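(* Given a partial cube $G$ with $n$ vertices and an isometric embedding $G\to Q_k$, where $k={\rm idim}(G)$, one can compute in $O(k^2 n)$ time an isometric embedding of $G$ into $\Gamma_{f'}$ for some $f'\le \tfrac{3}{2}\,{\rm fdim}(G)$.
   Context: All graphs are finite. The $d$-cube $Q_d$ has vertex set $\{0,1\}^d$, two vertices adjacent iff they differ in exactly one coordinate. A Fibonacci string is a binary string with no two consecutive $1$s; the Fibonacci cube $\Gamma_d$ is the subgraph of $Q_d$ induced by the Fibonacci strings of length $d$. An isometric embedding is an injective map preserving shortest-path distances; computing an embedding into $Q_d$ or $\Gamma_d$ means assigning to each vertex its binary $d$-tuple. A partial cube is a graph that isometrically embeds into some hypercube. ${\rm idim}(G)$ (resp. ${\rm fdim}(G)$) is the least $k$ such that $G$ isometrically embeds into $Q_k$ (resp. $\Gamma_k$). *)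

theory Defs
  imports "Graph_Theory.Graph_Theory"
begin

section \<open>Cubes, Fibonacci cubes and isometric embeddings\<close>

text \<open>
  Finite simple graphs are the symmetric loop-free digraphs of the locale \<^locale>\<open>pair_graph\<close>.
  Distances are shortest-path lengths with unit weights; they are infinite between
  different components.
\<close>

definition gdist :: "('a, 'b) pre_digraph \<Rightarrow> 'a \<Rightarrow> 'a \<Rightarrow> ereal" where
  "gdist G u v = wf_digraph.\<mu> G (\<lambda>_. 1) u v"

definition isometric_embedding ::
  "('a \<Rightarrow> 'c) \<Rightarrow> ('a, 'b) pre_digraph \<Rightarrow> ('c, 'd) pre_digraph \<Rightarrow> bool" where
  "isometric_embedding f G H \<longleftrightarrow>
     inj_on f (verts G) \<and> f ` verts G \<subseteq> verts H \<and>
     (\<forall>u\<in>verts G. \<forall>v\<in>verts G. gdist H (f u) (f v) = gdist G u v)"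

definition cube :: "nat \<Rightarrow> (bool list, bool list \<times> bool list) pre_digraph" where
  "cube d = with_proj
     \<lparr> pverts = {x. length x = d},
       parcs = {(x, y). length x = d \<and> length y = d \<and> card {i. i < d \<and> x ! i \<noteq> y ! i} = 1} \<rparr>"

definition fibonacci_string :: "bool list \<Rightarrow> bool" where
  "fibonacci_string x \<longleftrightarrow> (\<forall>i. Suc i < length x \<longrightarrow> \<not> (x ! i \<and> x ! Suc i))"

definition fib_cube :: "nat \<Rightarrow> (bool list, bool list \<times> bool list) pre_digraph" where
  "fib_cube d = cube d \<restriction> {x. length x = d \<and> fibonacci_string x}"

definition partial_cube :: "('a, 'b) pre_digraph \<Rightarrow> bool" where
  "partial_cube G \<longleftrightarrow> (\<exists>d f. isometric_embedding f G (cube d))"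

definition idim :: "('a, 'b) pre_digraph \<Rightarrow> nat" where
  "idim G = (LEAST k. \<exists>f. isometric_embedding f G (cube k))"

definition fdim :: "('a, 'b) pre_digraph \<Rightarrow> nat" where
  "fdim G = (LEAST k. \<exists>f. isometric_embedding f G (fib_cube k))"


section \<open>A unit-cost word RAM\<close>

text \<open>
  Programs are structured programs over named registers and finitely many named arrays, with
  indirect addressing. A word has \<open>w\<close> bits: arithmetic is modulo \<open>2 ^ w\<close>, except that
  subtraction is cut off at \<open>0\<close>; \<open>a div 0 = 0\<close> and \<open>a mod 0 = a\<close>, as in HOL. Every
  operation, memory access, assignment and test costs one unit of time.
\<close>

datatype aexp =
    Const nat
  | Reg string
  | Load string aexp
  | Plus aexp aexp
  | Minus aexp aexp
  | Times aexp aexp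
  | Div aexp aexp
  | Mod aexp aexp

datatype bexp = Less aexp aexp | Equal aexp aexp | Not bexp | And bexp bexp

datatype com =
    Skip
  | Assign string aexp
  | Store string aexp aexp
  | Seq com com
  | If bexp com com
  | While bexp com

record ram_state =
  reg :: "string \<Rightarrow> nat"
  mem :: "string \<Rightarrow> nat \<Rightarrow> nat"

primrec aval :: "nat \<Rightarrow> ram_state \<Rightarrow> aexp \<Rightarrow> nat" where
  "aval w s (Const c) = c mod 2 ^ w"
| "aval w s (Reg x) = reg s x"
| "aval w s (Load A i) = mem s A (aval w s i)"
| "aval w s (Plus a b) = (aval w s a + aval w s b) mod 2 ^ w"
| "aval w s (Minus a b) = aval w s a - aval w s b"
| "aval w s (Times a b) = (aval w s a * aval w s b) mod 2 ^ w"
| "aval w s (Div a b) = aval w s a div aval w s b"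
| "aval w s (Mod a b) = aval w s a mod aval w s b"

primrec bval :: "nat \<Rightarrow> ram_state \<Rightarrow> bexp \<Rightarrow> bool" where
  "bval w s (Less a b) \<longleftrightarrow> aval w s a < aval w s b"
| "bval w s (Equal a b) \<longleftrightarrow> aval w s a = aval w s b"
| "bval w s (Not b) \<longleftrightarrow> \<not> bval w s b"
| "bval w s (And b c) \<longleftrightarrow> bval w s b \<and> bval w s c"

primrec acost :: "aexp \<Rightarrow> nat" where
  "acost (Const c) = 1"
| "acost (Reg x) = 1"
| "acost (Load A i) = 1 + acost i"
| "acost (Plus a b) = 1 + acost a + acost b"
| "acost (Minus a b) = 1 + acost a + acost b"
| "acost (Times a b) = 1 + acost a + acost b"
| "acost (Div a b) = 1 + acost a + acost b"
| "acost (Mod a b) = 1 + acost a + acost b"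

primrec bcost :: "bexp \<Rightarrow> nat" where
  "bcost (Less a b) = 1 + acost a + acost b"
| "bcost (Equal a b) = 1 + acost a + acost b"
| "bcost (Not b) = 1 + bcost b"
| "bcost (And b c) = 1 + bcost b + bcost c"

text \<open>
  \<open>exec w c s t s'\<close>: with word size \<open>w\<close>, program \<open>c\<close> started in state \<open>s\<close> halts in state
  \<open>s'\<close> after exactly \<open>t\<close> units of time.
\<close>

inductive exec :: "nat \<Rightarrow> com \<Rightarrow> ram_state \<Rightarrow> nat \<Rightarrow> ram_state \<Rightarrow> bool" for w where
  Skip: "exec w Skip s 1 s"
| Assign: "exec w (Assign x a) s (1 + acost a) (s\<lparr>reg := (reg s)(x := aval w s a)\<rparr>)"
| Store: "exec w (Store A i a) s (1 + acost i + acost a)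
     (s\<lparr>mem := (mem s)(A := (mem s A)(aval w s i := aval w s a))\<rparr>)"
| Seq: "exec w c1 s1 t1 s2 \<Longrightarrow> exec w c2 s2 t2 s3 \<Longrightarrow> exec w (Seq c1 c2) s1 (t1 + t2) s3"
| IfTrue: "bval w s b \<Longrightarrow> exec w c1 s t s' \<Longrightarrow> exec w (If b c1 c2) s (1 + bcost b + t) s'"
| IfFalse: "\<not> bval w s b \<Longrightarrow> exec w c2 s t s' \<Longrightarrow> exec w (If b c1 c2) s (1 + bcost b + t) s'"
| WhileFalse: "\<not> bval w s b \<Longrightarrow> exec w (While b c) s (1 + bcost b) s"
| WhileTrue: "bval w s1 b \<Longrightarrow> exec w c s1 t1 s2 \<Longrightarrow> exec w (While b c) s2 t2 s3 \<Longrightarrow>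
     exec w (While b c) s1 (1 + bcost b + t1 + t2) s3"


section \<open>Input and output\<close>

definition list_array :: "nat list \<Rightarrow> nat \<Rightarrow> nat" where
  "list_array xs j = (if j < length xs then xs ! j else 0)"

text \<open>The binary tuples assigned to the vertices \<open>0, \<dots>, n - 1\<close>, one after the other.\<close>

definition tuple_cells :: "nat \<Rightarrow> (nat \<Rightarrow> bool list) \<Rightarrow> nat list" where
  "tuple_cells n f = concat (map (\<lambda>v. map of_bool (f v)) [0..<n])"

definition adjacency_lists :: "nat \<Rightarrow> nat pair_pre_digraph \<Rightarrow> nat list list \<Rightarrow> bool" where
  "adjacency_lists n G L \<longleftrightarrow>
     length L = n \<and> (\<forall>v<n. distinct (L ! v) \<and> set (L ! v) = {u. (v, u) \<in> parcs G})"

text \<open>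
  The neighbours of \<open>v\<close> occupy the cells \<open>off v, \<dots>, off (v + 1) - 1\<close> of the array \<open>adj\<close>.
  Everything that is not part of the input is initially zero.
\<close>

definition input_state ::
  "nat \<Rightarrow> nat \<Rightarrow> nat list list \<Rightarrow> (nat \<Rightarrow> bool list) \<Rightarrow> ram_state" where
  "input_state n k L \<phi> =
     \<lparr> reg = (\<lambda>_. 0)(''n'' := n, ''k'' := k),
       mem = (\<lambda>_ _. 0)
         (''adj'' := list_array (concat L),
          ''off'' := list_array (map (\<lambda>v. length (concat (take v L))) [0..<Suc n]),
          ''emb'' := list_array (tuple_cells n \<phi>)) \<rparr>"

definition output_state :: "ram_state \<Rightarrow> nat \<Rightarrow> nat \<Rightarrow> (nat \<Rightarrow> bool list) \<Rightarrow> bool" where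
  "output_state s n f \<psi> \<longleftrightarrow>
     reg s ''f'' = f \<and> map (mem s ''out'') [0..<n * f] = tuple_cells n \<psi>"

end

theory Submission
  imports Defs
begin

text \<open>
  Complement the coordinates so that vertex \<open>0\<close> becomes the zero string, and let \<open>A i\<close> be the
  set of vertices with bit \<open>i\<close> set. Every isometric embedding into a hypercube consists of
  the coordinates of the given one, some of them complemented, and of constant ones. Embeddings
  into Fibonacci cubes therefore arise by arranging the coordinates in chains, such that the
  signed sets of neighbours (\<open>A i\<close> or its complement) are disjoint, and separating the chains by
  zeros: \<open>p\<close> chains give \<open>f' = k + p - 1\<close>.

  Coordinates are inserted by increasing \<open>card (A x)\<close>, keeping the ends of different chains
  crossing (all four combinations of values occur). If \<open>x\<close> does not cross some end \<open>y\<close>, it is put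
  between \<open>y\<close> and its neighbour, provided that \<open>y\<close> is complemented, which \<open>y\<close> then ceases to be.
  Otherwise it is attached to \<open>y\<close>, and if it does not cross an end \<open>z\<close> of another chain, then
  also to \<open>z\<close>, joining the two chains. Otherwise \<open>x\<close> starts a new chain.

  Crossing coordinates are never neighbours in an embedding into a Fibonacci cube, so
  choosing an end of every chain shows \<open>2 p \<le> fdim G + 1\<close>. With \<open>k \<le> fdim G\<close> this gives the bound.
\<close>

section \<open>Hamming distance\<close>

text \<open>No set contains vertex \<open>0\<close>, so two complements always meet, and two sets
  that do not cross are disjoint or nested. As \<open>x\<close> comes after all smaller sets,
  \<open>A x\<close> is never inside the set of a placed coordinate; so if it does not cross
  \<open>y\<close>, then \<open>A x\<close> or its complement is disjoint from \<open>A y\<close>,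
  and \<open>x\<close> fits beside an uncomplemented \<open>y\<close>. The obstacle is a
  complemented end \<open>y\<close>. Beside the complement of \<open>A y\<close> only a subset of
  \<open>A y\<close> may stand; \<open>A x\<close> is none because of its size, and its complement
  is none because it contains \<open>0\<close>. So \<open>x\<close> cannot be put outside of
  \<open>y\<close>, and the two have to be rearranged. The invariant concerns only ends because the
  lower bound needs just one member per chain. A coordinate that lands inside a chain may therefore
  fail to cross any number of other ones; this is why joining two chains need not look at a third.
  One placement compares \<open>x\<close> with at most \<open>k\<close> ends, each time running over
  the \<open>n\<close> vertices. With \<open>k\<close> placements this gives the time
  \<open>k ^ 2 * n\<close>.\<close>

definition ham :: "bool list \<Rightarrow> bool list \<Rightarrow> nat" where
  "ham x y = card {i. i < length x \<and> x ! i \<noteq> y ! i}"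

lemma ham_self [simp]: "ham x x = 0"
  by (simp add: ham_def)

lemma ham_eq_0: "length x = length y \<Longrightarrow> ham x y = 0 \<longleftrightarrow> x = y"
  by (auto simp: ham_def list_eq_iff_nth_eq)

lemma ham_triangle:
  assumes "length x = length y"
  shows "ham x z \<le> ham x y + ham y z"
proof -
  have "{i. i < length x \<and> x ! i \<noteq> z ! i} \<subseteq>
      {i. i < length x \<and> x ! i \<noteq> y ! i} \<union> {i. i < length y \<and> y ! i \<noteq> z ! i}"
    using assms by auto
  then have "ham x z \<le> card ({i. i < length x \<and> x ! i \<noteq> y ! i} \<union> {i. i < length y \<and> y ! i \<noteq> z ! i})"
    unfolding ham_def by (intro card_mono) auto
  also have "\<dots> \<le> ham x y + ham y z"
    unfolding ham_def by (rule card_Un_le)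
  finally show ?thesis .
qed

lemma ham_flip:
  assumes "i < length x"
  shows "ham x (x[i := b]) = of_bool (x ! i \<noteq> b)"
proof -
  have "{j. j < length x \<and> x ! j \<noteq> x[i := b] ! j} = (if x ! i \<noteq> b then {i} else {})"
    using assms by (auto simp: nth_list_update split: if_splits)
  then show ?thesis by (simp add: ham_def)
qed

lemma ham_flip_step:
  assumes "i < length x" "length x = length y" "x ! i \<noteq> y ! i"
  shows "ham x y = Suc (ham (x[i := y ! i]) y)"
proof -
  have "{j. j < length x \<and> x ! j \<noteq> y ! j} =
      insert i {j. j < length (x[i := y ! i]) \<and> x[i := y ! i] ! j \<noteq> y ! j}"
    using assms by (auto simp: nth_list_update split: if_splits)
  then have "ham x y = card (insert i {j. j < length (x[i := y ! i]) \<and> x[i := y ! i] ! j \<noteq> y ! j})"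
    unfolding ham_def by (rule arg_cong)
  also have "\<dots> = Suc (ham (x[i := y ! i]) y)"
    unfolding ham_def by (rule card_insert_disjoint) (use assms in auto)
  finally show ?thesis .
qed

lemma ham_1:
  assumes "ham x y = 1" "length x = length y"
  obtains i where "i < length x" "x ! i \<noteq> y ! i" "y = x[i := \<not> x ! i]"
proof -
  from assms(1) obtain i where "{i. i < length x \<and> x ! i \<noteq> y ! i} = {i}"
    unfolding ham_def by (auto simp: card_1_singleton_iff)
  then have eq_iff: "j < length x \<and> x ! j \<noteq> y ! j \<longleftrightarrow> j = i" for j by blast
  then have "i < length x" "x ! i \<noteq> y ! i" by blast+
  moreover have "y = x[i := \<not> x ! i]"
  proof (rule nth_equalityI)
    fix j assume "j < length y"
    then show "y ! j = x[i := \<not> x ! i] ! j"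
      using assms(2) \<open>x ! i \<noteq> y ! i\<close> eq_iff[of j] by (cases "j = i") auto
  qed (use assms in auto)
  ultimately show ?thesis by (rule that)
qed

text \<open>This reads a bit of \<open>y\<close> off distances alone: it tells which end of an edge
  in direction \<open>i\<close> is nearer to \<open>y\<close>. Distances do not depend on the
  embedding, so bits of different embeddings can be matched.\<close>

lemma ham_less_iff:
  assumes "length x = length y" "i < length x"
  shows "ham x y < ham (x[i := \<not> x ! i]) y \<longleftrightarrow> y ! i = x ! i"
proof (cases "y ! i = x ! i")
  case True
  have "ham (x[i := \<not> x ! i]) y = Suc (ham x y)"
    using ham_flip_step[of i "x[i := \<not> x ! i]" y] assms True by simp
  then show ?thesis using True by simp
next
  case False
  then have "y ! i = (\<not> x ! i)" by blast
  then have "ham x y = Suc (ham (x[i := \<not> x ! i]) y)"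
    using ham_flip_step[of i x y] assms by simp
  then show ?thesis using False by simp
qed

text \<open>A common criterion for both families of cubes. Each arc changes one bit, so no walk is
  shorter than the Hamming distance; \<open>step\<close> lets a greedy walk attain it. For an
  induced subgraph only \<open>step\<close> is in question.\<close>

lemma gdist_eq_ham:
  fixes H :: "(bool list, 'b) pre_digraph"
  assumes wf: "wf_digraph H"
    and len: "\<And>x. x \<in> verts H \<Longrightarrow> length x = d"
    and arc: "\<And>e. e \<in> arcs H \<Longrightarrow> ham (tail H e) (head H e) = 1"
    and step: "\<And>x y. x \<in> verts H \<Longrightarrow> y \<in> verts H \<Longrightarrow> x \<noteq> y \<Longrightarrow>
      \<exists>e\<in>arcs H. tail H e = x \<and> ham x y = Suc (ham (head H e) y)"
    and x: "x \<in> verts H" and y: "y \<in> verts H"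
  shows "gdist H x y = ereal (real (ham x y))"
proof -
  interpret wf_digraph H by (rule wf)
  have cost: "awalk_cost (\<lambda>_. 1) p = real (length p)" for p :: "'b list"
    by (induction p) auto
  have lower: "ham x y \<le> length p" if "awalk x p y" for p
    using that
  proof (induction p arbitrary: x)
    case Nil
    then show ?case by (simp add: awalk_Nil_iff)
  next
    case (Cons e p)
    then have *: "e \<in> arcs H" "tail H e = x" "awalk (head H e) p y"
      by (auto simp: awalk_Cons_iff)
    have "ham x y \<le> ham x (head H e) + ham (head H e) y"
      using * by (intro ham_triangle) (auto simp: len)
    then show ?case using Cons.IH[OF *(3)] arc[OF *(1)] *(2) by simp
  qed
  have upper: "\<exists>p. awalk x p y \<and> length p = ham x y" if "x \<in> verts H" for x
    using that
  proof (induction "ham x y" arbitrary: x)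
    case 0
    then have "x = y" using ham_eq_0[of x y] len y by auto
    then show ?case using y by (auto simp: awalk_Nil_iff intro!: exI[of _ "[]"])
  next
    case (Suc m)
    then have "x \<noteq> y" by auto
    from step[OF Suc.prems y this] obtain e where
      e: "e \<in> arcs H" "tail H e = x" "ham x y = Suc (ham (head H e) y)" by blast
    with Suc.hyps(1)[of "head H e"] Suc.hyps(2) obtain p where
      "awalk (head H e) p y" "length p = ham (head H e) y" by auto
    then show ?case using e by (intro exI[of _ "e # p"]) (auto simp: awalk_Cons_iff)
  qed
  have "(INF p\<in>{p. awalk x p y}. ereal (awalk_cost (\<lambda>_. 1) p)) = ereal (real (ham x y))"
  proof (rule antisym)
    obtain p where p: "awalk x p y" "length p = ham x y" using upper[OF x] by blast
    show "(INF p\<in>{p. awalk x p y}. ereal (awalk_cost (\<lambda>_. 1) p)) \<le> ereal (real (ham x y))"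
      by (rule INF_lower2[of p]) (use p in \<open>auto simp: cost\<close>)
  qed (auto intro!: INF_greatest simp: cost lower)
  then show ?thesis by (simp add: gdist_def \<mu>_def)
qed

section \<open>Distances in cubes and Fibonacci cubes\<close>

lemma verts_cube [simp]: "verts (cube d) = {x. length x = d}"
  by (simp add: cube_def)

lemma arcs_cube: "arcs (cube d) = {(x, y). length x = d \<and> length y = d \<and> ham x y = 1}"
  by (auto simp: cube_def ham_def)

lemma ends_cube [simp]: "tail (cube d) = fst" "head (cube d) = snd"
  by (simp_all add: cube_def)

lemma gdist_cube:
  assumes "length x = d" "length y = d"
  shows "gdist (cube d) x y = ereal (real (ham x y))"
proof (rule gdist_eq_ham)
  show "wf_digraph (cube d)"
    by unfold_locales (auto simp: arcs_cube)
  fix x y assume *: "x \<in> verts (cube d)" "y \<in> verts (cube d)" "x \<noteq> y"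
  then obtain i where i: "i < length x" "x ! i \<noteq> y ! i"
    by (auto simp: list_eq_iff_nth_eq)
  then show "\<exists>e\<in>arcs (cube d). tail (cube d) e = x \<and> ham x y = Suc (ham (head (cube d) e) y)"
    using * by (intro bexI[of _ "(x, x[i := y ! i])"])
      (auto simp: arcs_cube ham_flip intro: ham_flip_step)
qed (use assms in \<open>auto simp: arcs_cube\<close>)

lemma verts_fib_cube [simp]: "verts (fib_cube d) = {x. length x = d \<and> fibonacci_string x}"
  by (simp add: fib_cube_def)

text \<open>To walk between Fibonacci strings, clear superfluous ones before setting missing ones.\<close>

lemma gdist_fib_cube:
  assumes "length x = d" "fibonacci_string x" "length y = d" "fibonacci_string y"
  shows "gdist (fib_cube d) x y = ereal (real (ham x y))"
proof (rule gdist_eq_ham)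
  show "wf_digraph (fib_cube d)"
    by unfold_locales (auto simp: fib_cube_def)
  fix x y assume *: "x \<in> verts (fib_cube d)" "y \<in> verts (fib_cube d)" "x \<noteq> y"
  have "\<exists>i<d. x ! i \<noteq> y ! i \<and> fibonacci_string (x[i := y ! i])"
  proof (cases "\<exists>i<d. x ! i \<and> \<not> y ! i")
    case True
    then obtain i where "i < d" "x ! i" "\<not> y ! i" by blast
    then show ?thesis using *
      by (intro exI[of _ i]) (auto simp: fibonacci_string_def nth_list_update)
  next
    case False
    from * obtain i where i: "i < d" "x ! i \<noteq> y ! i"
      by (auto simp: list_eq_iff_nth_eq)
    have "fibonacci_string (x[i := y ! i])"
      unfolding fibonacci_string_def
    proof (intro allI impI notI, elim conjE)
      fix j assume j: "Suc j < length (x[i := y ! i])" "x[i := y ! i] ! j" "x[i := y ! i] ! Suc j"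
      have "y ! j" "y ! Suc j"
        using j i * False by (auto simp: nth_list_update split: if_splits)
      then show False using * j(1) by (simp add: fibonacci_string_def)
    qed
    then show ?thesis using i by blast
  qed
  then obtain i where i: "i < d" "x ! i \<noteq> y ! i" "fibonacci_string (x[i := y ! i])" by blast
  then show "\<exists>e\<in>arcs (fib_cube d). tail (fib_cube d) e = x \<and>
      ham x y = Suc (ham (head (fib_cube d) e) y)"
    using * by (intro bexI[of _ "(x, x[i := y ! i])"])
      (auto simp: fib_cube_def arcs_cube ham_flip intro: ham_flip_step)
qed (use assms in \<open>auto simp: fib_cube_def arcs_cube\<close>)

lemma isometric_embedding_cube_iff:
  "isometric_embedding f G (cube d) \<longleftrightarrow>
    (\<forall>u\<in>verts G. length (f u) = d) \<and>
    (\<forall>u\<in>verts G. \<forall>v\<in>verts G. gdist G u v = ereal (real (ham (f u) (f v)))) \<and> inj_on f (verts G)"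
proof -
  have "(\<forall>u\<in>verts G. \<forall>v\<in>verts G. gdist (cube d) (f u) (f v) = gdist G u v) \<longleftrightarrow>
      (\<forall>u\<in>verts G. \<forall>v\<in>verts G. gdist G u v = ereal (real (ham (f u) (f v))))"
    if "\<forall>u\<in>verts G. length (f u) = d"
    using that gdist_cube by metis
  then show ?thesis unfolding isometric_embedding_def by (simp add: image_subset_iff) blast
qed

lemma isometric_embedding_fib_cube_iff:
  "isometric_embedding f G (fib_cube d) \<longleftrightarrow>
    (\<forall>u\<in>verts G. length (f u) = d \<and> fibonacci_string (f u)) \<and>
    (\<forall>u\<in>verts G. \<forall>v\<in>verts G. gdist G u v = ereal (real (ham (f u) (f v)))) \<and> inj_on f (verts G)"
proof -
  have "(\<forall>u\<in>verts G. \<forall>v\<in>verts G. gdist (fib_cube d) (f u) (f v) = gdist G u v) \<longleftrightarrow>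
      (\<forall>u\<in>verts G. \<forall>v\<in>verts G. gdist G u v = ereal (real (ham (f u) (f v))))"
    if "\<forall>u\<in>verts G. length (f u) = d \<and> fibonacci_string (f u)"
    using that gdist_fib_cube by metis
  then show ?thesis unfolding isometric_embedding_def by (simp add: image_subset_iff) blast
qed

section \<open>Isometric embeddings of minimal dimension\<close>

lemma ham_remove:
  assumes "length x = Suc d" "length y = Suc d" "i \<le> d" "x ! i = y ! i"
  shows "ham (take i x @ drop (Suc i) x) (take i y @ drop (Suc i) y) = ham x y"
proof -
  let ?r = "\<lambda>x::bool list. take i x @ drop (Suc i) x"
  let ?s = "\<lambda>j. if j < i then j else Suc j"
  have nth: "?r z ! j = z ! ?s j" if "length z = Suc d" "j < d" for z j
    using that assms(3) by (auto simp: nth_append)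
  let ?t = "\<lambda>j. if j < i then j else j - 1"
  have st: "?s (?t j) = j \<and> ?t j < d" if "j < Suc d" "x ! j \<noteq> y ! j" for j
  proof -
    have "j \<noteq> i" using that assms by auto
    then show ?thesis using that assms by auto
  qed
  have "bij_betw ?s {j. j < d \<and> ?r x ! j \<noteq> ?r y ! j} {j. j < Suc d \<and> x ! j \<noteq> y ! j}"
  proof (rule bij_betw_byWitness[where f' = ?t])
    show "?s ` {j. j < d \<and> ?r x ! j \<noteq> ?r y ! j} \<subseteq> {j. j < Suc d \<and> x ! j \<noteq> y ! j}"
      using assms by (auto simp: nth simp del: append_take_drop_id)
    show "?t ` {j. j < Suc d \<and> x ! j \<noteq> y ! j} \<subseteq> {j. j < d \<and> ?r x ! j \<noteq> ?r y ! j}"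
    proof (rule image_subsetI)
      fix j assume j: "j \<in> {j. j < Suc d \<and> x ! j \<noteq> y ! j}"
      then show "?t j \<in> {j. j < d \<and> ?r x ! j \<noteq> ?r y ! j}"
        using st[of j] nth[of x "?t j"] nth[of y "?t j"] assms by simp
    qed
    show "\<forall>j\<in>{j. j < d \<and> ?r x ! j \<noteq> ?r y ! j}. ?t (?s j) = j"
      by simp
    show "\<forall>j\<in>{j. j < Suc d \<and> x ! j \<noteq> y ! j}. ?s (?t j) = j"
      using st by blast
  qed
  then have "card {j. j < d \<and> ?r x ! j \<noteq> ?r y ! j} = card {j. j < Suc d \<and> x ! j \<noteq> y ! j}"
    by (rule bij_betw_same_card)
  then show ?thesis using assms by (simp add: ham_def)
qed

text \<open>Deleting a constant coordinate would preserve all distances and embed \<open>G\<close>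
  into a smaller cube, against the minimality of \<open>idim G\<close>.\<close>

lemma idim_coordinate_nonconstant:
  assumes emb: "isometric_embedding \<phi> G (cube (idim G))" and i: "i < idim G"
  shows "\<exists>u\<in>verts G. \<exists>v\<in>verts G. \<phi> u ! i \<noteq> \<phi> v ! i"
proof (rule ccontr)
  assume "\<not> ?thesis"
  then have const: "\<And>u v. u \<in> verts G \<Longrightarrow> v \<in> verts G \<Longrightarrow> \<phi> u ! i = \<phi> v ! i" by blast
  obtain d where d: "idim G = Suc d" using i by (cases "idim G") auto
  let ?f = "\<lambda>u. take i (\<phi> u) @ drop (Suc i) (\<phi> u)"
  note e = emb[unfolded isometric_embedding_cube_iff d]
  have ham: "ham (?f u) (?f v) = ham (\<phi> u) (\<phi> v)" if "u \<in> verts G" "v \<in> verts G" for u v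
    by (rule ham_remove[where d = d]) (use that e i d const[OF that] in auto)
  have "inj_on ?f (verts G)"
  proof (rule inj_onI)
    fix u v assume uv: "u \<in> verts G" "v \<in> verts G" "?f u = ?f v"
    then have "ham (\<phi> u) (\<phi> v) = 0" using ham by (metis ham_self)
    then show "u = v" using uv e ham_eq_0 by (metis inj_onD)
  qed
  then have "isometric_embedding ?f G (cube d)"
    unfolding isometric_embedding_cube_iff using e ham i d by auto
  then have "idim G \<le> d" unfolding idim_def by (intro Least_le) blast
  then show False using d by simp
qed

text \<open>All distances in the cube are finite, so a walk joins \<open>u\<close> to
  \<open>v\<close>, and bit \<open>i\<close> changes along some arc of it. The ends of this arc have
  distance at most 1, the length of the walk consisting of that arc.\<close>

lemma coordinate_has_edge:
  assumes wf: "wf_digraph G" and emb: "isometric_embedding \<phi> G (cube k)"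
    and u: "u \<in> verts G" "v \<in> verts G" "\<phi> u ! i \<noteq> \<phi> v ! i"
  shows "\<exists>a\<in>verts G. \<exists>b\<in>verts G. ham (\<phi> a) (\<phi> b) \<le> 1 \<and> \<phi> a ! i \<noteq> \<phi> b ! i"
proof -
  interpret wf_digraph G by (rule wf)
  note e = emb[unfolded isometric_embedding_cube_iff]
  have "u \<rightarrow>\<^sup>*\<^bsub>G\<^esub> v"
  proof (rule ccontr)
    assume "\<not> u \<rightarrow>\<^sup>*\<^bsub>G\<^esub> v"
    then have "gdist G u v = \<infinity>" unfolding gdist_def by (rule shortest_path_inf)
    then show False using e u by simp
  qed
  then obtain p where "awalk u p v" by (auto simp: reachable_awalk)
  then have "\<exists>a\<in>arcs G. \<phi> (tail G a) ! i \<noteq> \<phi> (head G a) ! i" using u(3)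
  proof (induction p arbitrary: u)
    case Nil
    then show ?case by (auto simp: awalk_Nil_iff)
  next
    case (Cons a p)
    then show ?case by (cases "\<phi> u ! i = \<phi> (head G a) ! i") (auto simp: awalk_Cons_iff)
  qed
  then obtain a where a: "a \<in> arcs G" "\<phi> (tail G a) ! i \<noteq> \<phi> (head G a) ! i" by blast
  have "awalk (tail G a) [a] (head G a)" using a by (simp add: arc_implies_awalk)
  then have "gdist G (tail G a) (head G a) \<le> ereal (awalk_cost (\<lambda>_. 1) [a])"
    unfolding gdist_def by (rule min_cost_le_walk_cost)
  then have "ham (\<phi> (tail G a)) (\<phi> (head G a)) \<le> 1" using e a by simp
  then show ?thesis using a tail_in_verts head_in_verts by blast
qed

section \<open>Coordinates of isometric embeddings\<close>

text \<open>The form in which the minimality of \<open>k\<close> is used: every direction of the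
  cube is represented by an edge of \<open>G\<close>. Hence no coordinate is constant, and no two
  are equal or complementary.\<close>

definition coordinate_edges :: "('a, 'b) pre_digraph \<Rightarrow> ('a \<Rightarrow> bool list) \<Rightarrow> nat \<Rightarrow> bool" where
  "coordinate_edges G \<phi> k \<longleftrightarrow>
    (\<forall>i<k. \<exists>a\<in>verts G. \<exists>b\<in>verts G. \<phi> b = (\<phi> a)[i := \<not> \<phi> a ! i])"

lemma idim_coordinate_edges:
  assumes wf: "wf_digraph G" and k: "k = idim G"
    and emb: "isometric_embedding \<phi> G (cube k)"
  shows "coordinate_edges G \<phi> k"
  unfolding coordinate_edges_def
proof (intro allI impI)
  fix i assume i: "i < k"
  note e = emb[unfolded isometric_embedding_cube_iff]
  obtain u v where "u \<in> verts G" "v \<in> verts G" "\<phi> u ! i \<noteq> \<phi> v ! i"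
    using idim_coordinate_nonconstant[of \<phi> G i] emb i k by blast
  from coordinate_has_edge[OF wf emb this] obtain a b where
    ab: "a \<in> verts G" "b \<in> verts G" "ham (\<phi> a) (\<phi> b) \<le> 1" "\<phi> a ! i \<noteq> \<phi> b ! i" by blast
  have len: "length (\<phi> a) = length (\<phi> b)" "length (\<phi> a) = k" using e ab by auto
  then have "ham (\<phi> a) (\<phi> b) \<noteq> 0" using ab by (auto simp: ham_eq_0)
  then have "ham (\<phi> a) (\<phi> b) = 1" using ab by simp
  from this len(1) obtain j where
    j: "j < length (\<phi> a)" "\<phi> a ! j \<noteq> \<phi> b ! j" "\<phi> b = (\<phi> a)[j := \<not> \<phi> a ! j]"
    by (rule ham_1)
  have "i = j" using ab(4) j(3) nth_list_update_neq by metis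
  then show "\<exists>a\<in>verts G. \<exists>b\<in>verts G. \<phi> b = (\<phi> a)[i := \<not> \<phi> a ! i]" using j ab by blast
qed

text \<open>The ends of an edge determine the direction in which they differ. The crude bound
  suffices for showing that all addresses fit into a word.\<close>

lemma coordinate_edges_bound:
  assumes emb: "isometric_embedding \<phi> G (cube k)" and ce: "coordinate_edges G \<phi> k"
    and fin: "finite (verts G)"
  shows "k \<le> card (verts G) * card (verts G)"
proof -
  note e = emb[unfolded isometric_embedding_cube_iff]
  obtain a b where ab: "\<And>i. i < k \<Longrightarrow> a i \<in> verts G" "\<And>i. i < k \<Longrightarrow> b i \<in> verts G"
    "\<And>i. i < k \<Longrightarrow> \<phi> (b i) = (\<phi> (a i))[i := \<not> \<phi> (a i) ! i]"
    using ce unfolding coordinate_edges_def by metis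
  have "inj_on (\<lambda>i. (a i, b i)) {..<k}"
  proof (rule inj_onI)
    fix i j assume ij: "i \<in> {..<k}" "j \<in> {..<k}" "(a i, b i) = (a j, b j)"
    then have "\<phi> (b i) ! i \<noteq> \<phi> (a i) ! i" using ab[of i] e by auto
    then show "i = j" using ij ab(3)[of j] nth_list_update_neq[of j i] by fastforce
  qed
  then have "card {..<k} \<le> card (verts G \<times> verts G)"
    by (rule card_inj_on_le) (use ab fin in auto)
  then show ?thesis by (simp add: card_cartesian_product)
qed

text \<open>
  Up to complementation, the coordinates of \<open>\<phi>\<close> occur among those of every other isometric
  embedding. Two of them in all four combinations of values cannot be neighbours in
  Fibonacci strings.
\<close>

lemma fib_cube_lower_bound:
  assumes emb: "isometric_embedding \<phi> G (cube k)" and ce: "coordinate_edges G \<phi> k"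
    and fib: "isometric_embedding \<psi> G (fib_cube F)"
    and I: "I \<subseteq> {..<k}"
    and cross: "\<And>i j p q. i \<in> I \<Longrightarrow> j \<in> I \<Longrightarrow> i \<noteq> j \<Longrightarrow>
      \<exists>v\<in>verts G. \<phi> v ! i = p \<and> \<phi> v ! j = q"
  shows "k \<le> F" and "2 * card I \<le> Suc F"
proof -
  note e = emb[unfolded isometric_embedding_cube_iff]
  note f = fib[unfolded isometric_embedding_fib_cube_iff]
  have len: "length (\<phi> u) = k" "length (\<psi> u) = F" if "u \<in> verts G" for u
    using e f that by auto
  have ham: "ham (\<phi> u) (\<phi> v) = ham (\<psi> u) (\<psi> v)" if "u \<in> verts G" "v \<in> verts G" for u v
    using e f that by (metis ereal.inject of_nat_eq_iff)
  obtain a b where ab: "\<And>i. i < k \<Longrightarrow> a i \<in> verts G" "\<And>i. i < k \<Longrightarrow> b i \<in> verts G"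
    "\<And>i. i < k \<Longrightarrow> \<phi> (b i) = (\<phi> (a i))[i := \<not> \<phi> (a i) ! i]"
    using ce unfolding coordinate_edges_def by metis
  \<comment> \<open>The edge from \<open>a i\<close> to \<open>b i\<close> flips a single bit
    \<open>j\<close> also under \<open>\<psi>\<close>. Whether \<open>v\<close> is nearer to
    \<open>a i\<close> or to \<open>b i\<close> decides bit \<open>i\<close> of
    \<open>\<phi> v\<close> as well as bit \<open>j\<close> of \<open>\<psi> v\<close>.\<close>
  have "\<exists>j<F. \<forall>v\<in>verts G. \<phi> v ! i = \<phi> (a i) ! i \<longleftrightarrow> \<psi> v ! j = \<psi> (a i) ! j" if i: "i < k" for i
  proof -
    have "ham (\<psi> (a i)) (\<psi> (b i)) = 1"
      using ham[of "a i" "b i"] ab[OF i] len i by (simp add: ham_flip)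
    then obtain j where j: "j < length (\<psi> (a i))" "\<psi> (b i) = (\<psi> (a i))[j := \<not> \<psi> (a i) ! j]"
      by (rule ham_1) (use ab[OF i] len in auto)
    have "\<phi> v ! i = \<phi> (a i) ! i \<longleftrightarrow> \<psi> v ! j = \<psi> (a i) ! j" if v: "v \<in> verts G" for v
      using ham_less_iff[of "\<phi> (a i)" "\<phi> v" i] ham_less_iff[of "\<psi> (a i)" "\<psi> v" j]
        ham[of "a i" v] ham[of "b i" v] ab[OF i] len[OF v] len[of "a i"] i v j by simp
    moreover have "j < F" using j ab[OF i] len[of "a i"] by auto
    ultimately show ?thesis by blast
  qed
  then obtain \<sigma> where \<sigma>: "\<And>i. i < k \<Longrightarrow> \<sigma> i < F"
    "\<And>i v. i < k \<Longrightarrow> v \<in> verts G \<Longrightarrow> \<phi> v ! i = \<phi> (a i) ! i \<longleftrightarrow> \<psi> v ! \<sigma> i = \<psi> (a i) ! \<sigma> i"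
    by metis
  have inj: "inj_on \<sigma> {..<k}"
  proof (rule inj_onI)
    fix i j assume ij: "i \<in> {..<k}" "j \<in> {..<k}" "\<sigma> i = \<sigma> j"
    show "i = j"
    proof (rule ccontr)
      assume "i \<noteq> j"
      have i: "i < k" and j: "j < k" using ij by auto
      \<comment> \<open>The edge of direction \<open>i\<close> changes bit \<open>i\<close> and
        keeps bit \<open>j\<close>, whereas both bits would be governed by the same position of
        \<open>\<psi>\<close>.\<close>
      have "\<phi> (b i) ! i \<noteq> \<phi> (a i) ! i" "\<phi> (b i) ! j = \<phi> (a i) ! j"
        using ab[OF i] len i j \<open>i \<noteq> j\<close> by (auto simp: nth_list_update)
      then show False
        using \<sigma>(2)[OF i, of "b i"] \<sigma>(2)[OF j, of "b i"] \<sigma>(2)[OF j, of "a i"] ab(1,2)[OF i]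
        unfolding ij(3) by argo
    qed
  qed
  have "card {..<k} \<le> card {..<F}"
    by (rule card_inj_on_le[OF inj]) (use \<sigma> in auto)
  then show "k \<le> F" by simp
  have nonconsec: "\<sigma> j \<noteq> Suc (\<sigma> i)" if ij: "i \<in> I" "j \<in> I" for i j
  proof
    assume s: "\<sigma> j = Suc (\<sigma> i)"
    then have "i \<noteq> j" by auto
    have i: "i < k" and j: "j < k" using ij I by auto
    \<comment> \<open>The two prescribed values are those that force ones at both positions
      \<open>\<sigma> i\<close> and \<open>\<sigma> j\<close> of \<open>\<psi> v\<close>.\<close>
    obtain v where v: "v \<in> verts G"
      "\<phi> v ! i = (\<phi> (a i) ! i = (\<psi> (a i) ! \<sigma> i))" "\<phi> v ! j = (\<phi> (a j) ! j = (\<psi> (a j) ! \<sigma> j))"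
      using cross[OF ij \<open>i \<noteq> j\<close>] by blast
    have "\<psi> v ! \<sigma> i" "\<psi> v ! \<sigma> j"
      using \<sigma>(2)[OF i v(1)] \<sigma>(2)[OF j v(1)] v by auto
    moreover have "length (\<psi> v) = F" "fibonacci_string (\<psi> v)" using f v by auto
    ultimately show False using s \<sigma>(1)[OF j] unfolding fibonacci_string_def by metis
  qed
  have fin: "finite I" using I finite_subset by blast
  have injI: "inj_on \<sigma> I" using inj I inj_on_subset by blast
  then have injS: "inj_on (\<lambda>i. Suc (\<sigma> i)) I" by (auto simp: inj_on_def)
  \<comment> \<open>No two of the chosen positions are consecutive, so they and their successors are
    all different. They lie among the \<open>F + 1\<close> numbers up to \<open>F\<close>.\<close>
  have "card (\<sigma> ` I \<union> (\<lambda>i. Suc (\<sigma> i)) ` I) = card I + card I"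
    using fin nonconsec by (subst card_Un_disjoint) (auto simp: card_image injI injS)
  moreover have "card (\<sigma> ` I \<union> (\<lambda>i. Suc (\<sigma> i)) ` I) \<le> card {..F}"
    using \<sigma>(1) I by (intro card_mono) (auto simp: Suc_le_eq subset_iff intro: less_imp_le)
  ultimately show "2 * card I \<le> Suc F" by simp
qed

section \<open>Chains of coordinates\<close>

text \<open>The interval starts above \<open>0\<close> because the coordinates are normalised at
  vertex \<open>0\<close>. Distinctness turns the weak order by size into strictness: a set that is
  no smaller and different cannot be included.\<close>

locale set_family =
  fixes n k :: nat and A :: "nat \<Rightarrow> nat set"
  assumes subset: "y < k \<Longrightarrow> A y \<subseteq> {0<..<n}"
    and nonempty: "y < k \<Longrightarrow> A y \<noteq> {}"
    and distinct: "y < k \<Longrightarrow> z < k \<Longrightarrow> A y = A z \<Longrightarrow> y = z"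
begin

definition signed :: "nat \<Rightarrow> nat \<Rightarrow> nat set" where
  "signed s y = (if s = 0 then A y else {..<n} - A y)"

text \<open>The fourth combination of values, outside both sets, is always realised by vertex
  \<open>0\<close>.\<close>

definition crossing :: "nat \<Rightarrow> nat \<Rightarrow> bool" where
  "crossing y z \<longleftrightarrow> A y \<inter> A z \<noteq> {} \<and> A y - A z \<noteq> {} \<and> A z - A y \<noteq> {}"

text \<open>
  Coordinate \<open>y\<close> is at position \<open>pos y\<close> of the chain \<open>pid y\<close>, which has \<open>len (pid y)\<close>
  members, and \<open>sg y \<noteq> 0\<close> means that it is complemented; \<open>pid y = 0\<close> if it has not been
  placed yet. Chain numbers without members have length \<open>0\<close>.
\<close>

definition chains ::
  "(nat \<Rightarrow> nat) \<Rightarrow> (nat \<Rightarrow> nat) \<Rightarrow> (nat \<Rightarrow> nat) \<Rightarrow> (nat \<Rightarrow> nat) \<Rightarrow> bool" where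
  "chains pid pos len sg \<longleftrightarrow>
    (\<forall>y<k. pid y \<noteq> 0 \<longrightarrow> pid y \<le> k \<and> pos y < len (pid y)) \<and>
    (\<forall>y<k. \<forall>z<k. pid y \<noteq> 0 \<longrightarrow> pid y = pid z \<longrightarrow> pos y = pos z \<longrightarrow> y = z) \<and>
    (\<forall>y<k. \<forall>z<k. pid y \<noteq> 0 \<longrightarrow> pid y = pid z \<longrightarrow> pos z = Suc (pos y) \<longrightarrow>
      signed (sg y) y \<inter> signed (sg z) z = {}) \<and>
    (\<forall>q. \<forall>j<len q. \<exists>y<k. pid y = q \<and> pos y = j) \<and>
    (\<forall>y<k. pid y \<noteq> 0 \<longrightarrow> sg y \<noteq> 0 \<longrightarrow> 2 \<le> len (pid y)) \<and>
    (\<forall>y<k. pid y = 0 \<longrightarrow> len (Suc y) = 0) \<and>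
    len 0 = 0"

lemma chainsI:
  assumes "\<And>y. y < k \<Longrightarrow> pid y \<noteq> 0 \<Longrightarrow> pid y \<le> k"
    and "\<And>y. y < k \<Longrightarrow> pid y \<noteq> 0 \<Longrightarrow> pos y < len (pid y)"
    and "\<And>y z. y < k \<Longrightarrow> z < k \<Longrightarrow> pid y \<noteq> 0 \<Longrightarrow> pid y = pid z \<Longrightarrow> pos y = pos z \<Longrightarrow> y = z"
    and "\<And>y z. y < k \<Longrightarrow> z < k \<Longrightarrow> pid y \<noteq> 0 \<Longrightarrow> pid y = pid z \<Longrightarrow> pos z = Suc (pos y) \<Longrightarrow>
      signed (sg y) y \<inter> signed (sg z) z = {}"
    and "\<And>q j. j < len q \<Longrightarrow> \<exists>y<k. pid y = q \<and> pos y = j"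
    and "\<And>y. y < k \<Longrightarrow> pid y \<noteq> 0 \<Longrightarrow> sg y \<noteq> 0 \<Longrightarrow> 2 \<le> len (pid y)"
    and "\<And>y. y < k \<Longrightarrow> pid y = 0 \<Longrightarrow> len (Suc y) = 0"
    and "len 0 = 0"
  shows "chains pid pos len sg"
  unfolding chains_def using assms by blast

lemma chainsD:
  assumes "chains pid pos len sg"
  shows "\<And>y. y < k \<Longrightarrow> pid y \<noteq> 0 \<Longrightarrow> pid y \<le> k"
    and "\<And>y. y < k \<Longrightarrow> pid y \<noteq> 0 \<Longrightarrow> pos y < len (pid y)"
    and "\<And>y z. y < k \<Longrightarrow> z < k \<Longrightarrow> pid y \<noteq> 0 \<Longrightarrow> pid y = pid z \<Longrightarrow> pos y = pos z \<Longrightarrow> y = z"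
    and "\<And>y z. y < k \<Longrightarrow> z < k \<Longrightarrow> pid y \<noteq> 0 \<Longrightarrow> pid y = pid z \<Longrightarrow> pos z = Suc (pos y) \<Longrightarrow>
      signed (sg y) y \<inter> signed (sg z) z = {}"
    and "\<And>q j. j < len q \<Longrightarrow> \<exists>y<k. pid y = q \<and> pos y = j"
    and "\<And>y. y < k \<Longrightarrow> pid y \<noteq> 0 \<Longrightarrow> sg y \<noteq> 0 \<Longrightarrow> 2 \<le> len (pid y)"
    and "\<And>y. y < k \<Longrightarrow> pid y = 0 \<Longrightarrow> len (Suc y) = 0"
    and "len 0 = 0"
  using assms unfolding chains_def by simp_all

definition chain_end :: "(nat \<Rightarrow> nat) \<Rightarrow> (nat \<Rightarrow> nat) \<Rightarrow> (nat \<Rightarrow> nat) \<Rightarrow> nat \<Rightarrow> bool" where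
  "chain_end pid pos len y \<longleftrightarrow> pid y \<noteq> 0 \<and> (pos y = 0 \<or> Suc (pos y) = len (pid y))"

definition ends_cross :: "(nat \<Rightarrow> nat) \<Rightarrow> (nat \<Rightarrow> nat) \<Rightarrow> (nat \<Rightarrow> nat) \<Rightarrow> bool" where
  "ends_cross pid pos len \<longleftrightarrow> (\<forall>y<k. \<forall>z<k. chain_end pid pos len y \<longrightarrow>
    chain_end pid pos len z \<longrightarrow> pid y \<noteq> pid z \<longrightarrow> crossing y z)"

lemma ends_crossD:
  "ends_cross pid pos len \<Longrightarrow> y < k \<Longrightarrow> z < k \<Longrightarrow> chain_end pid pos len y \<Longrightarrow>
    chain_end pid pos len z \<Longrightarrow> pid y \<noteq> pid z \<Longrightarrow> crossing y z"
  unfolding ends_cross_def by blast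

section \<open>Operations on chains\<close>

definition rev_pos ::
  "(nat \<Rightarrow> nat) \<Rightarrow> (nat \<Rightarrow> nat) \<Rightarrow> (nat \<Rightarrow> nat) \<Rightarrow> nat \<Rightarrow> nat \<Rightarrow> nat" where
  "rev_pos pid pos len q = (\<lambda>y. if y < k \<and> pid y = q then len q - 1 - pos y else pos y)"

text \<open>Disjointness of neighbours is symmetric, so chains have no direction. This is why
  attaching and inserting are treated at the last position only.\<close>

lemma chains_rev:
  assumes c: "chains pid pos len sg" and q: "q \<noteq> 0"
  shows "chains pid (rev_pos pid pos len q) len sg"
proof (rule chainsI)
  note D = chainsD[OF c]
  show "rev_pos pid pos len q y < len (pid y)" if "y < k" "pid y \<noteq> 0" for y
    using D(2)[OF that] by (auto simp: rev_pos_def)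
  show "y = z" if "y < k" "z < k" "pid y \<noteq> 0" "pid y = pid z"
    "rev_pos pid pos len q y = rev_pos pid pos len q z" for y z
    using D(2)[of y] D(2)[of z] D(3)[of y z] that by (auto simp: rev_pos_def split: if_splits)
  show "signed (sg y) y \<inter> signed (sg z) z = {}"
    if "y < k" "z < k" "pid y \<noteq> 0" "pid y = pid z"
    "rev_pos pid pos len q z = Suc (rev_pos pid pos len q y)" for y z
  proof (cases "pid y = q")
    case True
    then have "pid z = q" "pos y < len q" "pos z < len q"
      "len q - 1 - pos z = Suc (len q - 1 - pos y)"
      using D(2)[of y] D(2)[of z] that by (simp_all add: rev_pos_def)
    then have "pos y = Suc (pos z)" by linarith
    then have "signed (sg z) z \<inter> signed (sg y) y = {}" 
      using D(4)[OF that(2,1)] that(3,4) by metis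
    then show ?thesis by (simp add: Int_commute)
  next
    case False
    then show ?thesis using D(4)[of y z] that by (simp add: rev_pos_def)
  qed
  show "\<exists>y<k. pid y = p \<and> rev_pos pid pos len q y = j" if j: "j < len p" for p j
  proof (cases "p = q")
    case True
    then have "len q - 1 - j < len q" using j by auto
    then obtain y where "y < k" "pid y = q" "pos y = len q - 1 - j" using D(5) by blast
    then show ?thesis using j True by (intro exI[of _ y]) (auto simp: rev_pos_def)
  next
    case False
    obtain y where "y < k" "pid y = p" "pos y = j" using D(5)[OF j] by blast
    then show ?thesis using False by (intro exI[of _ y]) (auto simp: rev_pos_def)
  qed
qed (use chainsD[OF c] in auto)

lemma chain_end_rev:
  assumes c: "chains pid pos len sg" and y: "y < k"
  shows "chain_end pid (rev_pos pid pos len q) len y \<longleftrightarrow> chain_end pid pos len y"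
  using chainsD(2)[OF c y] y by (auto simp: chain_end_def rev_pos_def)

lemma ends_cross_rev:
  assumes c: "chains pid pos len sg" and e: "ends_cross pid pos len"
  shows "ends_cross pid (rev_pos pid pos len q) len"
  using e unfolding ends_cross_def by (simp add: chain_end_rev[OF c])

text \<open>The number \<open>Suc x\<close> is reserved for a chain founded by \<open>x\<close>, so
  it is free as long as \<open>x\<close> is unplaced; the successor keeps \<open>0\<close> for
  unplaced coordinates.\<close>

lemma chains_singleton:
  assumes c: "chains pid pos len sg" and x: "x < k" "pid x = 0"
  shows "chains (pid(x := Suc x)) (pos(x := 0)) (len(Suc x := 1)) (sg(x := 0))"
proof -
  note D = chainsD[OF c]
  have l: "len (Suc x) = 0" using D(7) x by blast
  have p: "\<forall>y<k. pid y \<noteq> Suc x" using D(2) l by fastforce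
  show ?thesis
  proof (rule chainsI)
    show "\<exists>y<k. (pid(x := Suc x)) y = q \<and> (pos(x := 0)) y = j"
      if j: "j < (len(Suc x := 1)) q" for q j
    proof (cases "q = Suc x")
      case True
      then show ?thesis using j x by auto
    next
      case False
      then have "j < len q" using j by simp
      then obtain y where "y < k" "pid y = q" "pos y = j" using D(5) by blast
      then show ?thesis using D(8) \<open>j < len q\<close> x by (intro exI[of _ y]) auto
    qed
  qed (use D x p l in \<open>auto split: if_splits\<close>)
qed

lemma chain_end_singleton:
  assumes c: "chains pid pos len sg" and x: "x < k" "pid x = 0" and y: "y < k"
  shows "chain_end (pid(x := Suc x)) (pos(x := 0)) (len(Suc x := 1)) y \<longleftrightarrow>
    y = x \<or> chain_end pid pos len y"
  using chainsD(2,7)[OF c] x y by (force simp: chain_end_def)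

text \<open>The pair \<open>y\<close>, \<open>x\<close> is the only new pair of neighbours.
  Afterwards the chain has at least two members, so both signs are allowed for
  \<open>x\<close>.\<close>

lemma chains_attach:
  assumes c: "chains pid pos len sg" and x: "x < k" "pid x = 0"
    and y: "y < k" "pid y = q" "q \<noteq> 0" "Suc (pos y) = len q"
    and d: "signed (sg y) y \<inter> signed s x = {}"
  shows "chains (pid(x := q)) (pos(x := len q)) (len(q := Suc (len q))) (sg(x := s))"
proof -
  note D = chainsD[OF c]
  have less: "pos z < len q" if "z < k" "pid z = q" for z using D(2)[of z] that y by auto
  have xy: "x \<noteq> y" using x y by auto
  show ?thesis
  proof (rule chainsI)
    show "\<exists>w<k. (pid(x := q)) w = p \<and> (pos(x := len q)) w = j"
      if "j < (len(q := Suc (len q))) p" for p j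
    proof (cases "p = q \<and> j = len q")
      case True
      then show ?thesis using x by auto
    next
      case False
      then have "j < len p" using that by (auto split: if_splits)
      then obtain w where "w < k" "pid w = p" "pos w = j" using D(5) by blast
      then show ?thesis using D(8) \<open>j < len p\<close> x by (intro exI[of _ w]) auto
    qed
    show "z = w" if "z < k" "w < k" "(pid(x := q)) z \<noteq> 0"
      "(pid(x := q)) z = (pid(x := q)) w" "(pos(x := len q)) z = (pos(x := len q)) w" for z w
      using that less[of z] less[of w] D(3)[of z w] by (auto split: if_splits)
    show "signed ((sg(x := s)) z) z \<inter> signed ((sg(x := s)) w) w = {}"
      if zw: "z < k" "w < k" "(pid(x := q)) z \<noteq> 0" "(pid(x := q)) z = (pid(x := q)) w"
        "(pos(x := len q)) w = Suc ((pos(x := len q)) z)" for z w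
    proof (cases "w = x")
      case True
      then have "z \<noteq> x" "pid z = q" "pos z = pos y" using zw y by (auto split: if_splits)
      then have "z = y" using D(3)[of z y] zw y by auto
      then show ?thesis using True d xy by auto
    next
      case False
      then have "z \<noteq> x" using zw less[of w] by (auto split: if_splits)
      then show ?thesis using False zw D(4)[of z w] by auto
    qed
    show "(len(q := Suc (len q))) (Suc z) = 0" if "z < k" "(pid(x := q)) z = 0" for z
      using that D(7)[of z] y x D(7)[of x] by (auto split: if_splits)
    show "(pid(x := q)) z \<le> k" if "z < k" "(pid(x := q)) z \<noteq> 0" for z
      using that D(1)[of z] D(1)[of y] y by (auto split: if_splits)
    show "(pos(x := len q)) z < (len(q := Suc (len q))) ((pid(x := q)) z)"
      if "z < k" "(pid(x := q)) z \<noteq> 0" for z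
      using that D(2)[of z] by (auto split: if_splits)
    show "2 \<le> (len(q := Suc (len q))) ((pid(x := q)) z)"
      if "z < k" "(pid(x := q)) z \<noteq> 0" "(sg(x := s)) z \<noteq> 0" for z
      using that D(6)[of z] y by (auto split: if_splits)
    show "(len(q := Suc (len q))) 0 = 0" using D(8) y by auto
  qed
qed

lemma chain_end_attach:
  assumes c: "chains pid pos len sg" and x: "x < k" "pid x = 0"
    and y: "y < k" "pid y = q" "q \<noteq> 0" "Suc (pos y) = len q"
    and w: "w < k" "chain_end (pid(x := q)) (pos(x := len q)) (len(q := Suc (len q))) w" "w \<noteq> x"
  shows "chain_end pid pos len w"
  using chainsD(2)[OF c w(1)] x y w by (auto simp: chain_end_def split: if_splits)

text \<open>
  A complemented end \<open>y\<close> with neighbour \<open>m\<close> makes room for \<open>x\<close> between them: \<open>y\<close> loses its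
  complement, and what lies in the signed set of \<open>m\<close> lies in \<open>A y\<close>.
\<close>

lemma chains_insert:
  assumes c: "chains pid pos len sg" and x: "x < k" "pid x = 0"
    and y: "y < k" "pid y = q" "q \<noteq> 0" "Suc (pos y) = len q" "sg y \<noteq> 0"
    and d: "if s = 0 then A x \<inter> A y = {} else A y \<subseteq> A x"
  shows "chains (pid(x := q)) (pos(x := len q - 1, y := len q)) (len(q := Suc (len q)))
    (sg(x := s, y := 0))"
proof -
  note D = chainsD[OF c]
  define pid' pos' where "pid' = pid(x := q)" and "pos' = pos(x := len q - 1, y := len q)"
  note defs = this
  let ?len = "len(q := Suc (len q))" and ?sg = "sg(x := s, y := 0)"
  have less: "pos z < len q" if "z < k" "pid z = q" for z using D(2)[of z] that y by auto
  have less': "pos z < len q - 1" if "z < k" "pid z = q" "z \<noteq> y" for z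
    using less[of z] D(3)[of z y] that y by (cases "pos z = pos y") auto
  have xy: "x \<noteq> y" using x y by auto
  have px: "pos' x = pos y" and py: "pos' y = Suc (pos y)" using y(4) xy by (simp_all add: defs)
  have other: "pid v = q" "pos' v = pos v" "pos' v < pos y"
    if "v < k" "pid' v = q" "v \<noteq> x" "v \<noteq> y" for v
    using that less'[of v] y(4) by (simp_all add: defs)
  have not_in_q: "v \<noteq> x" "v \<noteq> y" "pid v = pid' v" "pos' v = pos v" if "pid' v \<noteq> q" for v
    using that xy y by (cases "v = x"; cases "v = y"; simp add: defs)+
  have "chains pid' pos' ?len ?sg"
  proof (rule chainsI)
    show "\<exists>w<k. pid' w = p \<and> pos' w = j" if "j < ?len p" for p j
    proof (cases "p = q \<and> len q - 1 \<le> j")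
      case True
      then have "j = len q \<or> j = len q - 1" using that by auto
      then show ?thesis
      proof
        assume "j = len q"
        then show ?thesis using True xy y by (intro exI[of _ y]) (auto simp: defs)
      next
        assume "j = len q - 1"
        then show ?thesis using True xy x by (intro exI[of _ x]) (auto simp: defs)
      qed
    next
      case False
      then have "j < len p" using that by (auto split: if_splits)
      then obtain w where w: "w < k" "pid w = p" "pos w = j" using D(5) by blast
      moreover have "w \<noteq> x" using w x D(8) \<open>j < len p\<close> by auto
      moreover have "w \<noteq> y" using False w y by auto
      ultimately show ?thesis by (intro exI[of _ w]) (auto simp: defs)
    qed
    show "z = w" if "z < k" "w < k" "pid' z \<noteq> 0" "pid' z = pid' w" "pos' z = pos' w" for z w
    proof (cases "pid' z = q")
      case True
      then have "pid' w = q" using that by simp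
      have xy_neq: "pos' v \<noteq> pos' u" if "v = x \<or> v = y" "u \<noteq> v" "u < k" "pid' u = q" for u v
      proof (cases "u = x \<or> u = y")
        case True
        then show ?thesis using that px py xy by auto
      next
        case False
        then have "pos' u < pos y" using other that by blast
        then show ?thesis using that px py by auto
      qed
      show ?thesis
      proof (rule ccontr)
        assume "z \<noteq> w"
        then have "z \<noteq> x" "z \<noteq> y" "w \<noteq> x" "w \<noteq> y"
          using xy_neq[of z w] xy_neq[of w z] that \<open>pid' w = q\<close> True by metis+
        then have "z = w"
          using other[OF that(1) True] other[OF that(2) \<open>pid' w = q\<close>] D(3)[OF that(1,2)] that(5) y(3)
          by metis
        then show False using \<open>z \<noteq> w\<close> by blast
      qed
    next
      case False
      then have "pid' w \<noteq> q" using that by simp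
      then show ?thesis
        using not_in_q[OF False] not_in_q[OF \<open>pid' w \<noteq> q\<close>] that D(3)[OF that(1,2)] by metis
    qed
    show "signed (?sg z) z \<inter> signed (?sg w) w = {}"
      if zw: "z < k" "w < k" "pid' z \<noteq> 0" "pid' z = pid' w" "pos' w = Suc (pos' z)" for z w
    proof (cases "pid' z = q")
      case False
      then have "pid' w \<noteq> q" using zw by simp
      then have "signed (sg z) z \<inter> signed (sg w) w = {}"
        using not_in_q[OF False] not_in_q[OF \<open>pid' w \<noteq> q\<close>] zw D(4)[OF zw(1,2)] by metis
      then show ?thesis using not_in_q[OF False] not_in_q[OF \<open>pid' w \<noteq> q\<close>] by simp
    next
      case True
      then have "pid' w = q" using zw by simp
      have oz: "pid z = q" "pos' z = pos z" "pos' z < pos y" if "z \<noteq> x" "z \<noteq> y"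
        using other[OF zw(1) True that] .
      have ow: "pid w = q" "pos' w = pos w" "pos' w < pos y" if "w \<noteq> x" "w \<noteq> y"
        using other[OF zw(2) \<open>pid' w = q\<close> that] .
      consider "w = y" | "w = x" | "w \<noteq> x" "w \<noteq> y" by blast
      \<comment> \<open>The neighbours in the new chain: \<open>x\<close> before \<open>y\<close>,
        the former neighbour of \<open>y\<close> before \<open>x\<close>, and pairs that were
        neighbours already.\<close>
      then have "z = x \<and> w = y \<or> z \<noteq> x \<and> z \<noteq> y \<and> pid z = q \<and> Suc (pos z) = pos y \<and> w = x \<or>
        z \<noteq> x \<and> z \<noteq> y \<and> w \<noteq> x \<and> w \<noteq> y \<and> pid z = q \<and> pid w = q \<and> pos w = Suc (pos z)"
      proof cases
        case 1
        then have "pos' z = pos y" using zw(5) py by simp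
        then show ?thesis using 1 oz py by fastforce
      next
        case 2
        then have "Suc (pos' z) = pos y" using zw(5) px by simp
        moreover from this have "z \<noteq> x" "z \<noteq> y" using px py by auto
        ultimately show ?thesis using 2 oz by metis
      next
        case 3
        then have "Suc (pos' z) < pos y" using zw(5) ow by simp
        then have "z \<noteq> x" "z \<noteq> y" using px py by auto
        then show ?thesis using 3 oz ow zw(5) by metis
      qed
      then consider "z = x" "w = y" | "z \<noteq> x" "z \<noteq> y" "pid z = q" "Suc (pos z) = pos y" "w = x"
        | "z \<noteq> x" "z \<noteq> y" "w \<noteq> x" "w \<noteq> y" "pid z = q" "pid w = q" "pos w = Suc (pos z)"
        by blast
      then show ?thesis
      proof cases
        case 1
        then show ?thesis using d xy by (auto simp: signed_def split: if_splits)
      next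
        case 2
        then have "signed (sg z) z \<inter> signed (sg y) y = {}" using D(4)[of z y] zw y by simp
        moreover have "signed (sg z) z \<subseteq> {..<n}"
          using subset[OF zw(1)] by (auto simp: signed_def)
        moreover have "signed (sg y) y = {..<n} - A y" using y(5) by (simp add: signed_def)
        ultimately have "signed (sg z) z \<subseteq> A y" by blast
        then show ?thesis using 2 d xy by (auto simp: signed_def split: if_splits)
      next
        case 3
        then show ?thesis using D(4)[of z w] zw y(3) by simp
      qed
    qed
    show "?len (Suc z) = 0" if "z < k" "pid' z = 0" for z
      using that D(7)[of z] y x D(7)[of x] by (auto simp: defs split: if_splits)
    show "pid' z \<le> k" if "z < k" "pid' z \<noteq> 0" for z
      using that D(1)[of z] D(1)[of y] y by (auto simp: defs split: if_splits)
    show "pos' z < ?len (pid' z)" if "z < k" "pid' z \<noteq> 0" for z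
      using that D(2)[of z] y by (auto simp: defs split: if_splits)
    show "2 \<le> ?len (pid' z)" if "z < k" "pid' z \<noteq> 0" "?sg z \<noteq> 0" for z
      using that D(6)[of z] y by (auto simp: defs split: if_splits)
    show "?len 0 = 0" using D(8) y by auto
  qed
  then show ?thesis unfolding defs .
qed

text \<open>A complemented end belongs to a chain of at least two members, so the position before it
  is not the first one, and \<open>x\<close> lands strictly inside.\<close>

lemma chain_end_insert:
  assumes c: "chains pid pos len sg" and x: "x < k" "pid x = 0"
    and y: "y < k" "pid y = q" "q \<noteq> 0" "Suc (pos y) = len q" "sg y \<noteq> 0"
    and w: "w < k"
      "chain_end (pid(x := q)) (pos(x := len q - 1, y := len q)) (len(q := Suc (len q))) w"
  shows "w \<noteq> x \<and> chain_end pid pos len w"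
  using chainsD(2)[OF c w(1)] chainsD(6)[OF c y(1)] x y w
  by (auto simp: chain_end_def split: if_splits)

text \<open>All positions of the second chain are shifted by the same amount, so \<open>y\<close>,
  \<open>z\<close> is the only new pair of neighbours. The number \<open>r\<close> becomes that of
  an empty chain.\<close>

lemma chains_append:
  assumes c: "chains pid pos len sg"
    and y: "y < k" "pid y = q" "q \<noteq> 0" "Suc (pos y) = len q"
    and z: "z < k" "pid z = r" "r \<noteq> 0" "pos z = 0" "q \<noteq> r"
    and d: "signed (sg y) y \<inter> signed (sg z) z = {}"
  shows "chains (\<lambda>w. if w < k \<and> pid w = r then q else pid w)
    (\<lambda>w. if w < k \<and> pid w = r then pos w + len q else pos w)
    (len(q := len q + len r, r := 0)) sg"
proof -
  note D = chainsD[OF c]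
  let ?pid = "\<lambda>w. if w < k \<and> pid w = r then q else pid w"
  let ?pos = "\<lambda>w. if w < k \<and> pid w = r then pos w + len q else pos w"
  let ?len = "len(q := len q + len r, r := 0)"
  have lq: "pos w < len q" if "w < k" "pid w = q" for w using D(2)[of w] that y by auto
  have lr: "pos w < len r" if "w < k" "pid w = r" for w using D(2)[of w] that z by auto
  show ?thesis
  proof (rule chainsI)
    show "\<exists>w<k. ?pid w = p \<and> ?pos w = j" if j: "j < ?len p" for p j
    proof (cases "p = q \<and> len q \<le> j")
      case True
      then have "j - len q < len r" using j z by auto
      then obtain w where "w < k" "pid w = r" "pos w = j - len q" using D(5) by blast
      then show ?thesis using True by (intro exI[of _ w]) auto
    next
      case False
      then have "j < len p" "p \<noteq> r" using j by (auto split: if_splits)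
      then obtain w where w: "w < k" "pid w = p" "pos w = j" using D(5) by blast
      then show ?thesis using \<open>p \<noteq> r\<close> by (intro exI[of _ w]) auto
    qed
    show "v = w" if "v < k" "w < k" "?pid v \<noteq> 0" "?pid v = ?pid w" "?pos v = ?pos w" for v w
      using that lq[of v] lq[of w] D(3)[of v w] z by (auto split: if_splits)
    show "signed (sg v) v \<inter> signed (sg w) w = {}"
      if vw: "v < k" "w < k" "?pid v \<noteq> 0" "?pid v = ?pid w" "?pos w = Suc (?pos v)" for v w
    proof (cases "pid v = pid w")
      case True
      then show ?thesis using vw z D(4)[OF vw(1,2)] by (simp split: if_splits)
    next
      case False
      then have vq: "pid v = q" "pid w = r" using vw lq[of w] by (simp_all split: if_splits)
      then have "Suc (pos v) = len q" "pos w = 0" using vw(1,2,5) lq[of v] z(5) by simp_all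
      then have "v = y" "w = z"
        using D(3)[of v y] D(3)[of w z] vw(1,2) y z vq by simp_all
      then show ?thesis using d by simp
    qed
    show "?len (Suc w) = 0" if "w < k" "?pid w = 0" for w
      using that D(7)[of w] y lq[of y] by (auto split: if_splits)
    show "?pid w \<le> k" if "w < k" "?pid w \<noteq> 0" for w
      using that D(1)[of w] D(1)[of y] y by (auto split: if_splits)
    show "?pos w < ?len (?pid w)" if "w < k" "?pid w \<noteq> 0" for w
      using that D(2)[of w] z by (auto split: if_splits)
    show "2 \<le> ?len (?pid w)" if "w < k" "?pid w \<noteq> 0" "sg w \<noteq> 0" for w
      using that D(6)[of w] z by (auto split: if_splits)
    show "?len 0 = 0" using D(8) y by auto
  qed
qed

text \<open>As \<open>y\<close> is not the first member of its chain, it is enclosed at the seam.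
  For a freshly attached \<open>y\<close> this means that it never has to satisfy the crossing
  condition.\<close>

lemma chain_end_append:
  assumes c: "chains pid pos len sg"
    and y: "y < k" "pid y = q" "q \<noteq> 0" "Suc (pos y) = len q" "pos y \<noteq> 0"
    and z: "z < k" "pid z = r" "r \<noteq> 0" "pos z = 0" "q \<noteq> r"
    and w: "w < k" "chain_end (\<lambda>w. if w < k \<and> pid w = r then q else pid w)
    (\<lambda>w. if w < k \<and> pid w = r then pos w + len q else pos w)
    (len(q := len q + len r, r := 0)) w"
  shows "w \<noteq> y \<and> chain_end pid pos len w"
  using chainsD(2)[OF c w(1)] chainsD(2)[OF c z(1)] y z w
  by (auto simp: chain_end_def split: if_splits)

text \<open>
  If \<open>kind x y \<noteq> 0\<close>, then \<open>x\<close> can be put next to the uncomplemented \<open>y\<close>, with sign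
  \<open>kind x y - 1\<close>. The inclusion of \<open>A x\<close> in \<open>A y\<close> is missing because coordinates are
  inserted in the order of increasing size.
\<close>

definition "kind x y = (if A x \<inter> A y = {} then 1 else if A y \<subseteq> A x then 2 else 0 :: nat)"

section \<open>The insertion steps preserve the crossing of ends\<close>

definition ready :: "(nat \<Rightarrow> nat) \<Rightarrow> nat \<Rightarrow> bool" where
  "ready pid x \<longleftrightarrow> x < k \<and> pid x = 0 \<and> (\<forall>y<k. pid y \<noteq> 0 \<longrightarrow> card (A y) \<le> card (A x))"

definition valid :: "(nat \<Rightarrow> nat) \<Rightarrow> (nat \<Rightarrow> nat) \<Rightarrow> (nat \<Rightarrow> nat) \<Rightarrow> (nat \<Rightarrow> nat) \<Rightarrow> bool" where
  "valid pid pos len sg \<longleftrightarrow> chains pid pos len sg \<and> ends_cross pid pos len"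

lemma crossing_sym: "crossing x y \<longleftrightarrow> crossing y x"
  by (auto simp: crossing_def)

text \<open>What remains to be excluded is the inclusion of \<open>A x\<close> in
  \<open>A y\<close>. By the order of insertion it would be an equality, but \<open>x\<close> is
  unplaced and \<open>y\<close> is placed.\<close>

lemma kind_0:
  assumes "ready pid x" "y < k" "pid y \<noteq> 0" "kind x y = 0"
  shows "crossing x y" "crossing y x"
proof -
  have x: "x < k" "x \<noteq> y" "card (A y) \<le> card (A x)" using assms by (auto simp: ready_def)
  have "finite (A y)" using subset[OF assms(2)] finite_subset by blast
  then have "\<not> A x \<subseteq> A y"
    using x distinct[OF x(1) assms(2)] card_seteq[of "A y" "A x"] by blast
  then show "crossing x y"
    using assms(4) by (auto simp: kind_def crossing_def split: if_splits)
  then show "crossing y x" by (simp add: crossing_sym)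
qed

lemma kind_signed: "kind x y \<noteq> 0 \<Longrightarrow> A y \<inter> signed (kind x y - 1) x = {}"
  by (cases "A x \<inter> A y = {}"; cases "A y \<subseteq> A x") (auto simp: kind_def signed_def)

text \<open>If \<open>A x\<close> were disjoint from \<open>A y\<close> but contained \<open>A z\<close>, then \<open>A y\<close> and \<open>A z\<close> would be disjoint.\<close>

lemma kind_eq: "kind x y \<noteq> 0 \<Longrightarrow> kind x z \<noteq> 0 \<Longrightarrow> crossing y z \<Longrightarrow> kind x y = kind x z"
  by (auto simp: kind_def crossing_def split: if_splits)

lemma valid_rev: "valid pid pos len sg \<Longrightarrow> q \<noteq> 0 \<Longrightarrow> valid pid (rev_pos pid pos len q) len sg"
  unfolding valid_def using chains_rev ends_cross_rev by blast

lemma valid_singleton: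
  assumes i: "valid pid pos len sg" and x: "ready pid x"
    and none: "\<And>y. y < k \<Longrightarrow> chain_end pid pos len y \<Longrightarrow> kind x y = 0"
  shows "valid (pid(x := Suc x)) (pos(x := 0)) (len(Suc x := 1)) (sg(x := 0))"
proof -
  have c: "chains pid pos len sg" and e: "ends_cross pid pos len" using i by (auto simp: valid_def)
  have x': "x < k" "pid x = 0" using x by (auto simp: ready_def)
  have "ends_cross (pid(x := Suc x)) (pos(x := 0)) (len(Suc x := 1))"
    unfolding ends_cross_def
  proof (intro allI impI)
    fix y z
    assume yz: "y < k" "z < k" "(pid(x := Suc x)) y \<noteq> (pid(x := Suc x)) z"
      "chain_end (pid(x := Suc x)) (pos(x := 0)) (len(Suc x := 1)) y"
      "chain_end (pid(x := Suc x)) (pos(x := 0)) (len(Suc x := 1)) z"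
    note E = chain_end_singleton[OF c x']
    have nx: "crossing x w" "crossing w x" if "w < k" "chain_end pid pos len w" for w
      using kind_0[OF x that(1)] none[OF that] that(2) by (auto simp: chain_end_def)
    consider "y = x" "z \<noteq> x" | "y \<noteq> x" "z = x" | "y \<noteq> x" "z \<noteq> x" using yz(3) by blast
    then show "crossing y z"
    proof cases
      case 1
      then show ?thesis using nx E yz by blast
    next
      case 2
      then show ?thesis using nx E yz by blast
    next
      case 3
      then show ?thesis using ends_crossD[OF e yz(1,2)] E yz by auto
    qed
  qed
  then show ?thesis using chains_singleton[OF c x'] by (simp add: valid_def)
qed

text \<open>The ends after the insertion are old ends, so nothing has to be known about
  \<open>x\<close> and the other chains.\<close>

lemma valid_insert:
  assumes i: "valid pid pos len sg" and x: "ready pid x"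
    and y: "y < k" "pid y = q" "q \<noteq> 0" "Suc (pos y) = len q" "sg y \<noteq> 0" "kind x y \<noteq> 0"
  shows "valid (pid(x := q)) (pos(x := len q - 1, y := len q)) (len(q := Suc (len q)))
    (sg(x := kind x y - 1, y := 0))"
proof -
  have c: "chains pid pos len sg" and e: "ends_cross pid pos len" using i by (auto simp: valid_def)
  have x': "x < k" "pid x = 0" using x by (auto simp: ready_def)
  have d: "if kind x y - 1 = 0 then A x \<inter> A y = {} else A y \<subseteq> A x"
    using y(6) by (auto simp: kind_def split: if_splits)
  have "ends_cross (pid(x := q)) (pos(x := len q - 1, y := len q)) (len(q := Suc (len q)))"
    unfolding ends_cross_def
  proof (intro allI impI)
    fix u v
    assume uv: "u < k" "v < k" "(pid(x := q)) u \<noteq> (pid(x := q)) v"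
      "chain_end (pid(x := q)) (pos(x := len q - 1, y := len q)) (len(q := Suc (len q))) u"
      "chain_end (pid(x := q)) (pos(x := len q - 1, y := len q)) (len(q := Suc (len q))) v"
    then show "crossing u v"
      using chain_end_insert[OF c x' y(1-5) uv(1)] chain_end_insert[OF c x' y(1-5) uv(2)]
        ends_crossD[OF e uv(1,2)] by simp
  qed
  then show ?thesis using chains_insert[OF c x' y(1-5) d] by (simp add: valid_def)
qed

text \<open>Here \<open>x\<close> becomes an end itself, hence the assumption \<open>none\<close> on
  the ends of all other chains.\<close>

lemma valid_attach:
  assumes i: "valid pid pos len sg" and x: "ready pid x"
    and y: "y < k" "pid y = q" "q \<noteq> 0" "Suc (pos y) = len q" "sg y = 0" "kind x y \<noteq> 0"
    and none: "\<And>z. z < k \<Longrightarrow> chain_end pid pos len z \<Longrightarrow> pid z \<noteq> q \<Longrightarrow> kind x z = 0"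
  shows "valid (pid(x := q)) (pos(x := len q)) (len(q := Suc (len q))) (sg(x := kind x y - 1))"
proof -
  have c: "chains pid pos len sg" and e: "ends_cross pid pos len" using i by (auto simp: valid_def)
  have x': "x < k" "pid x = 0" using x by (auto simp: ready_def)
  have d: "signed (sg y) y \<inter> signed (kind x y - 1) x = {}"
    using kind_signed[OF y(6)] y(5) by (simp add: signed_def[of 0])
  have "ends_cross (pid(x := q)) (pos(x := len q)) (len(q := Suc (len q)))"
    unfolding ends_cross_def
  proof (intro allI impI)
    fix u v
    assume uv: "u < k" "v < k" "(pid(x := q)) u \<noteq> (pid(x := q)) v"
      "chain_end (pid(x := q)) (pos(x := len q)) (len(q := Suc (len q))) u"
      "chain_end (pid(x := q)) (pos(x := len q)) (len(q := Suc (len q))) v"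
    note E = chain_end_attach[OF c x' y(1-4)]
    have nx: "crossing x w" "crossing w x"
      if "w < k" "chain_end pid pos len w" "pid w \<noteq> q" for w
      using kind_0[OF x that(1)] none[OF that] that(2) by (auto simp: chain_end_def)
    consider "u = x" "v \<noteq> x" | "u \<noteq> x" "v = x" | "u \<noteq> x" "v \<noteq> x" using uv(3) by blast
    then show "crossing u v"
    proof cases
      case 1
      then show ?thesis using nx[of v] E[OF uv(2,5)] uv by simp
    next
      case 2
      then show ?thesis using nx[of u] E[OF uv(1,4)] uv by simp
    next
      case 3
      then show ?thesis
        using ends_crossD[OF e uv(1,2)] E[OF uv(1,4)] E[OF uv(2,5)] uv(3) by simp
    qed
  qed
  then show ?thesis using chains_attach[OF c x' y(1-4) d] by (simp add: valid_def)
qed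

text \<open>Attaching \<open>x\<close> and then appending the second chain encloses
  \<open>x\<close>, so no assumption on the remaining chains is made. The state in between may
  violate the invariant; only \<open>chains\<close> is carried through it.\<close>

lemma valid_join:
  assumes i: "valid pid pos len sg" and x: "ready pid x"
    and y: "y < k" "pid y = q" "q \<noteq> 0" "Suc (pos y) = len q" "sg y = 0" "kind x y \<noteq> 0"
    and z: "z < k" "pid z = r" "r \<noteq> 0" "q \<noteq> r" "pos z = 0" "sg z = 0" "kind x z \<noteq> 0"
  shows "valid (\<lambda>w. if w < k \<and> (pid(x := q)) w = r then q else (pid(x := q)) w)
    (\<lambda>w. if w < k \<and> (pid(x := q)) w = r then (pos(x := len q)) w + Suc (len q)
      else (pos(x := len q)) w)
    (len(q := Suc (len q) + len r, r := 0)) (sg(x := kind x y - 1))"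
proof -
  have c: "chains pid pos len sg" and e: "ends_cross pid pos len" using i by (auto simp: valid_def)
  have x': "x < k" "pid x = 0" using x by (auto simp: ready_def)
  have d: "signed (sg y) y \<inter> signed (kind x y - 1) x = {}"
    using kind_signed[OF y(6)] y(5) by (simp add: signed_def[of 0])
  note c' = chains_attach[OF c x' y(1-4) d]
  have ends: "chain_end pid pos len y" "chain_end pid pos len z"
    using y z by (auto simp: chain_end_def)
  have "crossing y z" using ends_crossD[OF e y(1) z(1) ends] y z by simp
  \<comment> \<open>A single sign of \<open>x\<close> has to suit both of its neighbours; it does
    because the ends \<open>y\<close> and \<open>z\<close> cross.\<close>
  then have eq: "kind x y = kind x z" using kind_eq y z by blast
  have xz: "x \<noteq> z" using x' z by auto
  have d': "signed ((sg(x := kind x y - 1)) x) x \<inter> signed ((sg(x := kind x y - 1)) z) z = {}"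
    using kind_signed[OF z(7)] z(6) eq xz by (auto simp: signed_def[of 0])
  have 1: "(pid(x := q)) x = q" "Suc ((pos(x := len q)) x) = (len(q := Suc (len q))) q"
    "(pid(x := q)) z = r" "(pos(x := len q)) z = 0" "(pos(x := len q)) x \<noteq> 0"
    using xz z y by auto
  note c'' = chains_append[OF c' x'(1) 1(1) y(3) 1(2) z(1) 1(3) z(3) 1(4) z(4) d']
  note E' = chain_end_append[OF c' x'(1) 1(1) y(3) 1(2) 1(5) z(1) 1(3) z(3) 1(4) z(4)]
  note E = chain_end_attach[OF c x' y(1-4)]
  have "ends_cross (\<lambda>w. if w < k \<and> (pid(x := q)) w = r then q else (pid(x := q)) w)
    (\<lambda>w. if w < k \<and> (pid(x := q)) w = r then (pos(x := len q)) w + (len(q := Suc (len q))) q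
      else (pos(x := len q)) w)
    (len(q := Suc (len q), q := (len(q := Suc (len q))) q + (len(q := Suc (len q))) r, r := 0))"
    (is "ends_cross ?pid ?pos ?len")
    unfolding ends_cross_def
  proof (intro allI impI)
    fix u v
    assume uv: "u < k" "v < k" "chain_end ?pid ?pos ?len u" "chain_end ?pid ?pos ?len v"
      "?pid u \<noteq> ?pid v"
    have u: "u \<noteq> x" "chain_end pid pos len u" using E'[OF uv(1,3)] E[OF uv(1)] by blast+
    have v: "v \<noteq> x" "chain_end pid pos len v" using E'[OF uv(2,4)] E[OF uv(2)] by blast+
    have "?pid u = ?pid v" if "pid u = pid v" using that uv(1,2) u(1) v(1) by simp
    then have "pid u \<noteq> pid v" using uv(5) by blast
    then show "crossing u v" using ends_crossD[OF e uv(1,2) u(2) v(2)] by blast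
  qed
  with c'' have "valid ?pid ?pos ?len (sg(x := kind x y - 1))" unfolding valid_def by blast
  then show ?thesis using z(4) by (simp cong: if_cong)
qed

lemma valid_empty: "valid (\<lambda>_. 0) pos (\<lambda>_. 0) sg"
  by (auto simp: valid_def chains_def ends_cross_def chain_end_def)

section \<open>The layout of the chains\<close>

text \<open>Every nonempty chain takes one additional cell for the separating zero. The zero after
  the last chain is dropped by the \<open>- 1\<close> in the length of the layout.\<close>

definition offset :: "(nat \<Rightarrow> nat) \<Rightarrow> nat \<Rightarrow> nat" where
  "offset len q = (\<Sum>p\<in>{1..<q}. if len p = 0 then 0 else Suc (len p))"

lemma offset_Suc:
  "1 \<le> q \<Longrightarrow> offset len (Suc q) = offset len q + (if len q = 0 then 0 else Suc (len q))"
  by (simp add: offset_def)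

lemma offset_mono: "p \<le> q \<Longrightarrow> offset len p \<le> offset len q"
  unfolding offset_def by (intro sum_mono2) auto

definition place :: "(nat \<Rightarrow> nat) \<Rightarrow> (nat \<Rightarrow> nat) \<Rightarrow> (nat \<Rightarrow> nat) \<Rightarrow> nat \<Rightarrow> nat" where
  "place pid pos len y = offset len (pid y) + pos y"

text \<open>The \<open>Suc\<close> expresses the gap left by the separating zero. It makes
  consecutive occupied cells belong to the same chain.\<close>

lemma place_less:
  assumes c: "chains pid pos len sg" and y: "y < k" "pid y \<noteq> 0" and q: "pid y < q"
  shows "Suc (place pid pos len y) < offset len q"
proof -
  have "pos y < len (pid y)" using chainsD(2)[OF c y] .
  then have "Suc (place pid pos len y) < offset len (Suc (pid y))"
    using y by (subst offset_Suc) (auto simp: place_def)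
  then show ?thesis using offset_mono[of "Suc (pid y)" q len] q by simp
qed

lemma place_pid_less:
  assumes "chains pid pos len sg" "y < k" "pid y \<noteq> 0" "pid y < pid z"
  shows "Suc (place pid pos len y) < place pid pos len z"
  using place_less[OF assms] by (simp add: place_def)

lemma place_inj:
  assumes c: "chains pid pos len sg" and "y < k" "z < k" "pid y \<noteq> 0" "pid z \<noteq> 0"
    and eq: "place pid pos len y = place pid pos len z"
  shows "y = z"
proof -
  have "pid y = pid z"
    using place_pid_less[OF c, of y z] place_pid_less[OF c, of z y] assms
    by (metis linorder_neqE_nat not_less_eq less_Suc_eq)
  then show ?thesis using eq assms chainsD(3)[OF c, of y z] by (simp add: place_def)
qed

lemma place_Suc:
  assumes c: "chains pid pos len sg" and "y < k" "z < k" "pid y \<noteq> 0" "pid z \<noteq> 0"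
    and eq: "place pid pos len z = Suc (place pid pos len y)"
  shows "signed (sg y) y \<inter> signed (sg z) z = {}"
proof -
  have "pid y = pid z"
    using place_pid_less[OF c, of y z] place_pid_less[OF c, of z y] assms
    by (metis linorder_neqE_nat less_irrefl less_Suc_eq less_trans lessI)
  then show ?thesis using eq assms chainsD(4)[OF c, of y z] by (simp add: place_def)
qed

definition chain_count :: "(nat \<Rightarrow> nat) \<Rightarrow> nat" where
  "chain_count len = card {q. 1 \<le> q \<and> q \<le> k \<and> len q \<noteq> 0}"

text \<open>Coordinates correspond to pairs of a chain number and a position, so the lengths of the
  chains add up to \<open>k\<close>; each nonempty chain adds one separator.\<close>

lemma offset_total:
  assumes c: "chains pid pos len sg" and all: "\<And>y. y < k \<Longrightarrow> pid y \<noteq> 0"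
  shows "offset len (Suc k) = k + chain_count len"
proof -
  let ?S = "Sigma {1..k} (\<lambda>q. {..<len q})"
  have "bij_betw (\<lambda>y. (pid y, pos y)) {..<k} ?S"
    unfolding bij_betw_def
  proof
    show "inj_on (\<lambda>y. (pid y, pos y)) {..<k}"
      using chainsD(3)[OF c] all by (auto simp: inj_on_def)
    have "s \<in> (\<lambda>y. (pid y, pos y)) ` {..<k}" if s: "s \<in> ?S" for s
    proof -
      obtain q j where qj: "s = (q, j)" "j < len q" using s by auto
      then obtain y where "y < k" "pid y = q" "pos y = j" using chainsD(5)[OF c] by blast
      then show ?thesis using qj by auto
    qed
    moreover have "(pid y, pos y) \<in> ?S" if "y < k" for y
      using chainsD(1,2)[OF c that all[OF that]] all[OF that] by simp
    ultimately show "(\<lambda>y. (pid y, pos y)) ` {..<k} = ?S" by blast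
  qed
  then have "card {..<k} = card ?S" by (rule bij_betw_same_card)
  then have k: "k = (\<Sum>q\<in>{1..k}. len q)" by simp
  have "offset len (Suc k) = (\<Sum>q\<in>{1..k}. len q + (if len q \<noteq> 0 then 1 else 0))"
    unfolding offset_def by (rule sum.cong) auto
  also have "\<dots> = (\<Sum>q\<in>{1..k}. len q) + (\<Sum>q\<in>{1..k}. if len q \<noteq> 0 then 1 else 0)"
    by (rule sum.distrib)
  also have "(\<Sum>q\<in>{1..k}. if len q \<noteq> 0 then 1 else 0) = chain_count len"
    by (simp add: chain_count_def sum.If_cases Int_def conj_assoc)
  finally show ?thesis using k by simp
qed

text \<open>First members of chains are ends, and those of different chains cross by the
  invariant.\<close>

lemma crossing_representatives:
  assumes i: "valid pid pos len sg"
  obtains I where "I \<subseteq> {..<k}" "card I = chain_count len"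
    "\<And>y z. y \<in> I \<Longrightarrow> z \<in> I \<Longrightarrow> y \<noteq> z \<Longrightarrow> crossing y z"
proof -
  have c: "chains pid pos len sg" and e: "ends_cross pid pos len" using i by (auto simp: valid_def)
  let ?Q = "{q. 1 \<le> q \<and> q \<le> k \<and> len q \<noteq> 0}"
  have "\<exists>y<k. pid y = q \<and> pos y = 0" if "q \<in> ?Q" for q
    using chainsD(5)[OF c, of 0 q] that by auto
  then obtain h where h: "\<And>q. q \<in> ?Q \<Longrightarrow> h q < k \<and> pid (h q) = q \<and> pos (h q) = 0" by metis
  then have "inj_on h ?Q" by (metis (mono_tags, lifting) inj_onI)
  then have 1: "card (h ` ?Q) = chain_count len" by (simp add: card_image chain_count_def)
  have 2: "h ` ?Q \<subseteq> {..<k}" using h by auto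
  have 3: "crossing y z" if yz: "y \<in> h ` ?Q" "z \<in> h ` ?Q" "y \<noteq> z" for y z
  proof -
    obtain p q where pq: "p \<in> ?Q" "y = h p" "q \<in> ?Q" "z = h q" using yz by blast
    have "chain_end pid pos len y" "chain_end pid pos len z" "pid y \<noteq> pid z"
      using h[OF pq(1)] h[OF pq(3)] pq yz(3) by (auto simp: chain_end_def)
    then show ?thesis using ends_crossD[OF e] h pq by metis
  qed
  show ?thesis by (rule that[OF 2 1 3])
qed

section \<open>The strings described by a layout\<close>

definition layout_string ::
  "(nat \<Rightarrow> nat) \<Rightarrow> (nat \<Rightarrow> nat) \<Rightarrow> (nat \<Rightarrow> nat) \<Rightarrow> (nat \<Rightarrow> nat) \<Rightarrow> nat \<Rightarrow> bool list" where
  "layout_string pid pos len sg v =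
    map (\<lambda>j. \<exists>y<k. place pid pos len y = j \<and> v \<in> signed (sg y) y) [0..<offset len (Suc k) - 1]"

lemma length_layout_string [simp]:
  "length (layout_string pid pos len sg v) = offset len (Suc k) - 1"
  by (simp add: layout_string_def)

context
  fixes pid pos len sg
  assumes c: "chains pid pos len sg" and all: "\<And>y. y < k \<Longrightarrow> pid y \<noteq> 0"
begin

lemma place_bound: "y < k \<Longrightarrow> place pid pos len y < offset len (Suc k) - 1"
  using place_less[OF c, of y "Suc k"] all[of y] chainsD(1)[OF c, of y] by simp

lemma nth_layout_string:
  assumes "y < k"
  shows "layout_string pid pos len sg v ! place pid pos len y \<longleftrightarrow> v \<in> signed (sg y) y"
proof -
  have "z = y" if "z < k" "place pid pos len z = place pid pos len y" for z
    using place_inj[OF c that(1) assms all[OF that(1)] all[OF assms] that(2)] .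
  then show ?thesis
    using assms place_bound[OF assms] by (auto simp: layout_string_def)
qed

lemma fibonacci_layout_string: "fibonacci_string (layout_string pid pos len sg v)"
  unfolding fibonacci_string_def
proof (intro allI impI notI, elim conjE)
  fix j
  assume j: "Suc j < length (layout_string pid pos len sg v)"
    "layout_string pid pos len sg v ! j" "layout_string pid pos len sg v ! Suc j"
  then obtain y z where y: "y < k" "place pid pos len y = j" "v \<in> signed (sg y) y"
    and z: "z < k" "place pid pos len z = Suc j" "v \<in> signed (sg z) z"
    by (auto simp: layout_string_def)
  then have "signed (sg y) y \<inter> signed (sg z) z = {}"
    using place_Suc[OF c y(1) z(1) all[OF y(1)] all[OF z(1)]] by simp
  then show False using y z by blast
qed

text \<open>A set and its complement separate the same pairs of vertices, and cells without a
  coordinate are zero in all strings.\<close>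

lemma ham_layout_string:
  assumes uv: "u < n" "v < n"
  shows "ham (layout_string pid pos len sg u) (layout_string pid pos len sg v) =
    card {y. y < k \<and> (u \<in> A y) \<noteq> (v \<in> A y)}"
proof -
  let ?s = "layout_string pid pos len sg"
  have diff: "(?s u ! place pid pos len y \<noteq> ?s v ! place pid pos len y) \<longleftrightarrow>
      (u \<in> A y) \<noteq> (v \<in> A y)" if "y < k" for y
    using nth_layout_string[OF that] uv by (auto simp: signed_def)
  have "{i. i < length (?s u) \<and> ?s u ! i \<noteq> ?s v ! i} =
      place pid pos len ` {y. y < k \<and> (u \<in> A y) \<noteq> (v \<in> A y)}" (is "?L = ?R")
  proof
    show "?L \<subseteq> ?R"
    proof
      fix i assume i: "i \<in> ?L"
      have "\<exists>y<k. place pid pos len y = i"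
        by (rule ccontr) (use i in \<open>auto simp: layout_string_def\<close>)
      then obtain y where "y < k" "place pid pos len y = i" by blast
      then show "i \<in> ?R" using diff[of y] i by auto
    qed
    show "?R \<subseteq> ?L"
    proof (rule image_subsetI)
      fix y assume "y \<in> {y. y < k \<and> (u \<in> A y) \<noteq> (v \<in> A y)}"
      then show "place pid pos len y \<in> ?L" using diff[of y] place_bound[of y] by simp
    qed
  qed
  moreover have "inj_on (place pid pos len) {y. y < k \<and> (u \<in> A y) \<noteq> (v \<in> A y)}"
    using place_inj[OF c] all by (auto simp: inj_on_def)
  ultimately show ?thesis by (simp add: ham_def card_image)
qed

end

end

section \<open>Isometry and near optimality of the layout\<close>

definition coordinate_set :: "nat \<Rightarrow> (nat \<Rightarrow> bool list) \<Rightarrow> nat \<Rightarrow> nat set" where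
  "coordinate_set n \<phi> y = {v. v < n \<and> \<phi> v ! y \<noteq> \<phi> 0 ! y}"

context
  fixes n k :: nat and G :: "(nat, 'b) pre_digraph" and \<phi> :: "nat \<Rightarrow> bool list"
  assumes verts: "verts G = {..<n}"
    and emb: "isometric_embedding \<phi> G (cube k)" and ce: "coordinate_edges G \<phi> k"
begin

text \<open>The ends of an edge of direction \<open>y\<close> differ at \<open>y\<close> only. One
  of them lies in the set of \<open>y\<close>, and they separate this set from every other
  one.\<close>

lemma set_family_coordinates: "set_family n k (coordinate_set n \<phi>)"
proof
  have len: "length (\<phi> u) = k" if "u < n" for u
    using emb that verts by (auto simp: isometric_embedding_cube_iff)
  have edge: "\<exists>a<n. \<exists>b<n. \<phi> a ! y \<noteq> \<phi> b ! y \<and> (\<forall>z. z \<noteq> y \<longrightarrow> \<phi> a ! z = \<phi> b ! z)" if "y < k" for y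
  proof -
    obtain a b where ab: "a < n" "b < n" "\<phi> b = (\<phi> a)[y := \<not> \<phi> a ! y]"
      using ce \<open>y < k\<close> verts unfolding coordinate_edges_def by auto
    then have "\<phi> b ! y = (\<not> \<phi> a ! y)" "\<And>z. z \<noteq> y \<Longrightarrow> \<phi> b ! z = \<phi> a ! z"
      using len[OF ab(1)] that by simp_all
    then show ?thesis using ab(1,2) by metis
  qed
  fix y assume y: "y < k"
  show "coordinate_set n \<phi> y \<subseteq> {0<..<n}"
    by (auto simp: coordinate_set_def intro!: gr0I)
  show "coordinate_set n \<phi> y \<noteq> {}"
    using edge[OF y] unfolding coordinate_set_def by blast
  fix z assume "z < k" and eq: "coordinate_set n \<phi> y = coordinate_set n \<phi> z"
  then have "\<And>v. v < n \<Longrightarrow> \<phi> v ! y \<noteq> \<phi> 0 ! y \<longleftrightarrow> \<phi> v ! z \<noteq> \<phi> 0 ! z"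
    unfolding coordinate_set_def by blast
  then show "y = z" using edge[OF y] by metis
qed

interpretation set_family n k "coordinate_set n \<phi>"
  by (rule set_family_coordinates)

lemma ham_coordinate_set:
  assumes "u < n" "v < n"
  shows "card {y. y < k \<and> (u \<in> coordinate_set n \<phi> y) \<noteq> (v \<in> coordinate_set n \<phi> y)} =
    ham (\<phi> u) (\<phi> v)"
proof -
  have "length (\<phi> u) = k" using emb assms verts by (auto simp: isometric_embedding_cube_iff)
  then have "{y. y < k \<and> (u \<in> coordinate_set n \<phi> y) \<noteq> (v \<in> coordinate_set n \<phi> y)} =
      {y. y < length (\<phi> u) \<and> \<phi> u ! y \<noteq> \<phi> v ! y}"
    using assms by (auto simp: coordinate_set_def)
  then show ?thesis by (simp add: ham_def)
qed

lemma layout_isometric_embedding: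
  assumes c: "chains pid pos len sg" and all: "\<And>y. y < k \<Longrightarrow> pid y \<noteq> 0"
  shows "isometric_embedding (layout_string pid pos len sg) G (fib_cube (offset len (Suc k) - 1))"
proof -
  let ?s = "layout_string pid pos len sg"
  note e = emb[unfolded isometric_embedding_cube_iff]
  have ham: "ham (?s u) (?s v) = ham (\<phi> u) (\<phi> v)" if "u < n" "v < n" for u v
    using ham_layout_string[OF c all that] ham_coordinate_set[OF that] by simp
  have "inj_on ?s (verts G)"
  proof (rule inj_onI)
    fix u v assume uv: "u \<in> verts G" "v \<in> verts G" "?s u = ?s v"
    then have "ham (\<phi> u) (\<phi> v) = 0" using ham[of u v] verts by simp
    then have "\<phi> u = \<phi> v" using uv e ham_eq_0 by metis
    then show "u = v" using uv e by (meson inj_onD)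
  qed
  then show ?thesis
    unfolding isometric_embedding_fib_cube_iff
    using e ham verts fibonacci_layout_string[OF c all] by simp
qed

lemma crossing_all_values:
  assumes "y < k" "crossing y z"
  shows "\<exists>v\<in>verts G. \<phi> v ! y = p \<and> \<phi> v ! z = q"
proof -
  have "0 < n" using nonempty[OF assms(1)] by (auto simp: coordinate_set_def)
  moreover obtain u v w where "u < n" "\<phi> u ! y \<noteq> \<phi> 0 ! y" "\<phi> u ! z \<noteq> \<phi> 0 ! z"
    "v < n" "\<phi> v ! y \<noteq> \<phi> 0 ! y" "\<phi> v ! z = \<phi> 0 ! z"
    "w < n" "\<phi> w ! y = \<phi> 0 ! y" "\<phi> w ! z \<noteq> \<phi> 0 ! z"
    using assms(2) unfolding crossing_def coordinate_set_def by blast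
  ultimately show ?thesis
    unfolding verts lessThan_iff Bex_def by (cases "p = \<phi> 0 ! y"; cases "q = \<phi> 0 ! z") metis+
qed

lemma layout_near_optimal:
  assumes v: "valid pid pos len sg" and all: "\<And>y. y < k \<Longrightarrow> pid y \<noteq> 0"
  shows "2 * (offset len (Suc k) - 1) \<le> 3 * fdim G"
proof -
  have c: "chains pid pos len sg" using v by (simp add: valid_def)
  \<comment> \<open>The layout itself shows that some embedding into a Fibonacci cube exists,
    without which the \<open>LEAST\<close> in \<open>fdim\<close> would say nothing.\<close>
  have "\<exists>\<psi>. isometric_embedding \<psi> G (fib_cube (fdim G))"
    unfolding fdim_def
    by (rule LeastI_ex[of "\<lambda>F. \<exists>\<psi>. isometric_embedding \<psi> G (fib_cube F)"])
      (use layout_isometric_embedding[OF c all] in blast)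
  then obtain \<psi> where \<psi>: "isometric_embedding \<psi> G (fib_cube (fdim G))" by blast
  obtain I where I: "I \<subseteq> {..<k}" "card I = chain_count len"
    "\<And>y z. y \<in> I \<Longrightarrow> z \<in> I \<Longrightarrow> y \<noteq> z \<Longrightarrow> crossing y z"
    using crossing_representatives[OF v] by blast
  have "k \<le> fdim G \<and> 2 * card I \<le> Suc (fdim G)"
    using fib_cube_lower_bound[OF emb ce \<psi> I(1)] crossing_all_values I by blast
  \<comment> \<open>With \<open>p\<close> chains and \<open>F = fdim G\<close>,
    \<open>2 * (k + p - 1)\<close> is at most \<open>2 * F + (F + 1) - 2\<close> unless
    \<open>k + p = 0\<close>, when the cut-off difference is \<open>0\<close>.\<close>
  then show ?thesis using offset_total[OF c all] I(2) by linarith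
qed

end

section \<open>Weakest preconditions for the word RAM\<close>

text \<open>Total correctness: some run terminates, and its exact time is passed to the
  postcondition. The rules below are equations between predicates, so that they rewrite also inside
  the nested postconditions of \<open>Seq\<close>.\<close>

definition wp :: "nat \<Rightarrow> com \<Rightarrow> (nat \<Rightarrow> ram_state \<Rightarrow> bool) \<Rightarrow> ram_state \<Rightarrow> bool" where
  "wp w c Q s \<longleftrightarrow> (\<exists>t s'. exec w c s t s' \<and> Q t s')"

lemma wp_Skip: "wp w Skip Q = Q 1"
  unfolding wp_def fun_eq_iff by (subst exec.simps) auto

lemma wp_Assign:
  "wp w (Assign x a) Q = (\<lambda>s. Q (1 + acost a) (s\<lparr>reg := (reg s)(x := aval w s a)\<rparr>))"
  unfolding wp_def fun_eq_iff by (subst exec.simps) auto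

lemma wp_Store:
  "wp w (Store A i a) Q = (\<lambda>s. Q (1 + acost i + acost a)
    (s\<lparr>mem := (mem s)(A := (mem s A)(aval w s i := aval w s a))\<rparr>))"
  unfolding wp_def fun_eq_iff by (subst exec.simps) auto

lemma wp_Seq: "wp w (Seq c1 c2) Q = wp w c1 (\<lambda>t1. wp w c2 (\<lambda>t2. Q (t1 + t2)))"
proof -
  have "exec w (Seq c1 c2) s t s' \<longleftrightarrow>
      (\<exists>t1 t2 s1. t = t1 + t2 \<and> exec w c1 s t1 s1 \<and> exec w c2 s1 t2 s')" for s t s'
    by (subst exec.simps) auto
  then show ?thesis unfolding wp_def fun_eq_iff by (simp only:) blast
qed

lemma wp_If:
  "wp w (If b c1 c2) Q = (\<lambda>s.
    if bval w s b then wp w c1 (\<lambda>t. Q (1 + bcost b + t)) s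
    else wp w c2 (\<lambda>t. Q (1 + bcost b + t)) s)"
proof -
  have "exec w (If b c1 c2) s t s' \<longleftrightarrow>
      (\<exists>t1. t = 1 + bcost b + t1 \<and> exec w (if bval w s b then c1 else c2) s t1 s')" for s t s'
    by (subst exec.simps) auto
  then show ?thesis unfolding wp_def fun_eq_iff by auto
qed

lemmas wp_simps = wp_Skip wp_Assign wp_Store wp_Seq wp_If

lemma wp_mono: "wp w c P s \<Longrightarrow> (\<And>t s'. P t s' \<Longrightarrow> Q t s') \<Longrightarrow> wp w c Q s"
  unfolding wp_def by blast

section \<open>Frame rule and counting loops\<close>

primrec written_regs :: "com \<Rightarrow> string set" where
  "written_regs Skip = {}"
| "written_regs (Assign x a) = {x}"
| "written_regs (Store A i a) = {}"
| "written_regs (Seq c1 c2) = written_regs c1 \<union> written_regs c2"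
| "written_regs (If b c1 c2) = written_regs c1 \<union> written_regs c2"
| "written_regs (While b c) = written_regs c"

primrec written_arrays :: "com \<Rightarrow> string set" where
  "written_arrays Skip = {}"
| "written_arrays (Assign x a) = {}"
| "written_arrays (Store A i a) = {A}"
| "written_arrays (Seq c1 c2) = written_arrays c1 \<union> written_arrays c2"
| "written_arrays (If b c1 c2) = written_arrays c1 \<union> written_arrays c2"
| "written_arrays (While b c) = written_arrays c"

definition agree :: "string set \<Rightarrow> string set \<Rightarrow> ram_state \<Rightarrow> ram_state \<Rightarrow> bool" where
  "agree X Y s s' \<longleftrightarrow> (\<forall>x. x \<notin> X \<longrightarrow> reg s' x = reg s x) \<and> (\<forall>A. A \<notin> Y \<longrightarrow> mem s' A = mem s A)"

lemma agree_reg: "agree X Y s s' \<Longrightarrow> x \<notin> X \<Longrightarrow> reg s' x = reg s x"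
  and agree_mem: "agree X Y s s' \<Longrightarrow> A \<notin> Y \<Longrightarrow> mem s' A = mem s A"
  by (simp_all add: agree_def)

lemma agree_trans: "agree X Y s s' \<Longrightarrow> agree X Y s' s'' \<Longrightarrow> agree X Y s s''"
  by (simp add: agree_def)

lemma exec_agree: "exec w c s t s' \<Longrightarrow> agree (written_regs c) (written_arrays c) s s'"
  by (induction rule: exec.induct) (auto simp: agree_def)

text \<open>A frame rule: whatever a command does not mention as a target can be left out of
  specifications and invariants.\<close>

lemma wp_agree:
  "wp w c Q s \<Longrightarrow> wp w c (\<lambda>t s'. Q t s' \<and> agree (written_regs c) (written_arrays c) s s') s"
  unfolding wp_def using exec_agree by blast

definition For :: "string \<Rightarrow> string \<Rightarrow> com \<Rightarrow> com" where
  "For i N c = Seq (Assign i (Const 0))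
     (While (Less (Reg i) (Reg N)) (Seq c (Assign i (Plus (Reg i) (Const 1)))))"

lemma written_For [simp]:
  "written_regs (For i N c) = insert i (written_regs c)"
  "written_arrays (For i N c) = written_arrays c"
  by (auto simp: For_def)

text \<open>An unconditional unfolding equation for \<open>While\<close> would rewrite forever, so
  the loop gets two conditional rules.\<close>

lemma wp_While_step:
  assumes "bval w s b" and "wp w c (\<lambda>t1. wp w (While b c) (\<lambda>t2. Q (1 + bcost b + t1 + t2))) s"
  shows "wp w (While b c) Q s"
  using assms unfolding wp_def by (blast intro: exec.WhileTrue)

lemma wp_While_end: "\<not> bval w s b \<Longrightarrow> Q (1 + bcost b) s \<Longrightarrow> wp w (While b c) Q s"
  unfolding wp_def by (blast intro: exec.WhileFalse)

text \<open>A round costs 4 for the test and 4 for the increment besides the body; the initial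
  assignment and the failing last test make 6. The bound \<open>m < 2 ^ w\<close> keeps the
  increment from wrapping around.\<close>

lemma wp_For:
  assumes N: "reg s N = m" "m < 2 ^ w"
    and fresh: "i \<noteq> N" "i \<notin> written_regs c" "N \<notin> written_regs c"
    and init: "I 0 (s\<lparr>reg := (reg s)(i := 0)\<rparr>)"
    and step: "\<And>j s1. j < m \<Longrightarrow> I j s1 \<Longrightarrow> reg s1 i = j \<Longrightarrow>
      agree (insert i (written_regs c)) (written_arrays c) s s1 \<Longrightarrow>
      wp w c (\<lambda>t s2. t \<le> T \<and> I (Suc j) (s2\<lparr>reg := (reg s2)(i := Suc j)\<rparr>)) s1"
    and post: "\<And>t s1. t \<le> 6 + m * (T + 8) \<Longrightarrow> I m s1 \<Longrightarrow>
      agree (insert i (written_regs c)) (written_arrays c) s s1 \<Longrightarrow> Q t s1"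
  shows "wp w (For i N c) Q s"
proof -
  let ?X = "insert i (written_regs c)" and ?Y = "written_arrays c"
  let ?W = "While (Less (Reg i) (Reg N)) (Seq c (Assign i (Plus (Reg i) (Const 1))))"
  have loop: "wp w ?W (\<lambda>t s2. t \<le> 4 + (m - j) * (T + 8) \<and> I m s2 \<and> agree ?X ?Y s s2) s1"
    if "j \<le> m" "I j s1" "reg s1 i = j" "agree ?X ?Y s s1" for j s1
    using that
  proof (induction "m - j" arbitrary: j s1)
    case 0
    then have "j = m" by simp
    then show ?case
      using 0 N fresh by (intro wp_While_end) (auto dest: agree_reg)
  next
    case (Suc d)
    then have j: "j < m" "m - Suc j = d" by simp_all
    have N1: "reg s1 N = m" using Suc.prems N fresh by (auto dest: agree_reg)
    have "wp w c (\<lambda>t s2. (t \<le> T \<and> I (Suc j) (s2\<lparr>reg := (reg s2)(i := Suc j)\<rparr>)) \<and>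
        agree (written_regs c) ?Y s1 s2) s1"
      by (rule wp_agree[OF step[OF j(1) Suc.prems(2,3,4)]])
    then have "wp w c (\<lambda>t1 s2. wp w ?W
        (\<lambda>t2 s3. 1 + bcost (Less (Reg i) (Reg N)) + (t1 + (1 + acost (Plus (Reg i) (Const 1)))) + t2
            \<le> 4 + (m - j) * (T + 8) \<and> I m s3 \<and> agree ?X ?Y s s3)
        (s2\<lparr>reg := (reg s2)(i := aval w s2 (Plus (Reg i) (Const 1)))\<rparr>)) s1"
    proof (rule wp_mono)
      fix t1 s2
      assume *: "(t1 \<le> T \<and> I (Suc j) (s2\<lparr>reg := (reg s2)(i := Suc j)\<rparr>)) \<and>
        agree (written_regs c) ?Y s1 s2"
      let ?s = "s2\<lparr>reg := (reg s2)(i := Suc j)\<rparr>"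
      have "reg s2 i = j" using * fresh Suc.prems(3) by (auto dest: agree_reg)
      then have eq: "aval w s2 (Plus (Reg i) (Const 1)) = Suc j"
        using j N(2) by (cases w) (auto simp: less_Suc_eq_le)
      have "agree ?X ?Y s1 ?s" using * by (auto simp: agree_def)
      then have ag: "agree ?X ?Y s ?s" using Suc.prems(4) agree_trans by blast
      have bound: "(m - j) * (T + 8) = T + 8 + (m - Suc j) * (T + 8)"
        using j by (simp add: Suc.hyps(2)[symmetric])
      have "wp w ?W (\<lambda>t s3. t \<le> 4 + (m - Suc j) * (T + 8) \<and> I m s3 \<and> agree ?X ?Y s s3) ?s"
        using * j ag by (intro Suc.hyps(1)) auto
      then show "wp w ?W (\<lambda>t2 s3.
            1 + bcost (Less (Reg i) (Reg N)) + (t1 + (1 + acost (Plus (Reg i) (Const 1)))) + t2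
            \<le> 4 + (m - j) * (T + 8) \<and> I m s3 \<and> agree ?X ?Y s s3)
          (s2\<lparr>reg := (reg s2)(i := aval w s2 (Plus (Reg i) (Const 1)))\<rparr>)"
        unfolding eq by (rule wp_mono) (use * bound in auto)
    qed
    then have "wp w (Seq c (Assign i (Plus (Reg i) (Const 1)))) (\<lambda>t1. wp w ?W
        (\<lambda>t2 s3. 1 + bcost (Less (Reg i) (Reg N)) + t1 + t2
            \<le> 4 + (m - j) * (T + 8) \<and> I m s3 \<and> agree ?X ?Y s s3)) s1"
      unfolding wp_Seq wp_Assign .
    then show ?case
      by (rule wp_While_step[rotated]) (use Suc.prems(3) N1 j(1) in simp)
  qed
  have run: "wp w ?W (\<lambda>t s2. t \<le> 4 + (m - 0) * (T + 8) \<and> I m s2 \<and> agree ?X ?Y s s2)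
      (s\<lparr>reg := (reg s)(i := 0)\<rparr>)"
    using init by (intro loop) (auto simp: agree_def)
  have zero: "aval w s (Const 0) = 0" by simp
  show ?thesis
    unfolding For_def wp_Seq wp_Assign zero by (rule wp_mono[OF run]) (auto intro: post)
qed

section \<open>The program\<close>

text \<open>
  Complementing the coordinates that are set at vertex \<open>0\<close> is not carried out on the array
  \<open>emb\<close>; every reading of a bit is compared with that of vertex \<open>0\<close> instead.
\<close>

definition side_bit :: "string \<Rightarrow> string \<Rightarrow> bexp" where
  "side_bit y v = Not (Equal (Load ''emb'' (Plus (Times (Reg v) (Reg ''k'')) (Reg y)))
    (Load ''emb'' (Reg y)))"

definition reversal :: "string \<Rightarrow> com" where
  "reversal q = For ''v'' ''k'' (If (Equal (Load ''pid'' (Reg ''v'')) (Reg q))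
    (Store ''pos'' (Reg ''v'')
      (Minus (Minus (Load ''len'' (Reg q)) (Const 1)) (Load ''pos'' (Reg ''v'')))) Skip)"

text \<open>Lengths are updated only after the loop, because shifting the positions reads the old
  length of the first chain.\<close>

definition joining :: com where
  "joining = Seq (For ''v'' ''k'' (If (Equal (Load ''pid'' (Reg ''v'')) (Reg ''r''))
      (Seq (Store ''pid'' (Reg ''v'') (Reg ''q''))
        (Store ''pos'' (Reg ''v'') (Plus (Load ''pos'' (Reg ''v'')) (Load ''len'' (Reg ''q''))))) Skip))
    (Seq (Store ''len'' (Reg ''q'') (Plus (Load ''len'' (Reg ''q'')) (Load ''len'' (Reg ''r''))))
      (Store ''len'' (Reg ''r'') (Const 0)))"

definition counting :: com where
  "counting = For ''v'' ''n'' (If (side_bit ''y'' ''v'')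
    (Assign ''a'' (Plus (Reg ''a'') (Const 1))) Skip)"

definition sizes :: com where
  "sizes = For ''y'' ''k'' (Seq (Assign ''a'' (Const 0))
    (Seq counting (Store ''sz'' (Reg ''y'') (Reg ''a''))))"

text \<open>\<open>b\<close> is the successor of the best candidate so far, \<open>0\<close> meaning
  none. The language has no disjunction, so "no candidate yet, or a smaller set" is expressed by De
  Morgan.\<close>

definition selection :: com where
  "selection = Seq (Assign ''b'' (Const 0)) (Seq
    (For ''y'' ''k'' (If (And (Equal (Load ''pid'' (Reg ''y'')) (Const 0))
        (Not (And (Not (Equal (Reg ''b'') (Const 0)))
          (Not (Less (Load ''sz'' (Reg ''y'')) (Load ''sz'' (Minus (Reg ''b'') (Const 1))))))))
      (Assign ''b'' (Plus (Reg ''y'') (Const 1))) Skip))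
    (Assign ''x'' (Minus (Reg ''b'') (Const 1))))"

text \<open>The flag \<open>a\<close> records a common vertex of the two sets, \<open>b\<close> a
  vertex of \<open>A y\<close> outside \<open>A x\<close>. Together they determine
  \<open>kind\<close>.\<close>

definition comparing :: com where
  "comparing = For ''v'' ''n'' (If (side_bit ''y'' ''v'')
      (If (side_bit ''x'' ''v'') (Assign ''a'' (Const 1)) (Assign ''b'' (Const 1))) Skip)"

definition comparison :: com where
  "comparison = Seq (Assign ''a'' (Const 0)) (Seq (Assign ''b'' (Const 0)) (Seq comparing
    (If (Equal (Reg ''a'') (Const 0)) (Assign ''t'' (Const 1))
      (If (Equal (Reg ''b'') (Const 0)) (Assign ''t'' (Const 2)) (Assign ''t'' (Const 0))))))"

text \<open>Vertex \<open>0\<close> comes first in \<open>emb\<close>, so its bit \<open>y\<close>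
  is at address \<open>y\<close>, and comparing with it normalises the coordinates. The size
  condition covers all counters and the addresses of both bit arrays.\<close>

locale ram_input = set_family +
  fixes w W :: nat and E :: "nat \<Rightarrow> nat"
  assumes W: "2 ^ w = W"
    and size: "n * (2 * k + 2) + 2 * k + n + 8 \<le> W"
    and E: "\<And>v y. v < n \<Longrightarrow> y < k \<Longrightarrow> E (v * k + y) \<noteq> E y \<longleftrightarrow> v \<in> A y"
begin

definition has_input :: "ram_state \<Rightarrow> bool" where
  "has_input s \<longleftrightarrow> reg s ''n'' = n \<and> reg s ''k'' = k \<and> mem s ''emb'' = E"

lemma has_input_agree:
  assumes "has_input s" "agree X Y s s'" "''n'' \<notin> X" "''k'' \<notin> X" "''emb'' \<notin> Y"
  shows "has_input s'"
  using assms by (simp add: has_input_def agree_def)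

lemma W_bounds: "8 \<le> W" "2 * k + 8 \<le> W" "n + 8 \<le> W" "k + n + 8 \<le> W"
  using size by auto

lemma w_pos: "0 < w"
  using W W_bounds by (cases w) auto

text \<open>Used with \<open>m = k\<close> for reading \<open>emb\<close>, and with \<open>m\<close>
  the length of the output strings, which is at most \<open>2 * k\<close>, for writing
  \<open>out\<close>.\<close>

lemma address_bound:
  assumes "v < n" "y < m" "m \<le> 2 * k"
  shows "v * m < W" "v * m + y < W"
proof -
  have "v * m + y < v * m + m" using assms by simp
  also have "\<dots> = Suc v * m" by simp
  also have "\<dots> \<le> n * (2 * k)" using assms by (intro mult_le_mono) auto
  also have "\<dots> \<le> n * (2 * k + 2)" by simp
  finally show "v * m + y < W" using size by linarith
  then show "v * m < W" by linarith
qed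

lemma bval_side_bit:
  assumes "has_input s" "reg s y < k" "reg s v < n"
  shows "bval w s (side_bit y v) \<longleftrightarrow> reg s v \<in> A (reg s y)"
  using assms E[OF assms(3,2)] address_bound[of "reg s v" "reg s y" k]
  by (simp add: side_bit_def has_input_def W)

lemma bcost_side_bit: "bcost (side_bit y v) = 10"
  by (simp add: side_bit_def)

lemma wp_reversal:
  assumes i: "has_input s" and q: "q \<noteq> ''v''"
    and post: "\<And>t s'. t \<le> 6 + k * 38 \<Longrightarrow>
      mem s' ''pos'' = rev_pos (mem s ''pid'') (mem s ''pos'') (mem s ''len'') (reg s q) \<Longrightarrow>
      agree {''v''} {''pos''} s s' \<Longrightarrow> Q t s'"
  shows "wp w (reversal q) Q s"
  unfolding reversal_def
proof (rule wp_For[where m = k and T = 30 and I = "\<lambda>j s1. mem s1 ''pos'' =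
      (\<lambda>y. if y < j \<and> mem s ''pid'' y = reg s q then mem s ''len'' (reg s q) - 1 - mem s ''pos'' y
        else mem s ''pos'' y)"], goal_cases)
  case (7 j s1)
  note ag = agree_reg[OF 7(4)] agree_mem[OF 7(4)]
  show ?case using 7 q w_pos W_bounds
    by (auto simp: wp_simps ag W fun_eq_iff less_Suc_eq)
next
  case (8 t s1)
  then show ?case using post by (simp add: rev_pos_def)
qed (use i q W W_bounds in \<open>auto simp: has_input_def\<close>)

lemma written_reversal [simp]:
  "written_regs (reversal q) = {''v''}" "written_arrays (reversal q) = {''pos''}"
  by (simp_all add: reversal_def)

lemma wp_joining:
  assumes i: "has_input s"
    and b: "\<And>y. y < k \<Longrightarrow> mem s ''pid'' y = reg s ''r'' \<Longrightarrow>
      mem s ''pos'' y + mem s ''len'' (reg s ''q'') < W"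
      "mem s ''len'' (reg s ''q'') + mem s ''len'' (reg s ''r'') < W"
    and post: "\<And>t s'. t \<le> 40 + k * 38 \<Longrightarrow>
      mem s' ''pid'' = (\<lambda>y. if y < k \<and> mem s ''pid'' y = reg s ''r'' then reg s ''q''
        else mem s ''pid'' y) \<Longrightarrow>
      mem s' ''pos'' = (\<lambda>y. if y < k \<and> mem s ''pid'' y = reg s ''r''
        then mem s ''pos'' y + mem s ''len'' (reg s ''q'') else mem s ''pos'' y) \<Longrightarrow>
      mem s' ''len'' = (mem s ''len'')(reg s ''q'' :=
        mem s ''len'' (reg s ''q'') + mem s ''len'' (reg s ''r''), reg s ''r'' := 0) \<Longrightarrow>
      agree {''v''} {''pid'', ''pos'', ''len''} s s' \<Longrightarrow> Q t s'"
  shows "wp w joining Q s"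
  unfolding joining_def wp_Seq
proof (rule wp_For[where m = k and T = 30 and I = "\<lambda>j s1.
      mem s1 ''pid'' = (\<lambda>y. if y < j \<and> mem s ''pid'' y = reg s ''r'' then reg s ''q''
        else mem s ''pid'' y) \<and>
      mem s1 ''pos'' = (\<lambda>y. if y < j \<and> mem s ''pid'' y = reg s ''r''
        then mem s ''pos'' y + mem s ''len'' (reg s ''q'') else mem s ''pos'' y)"], goal_cases)
  case (7 j s1)
  note ag = agree_reg[OF 7(4)] agree_mem[OF 7(4)]
  show ?case using 7 w_pos W_bounds b(1)[of j]
    by (auto simp: wp_simps ag W fun_eq_iff less_Suc_eq)
next
  case (8 t s1)
  note ag = agree_reg[OF 8(3)] agree_mem[OF 8(3)]
  show ?case unfolding wp_simps
    by (rule post) (use 8 b(2) in \<open>auto simp: ag W agree_def\<close>)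
qed (use i W W_bounds in \<open>auto simp: has_input_def\<close>)

lemma wp_counting:
  assumes i: "has_input s" and y: "reg s ''y'' < k" "reg s ''a'' = 0"
    and post: "\<And>t s'. t \<le> 6 + n * 28 \<Longrightarrow> reg s' ''a'' = card (A (reg s ''y'')) \<Longrightarrow>
      agree {''v'', ''a''} {} s s' \<Longrightarrow> Q t s'"
  shows "wp w counting Q s"
  unfolding counting_def
proof (rule wp_For[where m = n and T = 20 and
      I = "\<lambda>j s1. reg s1 ''a'' = card (A (reg s ''y'') \<inter> {..<j})"], goal_cases)
  case (7 j s1)
  note ag = agree_reg[OF 7(4)] agree_mem[OF 7(4)]
  have "has_input s1" by (rule has_input_agree[OF i 7(4)]) auto
  then have bit: "bval w s1 (side_bit ''y'' ''v'') \<longleftrightarrow> j \<in> A (reg s ''y'')"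
    using 7 y by (subst bval_side_bit) (auto simp: ag)
  have "card (A (reg s ''y'') \<inter> {..<j}) \<le> card {..<j}" by (intro card_mono) auto
  then have "Suc (card (A (reg s ''y'') \<inter> {..<j})) < W" using 7(1) W_bounds by simp
  moreover have "A (reg s ''y'') \<inter> {..<Suc j} =
      (if j \<in> A (reg s ''y'') then insert j (A (reg s ''y'') \<inter> {..<j}) else A (reg s ''y'') \<inter> {..<j})"
    by (auto simp: less_Suc_eq)
  ultimately show ?case using 7 w_pos W_bounds
    by (auto simp: wp_simps bit bcost_side_bit W)
next
  case (8 t s1)
  have "A (reg s ''y'') \<inter> {..<n} = A (reg s ''y'')" using subset[OF y(1)] by auto
  then show ?case using 8 by (intro post) (auto simp: insert_commute)
qed (use i y W W_bounds in \<open>auto simp: has_input_def\<close>)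

lemma written_counting [simp]:
  "written_regs counting = {''v'', ''a''}" "written_arrays counting = {}"
  by (auto simp: counting_def)

lemma wp_sizes:
  assumes i: "has_input s"
    and post: "\<And>t s'. t \<le> 6 + k * (28 + n * 28) \<Longrightarrow>
      (\<forall>y<k. mem s' ''sz'' y = card (A y)) \<Longrightarrow>
      agree {''y'', ''v'', ''a''} {''sz''} s s' \<Longrightarrow> Q t s'"
  shows "wp w sizes Q s"
  unfolding sizes_def
proof (rule wp_For[where m = k and T = "20 + n * 28" and
      I = "\<lambda>j s1. \<forall>y<j. mem s1 ''sz'' y = card (A y)"], goal_cases)
  case (7 j s1)
  note ag = agree_reg[OF 7(4)] agree_mem[OF 7(4)]
  have "has_input s1" by (rule has_input_agree[OF i 7(4)]) auto
  then have i': "has_input (s1\<lparr>reg := (reg s1)(''a'' := aval w s1 (Const 0))\<rparr>)" by (simp add: has_input_def)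
  show ?case unfolding wp_simps
  proof (rule wp_counting[OF i'], goal_cases)
    case (3 t s2)
    note ag2 = agree_reg[OF 3(3)] agree_mem[OF 3(3)]
    show ?case using 3 7 by (auto simp: ag2 less_Suc_eq)
  qed (use 7 in auto)
next
  case (8 t s1)
  then show ?case by (intro post) (auto simp: insert_commute)
qed (use i W W_bounds in \<open>auto simp: has_input_def\<close>)

lemma wp_comparing:
  assumes i: "has_input s" and y: "reg s ''y'' < k" "reg s ''x'' < k" "reg s ''a'' = 0" "reg s ''b'' = 0"
    and post: "\<And>t s'. t \<le> 6 + n * 38 \<Longrightarrow>
      (reg s' ''a'' = 0 \<longleftrightarrow> A (reg s ''x'') \<inter> A (reg s ''y'') = {}) \<Longrightarrow>
      (reg s' ''b'' = 0 \<longleftrightarrow> A (reg s ''y'') \<subseteq> A (reg s ''x'')) \<Longrightarrow>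
      agree {''v'', ''a'', ''b''} {} s s' \<Longrightarrow> Q t s'"
  shows "wp w comparing Q s"
  unfolding comparing_def
proof (rule wp_For[where m = n and T = 30 and I = "\<lambda>j s1.
      (reg s1 ''a'' = 0 \<longleftrightarrow> A (reg s ''x'') \<inter> A (reg s ''y'') \<inter> {..<j} = {}) \<and>
      (reg s1 ''b'' = 0 \<longleftrightarrow> A (reg s ''y'') \<inter> {..<j} \<subseteq> A (reg s ''x''))"], goal_cases)
  case (7 j s1)
  note ag = agree_reg[OF 7(4)] agree_mem[OF 7(4)]
  have "has_input s1" by (rule has_input_agree[OF i 7(4)]) auto
  then have bit: "bval w s1 (side_bit ''y'' ''v'') \<longleftrightarrow> j \<in> A (reg s ''y'')"
      "bval w s1 (side_bit ''x'' ''v'') \<longleftrightarrow> j \<in> A (reg s ''x'')"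
    using 7 y by (auto simp: bval_side_bit ag)
  show ?case using 7 w_pos W_bounds
    by (auto simp: wp_simps bit bcost_side_bit W lessThan_Suc)
next
  case (8 t s1)
  have "A (reg s ''y'') \<inter> {..<n} = A (reg s ''y'')" using subset[OF y(1)] by auto
  then show ?case using 8 by (intro post) (auto simp: Int_assoc insert_commute)
qed (use i y W W_bounds in \<open>auto simp: has_input_def\<close>)

lemma written_comparing [simp]:
  "written_regs comparing = {''v'', ''a'', ''b''}" "written_arrays comparing = {}"
  by (auto simp: comparing_def)

lemma wp_comparison:
  assumes i: "has_input s" and y: "reg s ''y'' < k" "reg s ''x'' < k"
    and post: "\<And>t s'. t \<le> 30 + n * 38 \<Longrightarrow> reg s' ''t'' = kind (reg s ''x'') (reg s ''y'') \<Longrightarrow>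
      agree {''v'', ''a'', ''b'', ''t''} {} s s' \<Longrightarrow> Q t s'"
  shows "wp w comparison Q s"
  unfolding comparison_def wp_Seq wp_Assign
proof (rule wp_comparing, goal_cases)
  case (6 t s1)
  show ?case
  proof (cases "reg s1 ''a'' = 0")
    case True
    then show ?thesis using w_pos W_bounds unfolding wp_simps
      by (simp add: W) (rule post, use 6 in \<open>auto simp: kind_def agree_def\<close>)
  next
    case a: False
    show ?thesis
    proof (cases "reg s1 ''b'' = 0")
      case True
      then show ?thesis using a w_pos W_bounds unfolding wp_simps
        by (simp add: W) (rule post, use 6 in \<open>auto simp: kind_def agree_def\<close>)
    next
      case False
      then show ?thesis using a w_pos W_bounds unfolding wp_simps
        by (simp add: W) (rule post, use 6 in \<open>auto simp: kind_def agree_def\<close>)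
    qed
  qed
qed (use i y in \<open>simp_all add: has_input_def\<close>)

lemma written_comparison [simp]:
  "written_regs comparison = {''v'', ''a'', ''b'', ''t''}" "written_arrays comparison = {}"
  by (auto simp: comparison_def)

lemma wp_selection:
  assumes i: "has_input s" and ex: "\<exists>y<k. mem s ''pid'' y = 0"
    and post: "\<And>t s'. t \<le> 20 + k * 38 \<Longrightarrow> reg s' ''x'' < k \<Longrightarrow> mem s ''pid'' (reg s' ''x'') = 0 \<Longrightarrow>
      (\<forall>y<k. mem s ''pid'' y = 0 \<longrightarrow> mem s ''sz'' (reg s' ''x'') \<le> mem s ''sz'' y) \<Longrightarrow>
      agree {''y'', ''b'', ''x''} {} s s' \<Longrightarrow> Q t s'"
  shows "wp w selection Q s"
  unfolding selection_def wp_Seq wp_Assign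
proof (rule wp_For[where m = k and T = 30 and I = "\<lambda>j s1.
      (reg s1 ''b'' = 0 \<longrightarrow> (\<forall>y<j. mem s ''pid'' y \<noteq> 0)) \<and>
      (reg s1 ''b'' \<noteq> 0 \<longrightarrow> reg s1 ''b'' - 1 < k \<and> mem s ''pid'' (reg s1 ''b'' - 1) = 0 \<and>
        (\<forall>y<j. mem s ''pid'' y = 0 \<longrightarrow> mem s ''sz'' (reg s1 ''b'' - 1) \<le> mem s ''sz'' y))"],
    goal_cases)
  case (7 j s1)
  note ag = agree_reg[OF 7(4)] agree_mem[OF 7(4)]
  have "Suc j < W" using 7 W_bounds by simp
  then show ?case using 7 w_pos W_bounds
    by (auto simp: wp_simps ag W less_Suc_eq)
next
  case (8 t s1)
  then have "reg s1 ''b'' \<noteq> 0" using ex by auto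
  then show ?case using 8 W_bounds w_pos by (intro post) (auto simp: W agree_def)
qed (use i W W_bounds in \<open>auto simp: has_input_def\<close>)

lemma written_selection [simp]:
  "written_regs selection = {''y'', ''b'', ''x''}" "written_arrays selection = {}"
  by (auto simp: selection_def)

end

section \<open>The search for ends that the new coordinate does not cross\<close>

definition is_end :: bexp where
  "is_end = And (Not (Equal (Load ''pid'' (Reg ''y'')) (Const 0)))
    (Not (And (Not (Equal (Load ''pos'' (Reg ''y'')) (Const 0)))
      (Not (Equal (Plus (Load ''pos'' (Reg ''y'')) (Const 1))
        (Load ''len'' (Load ''pid'' (Reg ''y'')))))))"

text \<open>
  The registers \<open>g\<close>, \<open>h\<close> and \<open>e\<close> hold the successor of a coordinate, \<open>0\<close> meaning none:
  a complemented end next to which \<open>x\<close> fits, an uncomplemented one, and an uncomplemented one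
  of another chain than that of \<open>h\<close>.
\<close>

definition recording :: com where
  "recording = If (Equal (Reg ''t'') (Const 0)) Skip
    (If (Not (Equal (Load ''sg'' (Reg ''y'')) (Const 0)))
      (Seq (Assign ''g'' (Plus (Reg ''y'') (Const 1))) (Assign ''d'' (Reg ''t'')))
      (If (Equal (Reg ''h'') (Const 0))
        (Seq (Assign ''h'' (Plus (Reg ''y'') (Const 1))) (Assign ''c'' (Reg ''t'')))
        (If (Equal (Load ''pid'' (Reg ''y'')) (Load ''pid'' (Minus (Reg ''h'') (Const 1)))) Skip
          (Assign ''e'' (Plus (Reg ''y'') (Const 1))))))"

definition scan :: com where
  "scan = Seq (Assign ''g'' (Const 0)) (Seq (Assign ''h'' (Const 0)) (Seq (Assign ''e'' (Const 0))
    (For ''y'' ''k'' (If is_end (Seq comparison recording) Skip))))"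

context ram_input
begin

definition hit :: "ram_state \<Rightarrow> nat \<Rightarrow> bool" where
  "hit s y \<longleftrightarrow> y < k \<and> chain_end (mem s ''pid'') (mem s ''pos'') (mem s ''len'') y \<and>
    kind (reg s ''x'') y \<noteq> 0"

text \<open>\<open>h\<close> keeps the first uncomplemented hit, so the chain that candidates for
  \<open>e\<close> are compared with stays fixed. If \<open>h\<close> is \<open>0\<close>, there is
  no such hit, and the clause for \<open>e = 0\<close>, with its meaningless index
  \<open>h - 1\<close>, holds vacuously.\<close>

definition scanned :: "nat \<Rightarrow> ram_state \<Rightarrow> ram_state \<Rightarrow> bool" where
  "scanned j s s1 \<longleftrightarrow>
    (if reg s1 ''g'' = 0 then \<forall>y<j. hit s y \<longrightarrow> mem s ''sg'' y = 0
     else hit s (reg s1 ''g'' - 1) \<and> mem s ''sg'' (reg s1 ''g'' - 1) \<noteq> 0 \<and>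
       reg s1 ''d'' = kind (reg s ''x'') (reg s1 ''g'' - 1)) \<and>
    (if reg s1 ''h'' = 0 then \<forall>y<j. hit s y \<longrightarrow> mem s ''sg'' y \<noteq> 0
     else hit s (reg s1 ''h'' - 1) \<and> mem s ''sg'' (reg s1 ''h'' - 1) = 0 \<and>
       reg s1 ''c'' = kind (reg s ''x'') (reg s1 ''h'' - 1)) \<and>
    (if reg s1 ''e'' = 0 then \<forall>y<j. hit s y \<longrightarrow> mem s ''sg'' y = 0 \<longrightarrow>
       mem s ''pid'' y = mem s ''pid'' (reg s1 ''h'' - 1)
     else reg s1 ''h'' \<noteq> 0 \<and> hit s (reg s1 ''e'' - 1) \<and> mem s ''sg'' (reg s1 ''e'' - 1) = 0 \<and>
       mem s ''pid'' (reg s1 ''e'' - 1) \<noteq> mem s ''pid'' (reg s1 ''h'' - 1))"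

lemma bval_is_end:
  assumes "mem s ''pid'' (reg s ''y'') \<noteq> 0 \<Longrightarrow> Suc (mem s ''pos'' (reg s ''y'')) < W"
  shows "bval w s is_end \<longleftrightarrow>
    chain_end (mem s ''pid'') (mem s ''pos'') (mem s ''len'') (reg s ''y'')"
  using assms w_pos by (auto simp: is_end_def chain_end_def W)

lemma bcost_is_end: "bcost is_end = 22"
  by (simp add: is_end_def)

lemma written_recording [simp]:
  "written_regs recording = {''g'', ''d'', ''h'', ''c'', ''e''}" "written_arrays recording = {}"
  by (auto simp: recording_def)

lemma scanned_cong:
  assumes "scanned j s s1" "reg s2 ''g'' = reg s1 ''g''" "reg s2 ''d'' = reg s1 ''d''"
    "reg s2 ''h'' = reg s1 ''h''" "reg s2 ''c'' = reg s1 ''c''" "reg s2 ''e'' = reg s1 ''e''"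
  shows "scanned j s s2"
  using assms(1) unfolding scanned_def assms(2-) .

lemma scanned_Suc_no_hit: "scanned j s s1 \<Longrightarrow> \<not> hit s j \<Longrightarrow> scanned (Suc j) s s1"
  unfolding scanned_def All_less_Suc by (simp only: simp_thms)

lemma wp_recording:
  assumes y: "reg s1 ''y'' = j" "j < k" and t: "reg s1 ''t'' = kind (reg s ''x'') j"
    and mem: "mem s1 ''sg'' = mem s ''sg''" "mem s1 ''pid'' = mem s ''pid''"
    and e: "chain_end (mem s ''pid'') (mem s ''pos'') (mem s ''len'') j"
    and sc: "scanned j s s1"
    and post: "\<And>t s'. t \<le> 30 \<Longrightarrow> scanned (Suc j) s s' \<Longrightarrow> Q t s'"
  shows "wp w recording Q s1"
proof -
  have j: "Suc j < W" using y W_bounds by simp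
  have hit: "hit s j \<longleftrightarrow> kind (reg s ''x'') j \<noteq> 0" using y e by (simp add: hit_def)
  show ?thesis
  proof (cases "kind (reg s ''x'') j = 0")
    case True
    have "scanned (Suc j) s s1" using sc hit True scanned_Suc_no_hit by blast
    then show ?thesis using True t w_pos by (simp add: recording_def wp_simps post)
  next
    case k: False
    show ?thesis
    proof (cases "mem s ''sg'' j = 0")
      case False
      have "scanned (Suc j) s (s1\<lparr>reg := (reg s1)(''g'' := Suc j, ''d'' := kind (reg s ''x'') j)\<rparr>)"
        using sc hit k False unfolding scanned_def All_less_Suc by (simp split: if_splits)
      then show ?thesis using k False t y mem w_pos j
        by (simp add: recording_def wp_simps W post)
    next
      case sg: True
      show ?thesis
      proof (cases "reg s1 ''h'' = 0")
        case True
        have "scanned (Suc j) s (s1\<lparr>reg := (reg s1)(''h'' := Suc j, ''c'' := kind (reg s ''x'') j)\<rparr>)"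
          using sc hit k sg True unfolding scanned_def All_less_Suc
          by (simp split: if_splits) force+
        then show ?thesis using k sg True t y mem w_pos j
          by (simp add: recording_def wp_simps W post)
      next
        case h: False
        show ?thesis
        proof (cases "mem s ''pid'' j = mem s ''pid'' (reg s1 ''h'' - 1)")
          case True
          have "scanned (Suc j) s s1"
            using sc hit k sg h True unfolding scanned_def All_less_Suc by (simp split: if_splits)
          then show ?thesis using k sg h True t y mem w_pos j
            by (simp add: recording_def wp_simps W post)
        next
          case False
          have "scanned (Suc j) s (s1\<lparr>reg := (reg s1)(''e'' := Suc j)\<rparr>)"
            using sc hit k sg h False unfolding scanned_def All_less_Suc by (simp split: if_splits)
          then show ?thesis using k sg h False t y mem w_pos j
            by (simp add: recording_def wp_simps W post)
        qed
      qed
    qed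
  qed
qed

text \<open>Each comparison runs over all vertices, so this is the dominant cost of a placement,
  proportional to \<open>k * n\<close>.\<close>

lemma wp_scan:
  assumes i: "has_input s" and x: "reg s ''x'' < k"
    and b: "\<And>y. y < k \<Longrightarrow> mem s ''pid'' y \<noteq> 0 \<Longrightarrow> Suc (mem s ''pos'' y) < W"
    and post: "\<And>t s'. t \<le> 20 + k * (108 + n * 38) \<Longrightarrow> scanned k s s' \<Longrightarrow>
      agree {''g'', ''d'', ''h'', ''c'', ''e'', ''y'', ''v'', ''a'', ''b'', ''t''} {} s s' \<Longrightarrow> Q t s'"
  shows "wp w scan Q s"
  unfolding scan_def wp_Seq wp_Assign
proof (rule wp_For[where m = k and T = "100 + n * 38" and I = "\<lambda>j s1. scanned j s s1"], goal_cases)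
  case (7 j s1)
  have ag: "agree {''g'', ''d'', ''h'', ''c'', ''e'', ''y'', ''v'', ''a'', ''b'', ''t''} {} s s1"
    using 7(4) by (auto simp: agree_def)
  note ag' = agree_reg[OF ag] agree_mem[OF ag]
  have "has_input s1" by (rule has_input_agree[OF i ag]) auto
  have bv: "bval w s1 is_end \<longleftrightarrow>
      chain_end (mem s ''pid'') (mem s ''pos'') (mem s ''len'') j"
    using 7 b[of j] by (subst bval_is_end) (auto simp: ag')
  show ?case
  proof (cases "bval w s1 is_end")
    case False
    then have "\<not> hit s j" using bv by (simp add: hit_def)
    then have "scanned (Suc j) s s1" using 7(2) scanned_Suc_no_hit by blast
    then show ?thesis using False
      by (auto simp: wp_simps bcost_is_end intro: scanned_cong)
  next
    case True
    have "wp w comparison (\<lambda>t1. wp w recording (\<lambda>t2 s2. 23 + (t1 + t2) \<le> 100 + n * 38 \<and>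
        scanned (Suc j) s (s2\<lparr>reg := (reg s2)(''y'' := Suc j)\<rparr>))) s1"
    proof (rule wp_comparison[OF \<open>has_input s1\<close>], goal_cases)
      case (3 t s2)
      note ag2 = agree_reg[OF 3(3)] agree_mem[OF 3(3)]
      show ?case
      proof (rule wp_recording[where s = s and j = j], goal_cases)
        case 7
        show ?case by (rule scanned_cong[OF \<open>scanned j s s1\<close>]) (simp_all add: ag2)
      next
        case (8 t' s')
        then show ?case using 3 by (auto intro: scanned_cong)
      qed (use 7 3 True bv in \<open>auto simp: ag' ag2\<close>)
    qed (use 7 x in \<open>auto simp: ag'\<close>)
    then show ?thesis using True by (simp add: wp_simps bcost_is_end)
  qed
next
  case 6
  show ?case by (simp add: scanned_def)
next
  case (8 t s1)
  show ?case by (rule post) (use 8 in \<open>auto simp: agree_def\<close>)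
qed (use i W W_bounds in \<open>auto simp: has_input_def\<close>)

lemma written_scan [simp]:
  "written_regs scan = {''g'', ''d'', ''h'', ''c'', ''e'', ''y'', ''v'', ''a'', ''b'', ''t''}"
  "written_arrays scan = {}"
  by (auto simp: scan_def)

end

section \<open>Placing a single coordinate\<close>

definition bring_last :: com where
  "bring_last = Seq (Assign ''q'' (Load ''pid'' (Reg ''y'')))
    (If (Equal (Plus (Load ''pos'' (Reg ''y'')) (Const 1)) (Load ''len'' (Reg ''q''))) Skip
      (reversal ''q''))"

definition bring_first :: com where
  "bring_first = Seq (Assign ''z'' (Minus (Reg ''e'') (Const 1)))
    (Seq (Assign ''r'' (Load ''pid'' (Reg ''z'')))
      (If (Equal (Load ''pos'' (Reg ''z'')) (Const 0)) Skip (reversal ''r'')))"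

definition new_chain :: com where
  "new_chain = Seq (Store ''pid'' (Reg ''x'') (Plus (Reg ''x'') (Const 1)))
    (Seq (Store ''pos'' (Reg ''x'') (Const 0))
    (Seq (Store ''sg'' (Reg ''x'') (Const 0))
      (Store ''len'' (Plus (Reg ''x'') (Const 1)) (Const 1))))"

definition insertion :: com where
  "insertion = Seq (Store ''pid'' (Reg ''x'') (Reg ''q''))
    (Seq (Store ''pos'' (Reg ''x'') (Minus (Load ''len'' (Reg ''q'')) (Const 1)))
    (Seq (Store ''pos'' (Reg ''y'') (Load ''len'' (Reg ''q'')))
    (Seq (Store ''sg'' (Reg ''x'') (Minus (Reg ''d'') (Const 1)))
    (Seq (Store ''sg'' (Reg ''y'') (Const 0))
      (Store ''len'' (Reg ''q'') (Plus (Load ''len'' (Reg ''q'')) (Const 1)))))))"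

definition attachment :: com where
  "attachment = Seq (Store ''pid'' (Reg ''x'') (Reg ''q''))
    (Seq (Store ''pos'' (Reg ''x'') (Load ''len'' (Reg ''q'')))
    (Seq (Store ''sg'' (Reg ''x'') (Minus (Reg ''c'') (Const 1)))
      (Store ''len'' (Reg ''q'') (Plus (Load ''len'' (Reg ''q'')) (Const 1)))))"

definition placement :: com where
  "placement = Seq selection (Seq scan
    (If (Not (Equal (Reg ''g'') (Const 0)))
      (Seq (Assign ''y'' (Minus (Reg ''g'') (Const 1))) (Seq bring_last insertion))
      (If (Equal (Reg ''h'') (Const 0)) new_chain
        (Seq (Assign ''y'' (Minus (Reg ''h'') (Const 1))) (Seq bring_last
          (If (Equal (Reg ''e'') (Const 0)) attachment
            (Seq bring_first (Seq attachment joining))))))))"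

context ram_input
begin

lemma chain_len_le:
  assumes c: "chains pid pos len sg"
  shows "len q \<le> k"
proof -
  have "{..<len q} \<subseteq> pos ` {..<k}" using chainsD(5)[OF c] by fastforce
  then have "card {..<len q} \<le> card (pos ` {..<k})" by (intro card_mono) auto
  also have "\<dots> \<le> k" using card_image_le[of "{..<k}" pos] by simp
  finally show ?thesis by simp
qed

definition chain_state :: "ram_state \<Rightarrow> bool" where
  "chain_state s \<longleftrightarrow> valid (mem s ''pid'') (mem s ''pos'') (mem s ''len'') (mem s ''sg'')"

lemma chain_state_bounds:
  assumes "chain_state s"
  shows "mem s ''len'' q \<le> k" "Suc (mem s ''len'' q) < W"
    and "y < k \<Longrightarrow> mem s ''pid'' y \<noteq> 0 \<Longrightarrow> Suc (mem s ''pos'' y) < W"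
proof -
  have c: "chains (mem s ''pid'') (mem s ''pos'') (mem s ''len'') (mem s ''sg'')"
    using assms by (simp add: chain_state_def valid_def)
  show le: "mem s ''len'' q \<le> k" for q by (rule chain_len_le[OF c])
  then show "Suc (mem s ''len'' q) < W" using W_bounds(2) le[of q] by linarith
  show "Suc (mem s ''pos'' y) < W" if "y < k" "mem s ''pid'' y \<noteq> 0"
    using chainsD(2)[OF c that] le[of "mem s ''pid'' y"] W_bounds(2) by linarith
qed

text \<open>An end that is not last has position \<open>0\<close>, so reversing its chain makes it
  last. The set of ends stays the same.\<close>

lemma wp_bring_last:
  assumes i: "has_input s" and v: "chain_state s" and y: "reg s ''y'' < k"
    and e: "chain_end (mem s ''pid'') (mem s ''pos'') (mem s ''len'') (reg s ''y'')"
    and post: "\<And>t s'. t \<le> 40 + k * 38 \<Longrightarrow> chain_state s' \<Longrightarrow>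
      reg s' ''q'' = mem s ''pid'' (reg s ''y'') \<Longrightarrow>
      Suc (mem s' ''pos'' (reg s ''y'')) = mem s ''len'' (mem s ''pid'' (reg s ''y'')) \<Longrightarrow>
      (\<forall>z<k. chain_end (mem s ''pid'') (mem s' ''pos'') (mem s ''len'') z \<longleftrightarrow>
        chain_end (mem s ''pid'') (mem s ''pos'') (mem s ''len'') z) \<Longrightarrow>
      agree {''q'', ''v''} {''pos''} s s' \<Longrightarrow> Q t s'"
  shows "wp w bring_last Q s"
proof -
  let ?y = "reg s ''y''" and ?q = "mem s ''pid'' (reg s ''y'')"
  let ?s = "s\<lparr>reg := (reg s)(''q'' := aval w s (Load ''pid'' (Reg ''y'')))\<rparr>"
  have c: "chains (mem s ''pid'') (mem s ''pos'') (mem s ''len'') (mem s ''sg'')"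
    using v by (simp add: chain_state_def valid_def)
  have q: "?q \<noteq> 0" using e by (simp add: chain_end_def)
  have less: "mem s ''pos'' ?y < mem s ''len'' ?q" using chainsD(2)[OF c y q] .
  have b: "Suc (mem s ''pos'' ?y) < W" using chain_state_bounds(3)[OF v y q] .
  show ?thesis
  proof (cases "Suc (mem s ''pos'' ?y) = mem s ''len'' ?q")
    case True
    have "Q t ?s" if "t \<le> 40" for t
      by (rule post) (use that v True in \<open>simp_all add: chain_state_def agree_def\<close>)
    then show ?thesis using True b w_pos W_bounds by (simp add: bring_last_def wp_simps W)
  next
    case False
    then have 0: "mem s ''pos'' ?y = 0" using e by (simp add: chain_end_def)
    have nb: "\<not> bval w ?s (Equal (Plus (Load ''pos'' (Reg ''y'')) (Const 1)) (Load ''len'' (Reg ''q'')))"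
      using False b w_pos W_bounds by (simp add: W)
    show ?thesis
      unfolding bring_last_def wp_Seq wp_Assign wp_If if_not_P[OF nb]
    proof (rule wp_reversal, goal_cases)
      case (3 t s')
      then have pos: "mem s' ''pos'' = rev_pos (mem s ''pid'') (mem s ''pos'') (mem s ''len'') ?q"
        by simp
      note ag = agree_reg[OF 3(3)] agree_mem[OF 3(3)]
      show ?case
      proof (rule post)
        show "chain_state s'"
          using valid_rev[OF v[unfolded chain_state_def] q] by (simp add: chain_state_def pos ag)
        show "\<forall>z<k. chain_end (mem s ''pid'') (mem s' ''pos'') (mem s ''len'') z \<longleftrightarrow>
            chain_end (mem s ''pid'') (mem s ''pos'') (mem s ''len'') z"
          using chain_end_rev[OF c] by (simp add: pos)
        show "Suc (mem s' ''pos'' ?y) = mem s ''len'' ?q"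
          using y less 0 by (simp add: pos rev_pos_def)
        show "agree {''q'', ''v''} {''pos''} s s'" using 3(3) by (auto simp: agree_def)
      qed (use 3 in \<open>simp_all add: ag\<close>)
    qed (use i in \<open>simp_all add: has_input_def\<close>)
  qed
qed

text \<open>An end that is not first is last. The clause on the other chains ensures that the end
  \<open>y\<close> to be joined with \<open>z\<close> remains last in its own chain.\<close>

lemma wp_bring_first:
  assumes i: "has_input s" and v: "chain_state s" and z: "z = reg s ''e'' - 1" "z < k"
    and e: "chain_end (mem s ''pid'') (mem s ''pos'') (mem s ''len'') z"
    and post: "\<And>t s'. t \<le> 40 + k * 38 \<Longrightarrow> chain_state s' \<Longrightarrow>
      reg s' ''z'' = z \<Longrightarrow> reg s' ''r'' = mem s ''pid'' z \<Longrightarrow> mem s' ''pos'' z = 0 \<Longrightarrow>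
      (\<forall>y. mem s ''pid'' y \<noteq> mem s ''pid'' z \<longrightarrow> mem s' ''pos'' y = mem s ''pos'' y) \<Longrightarrow>
      agree {''z'', ''r'', ''v''} {''pos''} s s' \<Longrightarrow> Q t s'"
  shows "wp w bring_first Q s"
proof -
  let ?q = "mem s ''pid'' z"
  let ?s1 = "s\<lparr>reg := (reg s)(''z'' := aval w s (Minus (Reg ''e'') (Const 1)))\<rparr>"
  let ?s = "?s1\<lparr>reg := (reg ?s1)(''r'' := aval w ?s1 (Load ''pid'' (Reg ''z'')))\<rparr>"
  have c: "chains (mem s ''pid'') (mem s ''pos'') (mem s ''len'') (mem s ''sg'')"
    using v by (simp add: chain_state_def valid_def)
  have q: "?q \<noteq> 0" using e by (simp add: chain_end_def)
  show ?thesis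
  proof (cases "mem s ''pos'' z = 0")
    case True
    have "Q t ?s" if "t \<le> 40" for t
      by (rule post) (use that v True z(1) w_pos in \<open>simp_all add: chain_state_def agree_def\<close>)
    then show ?thesis using True w_pos W_bounds z(1)
      by (simp add: bring_first_def wp_simps W)
  next
    case False
    then have last: "Suc (mem s ''pos'' z) = mem s ''len'' ?q" using e by (simp add: chain_end_def)
    have nb: "\<not> bval w ?s (Equal (Load ''pos'' (Reg ''z'')) (Const 0))"
      using False z(1) w_pos by simp
    show ?thesis
      unfolding bring_first_def wp_Seq wp_Assign wp_If if_not_P[OF nb]
    proof (rule wp_reversal, goal_cases)
      case (3 t s')
      then have pos: "mem s' ''pos'' = rev_pos (mem s ''pid'') (mem s ''pos'') (mem s ''len'') ?q"
        using z(1) w_pos by simp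
      note ag = agree_reg[OF 3(3)] agree_mem[OF 3(3)]
      show ?case
      proof (rule post)
        show "chain_state s'"
          using valid_rev[OF v[unfolded chain_state_def] q] by (simp add: chain_state_def pos ag)
        show "mem s' ''pos'' z = 0" using z last by (simp add: pos rev_pos_def)
        show "\<forall>y. mem s ''pid'' y \<noteq> ?q \<longrightarrow> mem s' ''pos'' y = mem s ''pos'' y"
          by (simp add: pos rev_pos_def)
        show "agree {''z'', ''r'', ''v''} {''pos''} s s'" using 3(3) by (auto simp: agree_def)
      qed (use 3 z(1) w_pos in \<open>simp_all add: ag\<close>)
    qed (use i in \<open>simp_all add: has_input_def\<close>)
  qed
qed

definition placed :: "nat \<Rightarrow> ram_state \<Rightarrow> ram_state \<Rightarrow> bool" where
  "placed x s s' \<longleftrightarrow> chain_state s' \<and> (\<forall>y<k. mem s' ''pid'' y \<noteq> 0 \<longleftrightarrow> y = x \<or> mem s ''pid'' y \<noteq> 0)"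

lemma wp_new_chain:
  assumes v: "chain_state s" and x: "x = reg s ''x''" "ready (mem s ''pid'') x"
    and none: "\<And>y. y < k \<Longrightarrow> chain_end (mem s ''pid'') (mem s ''pos'') (mem s ''len'') y \<Longrightarrow>
      kind x y = 0"
    and post: "\<And>t s'. t \<le> 40 \<Longrightarrow> placed x s s' \<Longrightarrow> Q t s'"
  shows "wp w new_chain Q s"
proof -
  have "Suc x < W" using x W_bounds by (simp add: ready_def)
  moreover have "placed x s (s\<lparr>mem := (mem s)(''pid'' := (mem s ''pid'')(x := Suc x),
      ''pos'' := (mem s ''pos'')(x := 0), ''sg'' := (mem s ''sg'')(x := 0),
      ''len'' := (mem s ''len'')(Suc x := 1))\<rparr>)"
    using valid_singleton[OF v[unfolded chain_state_def] x(2) none]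
    by (simp add: placed_def chain_state_def)
  ultimately show ?thesis using w_pos
    by (simp add: new_chain_def wp_simps W post flip: x(1))
qed

lemma wp_insertion:
  assumes v: "chain_state s" and x: "x = reg s ''x''" "ready (mem s ''pid'') x"
    and y: "y = reg s ''y''" "y < k" "mem s ''pid'' y = q" "q \<noteq> 0" "q = reg s ''q''"
      "Suc (mem s ''pos'' y) = mem s ''len'' q" "mem s ''sg'' y \<noteq> 0" "kind x y \<noteq> 0"
      "kind x y = reg s ''d''"
    and post: "\<And>t s'. t \<le> 40 \<Longrightarrow> placed x s s' \<Longrightarrow> Q t s'"
  shows "wp w insertion Q s"
proof -
  have "placed x s (s\<lparr>mem := (mem s)(''pid'' := (mem s ''pid'')(x := q),
      ''pos'' := (mem s ''pos'')(x := mem s ''len'' q - 1, y := mem s ''len'' q),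
      ''sg'' := (mem s ''sg'')(x := kind x y - 1, y := 0),
      ''len'' := (mem s ''len'')(q := Suc (mem s ''len'' q)))\<rparr>)"
    using valid_insert[OF v[unfolded chain_state_def] x(2) y(2-4,6-8)] y(4)
    by (simp add: placed_def chain_state_def)
  then show ?thesis using w_pos W_bounds chain_state_bounds(2)[OF v]
    by (simp add: insertion_def wp_simps W post flip: x(1) y(1,5,9))
qed

text \<open>The postcondition gives the exact memory instead of the invariant, because attaching is
  also the first half of a join, after which the invariant need not hold.\<close>

lemma wp_attachment:
  assumes x: "x = reg s ''x''" and q: "q = reg s ''q''" "Suc (mem s ''len'' q) < W"
    and post: "\<And>t. t \<le> 40 \<Longrightarrow> Q t (s\<lparr>mem := (mem s)(''pid'' := (mem s ''pid'')(x := q),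
      ''pos'' := (mem s ''pos'')(x := mem s ''len'' q),
      ''sg'' := (mem s ''sg'')(x := reg s ''c'' - 1),
      ''len'' := (mem s ''len'')(q := Suc (mem s ''len'' q)))\<rparr>)"
  shows "wp w attachment Q s"
  using post q(2) w_pos W_bounds
  by (simp add: attachment_def wp_simps W flip: x q(1))

lemma agree_mem_eq: "agree X {} s s' \<Longrightarrow> mem s' = mem s"
  by (auto simp: agree_def)

lemma placed_cong: "placed x s1 s' \<Longrightarrow> mem s1 ''pid'' = mem s ''pid'' \<Longrightarrow> placed x s s'"
  by (simp add: placed_def)

lemma wp_placement:
  assumes i: "has_input s" and v: "chain_state s" and ex: "\<exists>y<k. mem s ''pid'' y = 0"
    and sz: "\<And>y. y < k \<Longrightarrow> mem s ''sz'' y = card (A y)"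
    and ord: "\<And>y z. y < k \<Longrightarrow> z < k \<Longrightarrow> mem s ''pid'' y \<noteq> 0 \<Longrightarrow> mem s ''pid'' z = 0 \<Longrightarrow>
      card (A y) \<le> card (A z)"
    and post: "\<And>t x s'. t \<le> 400 + k * (300 + n * 40) \<Longrightarrow> x < k \<Longrightarrow> mem s ''pid'' x = 0 \<Longrightarrow>
      (\<forall>z<k. mem s ''pid'' z = 0 \<longrightarrow> card (A x) \<le> card (A z)) \<Longrightarrow> placed x s s' \<Longrightarrow> Q t s'"
  shows "wp w placement Q s"
  unfolding placement_def wp_Seq
proof (rule wp_selection[OF i ex], goal_cases)
  case (1 t1 s1)
  define x where "x = reg s1 ''x''"
  note mem1 = agree_mem_eq[OF 1(5)]
  have x: "x < k" "mem s ''pid'' x = 0"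
    and min: "\<forall>z<k. mem s ''pid'' z = 0 \<longrightarrow> card (A x) \<le> card (A z)"
    using 1(2-4) sz by (auto simp: x_def)
  have ready: "ready (mem s ''pid'') x" using x ord by (simp add: ready_def)
  have i1: "has_input s1" by (rule has_input_agree[OF i 1(5)]) auto
  show ?case
  proof (rule wp_scan[OF i1], goal_cases)
    case 1
    show ?case using x by (simp add: x_def)
  next
    case (2 y)
    then show ?case using chain_state_bounds(3)[OF v] by (simp add: mem1)
  next
    case (3 t2 s2)
    note mem2 = agree_mem_eq[OF 3(3), unfolded mem1]
    have i2: "has_input s2" by (rule has_input_agree[OF i1 3(3)]) auto
    have v2: "chain_state s2" using v by (simp add: chain_state_def mem2)
    have x2: "reg s2 ''x'' = x" using agree_reg[OF 3(3)] by (simp add: x_def)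
    have hit: "hit s1 y \<longleftrightarrow> y < k \<and> chain_end (mem s ''pid'') (mem s ''pos'') (mem s ''len'') y \<and>
        kind x y \<noteq> 0" for y by (simp add: hit_def mem1 x_def)
    note sc = 3(2)[unfolded scanned_def mem1 x_def[symmetric]]
    have t12: "t1 + t2 \<le> 40 + k * (146 + n * 38)"
      using 1(1) 3(1) by (simp add: algebra_simps)
    show ?case
    proof (cases "reg s2 ''g'' = 0")
      case False
      then have b: "bval w s2 (Not (Equal (Reg ''g'') (Const 0)))" by simp
      define y where "y = reg s2 ''g'' - 1"
      have y: "y < k" "chain_end (mem s ''pid'') (mem s ''pos'') (mem s ''len'') y"
        "kind x y \<noteq> 0" "mem s ''sg'' y \<noteq> 0" "reg s2 ''d'' = kind x y"
        using sc False unfolding hit y_def by simp_all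
      have y': "aval w s2 (Minus (Reg ''g'') (Const 1)) = y"
        using w_pos by (simp add: y_def)
      show ?thesis
        unfolding wp_If if_P[OF b] wp_Seq wp_Assign y'
      proof (rule wp_bring_last, goal_cases)
        case (5 t3 s3)
        note ag3 = agree_reg[OF 5(6)] agree_mem[OF 5(6)]
        show ?case
        proof (rule wp_insertion[where x = x and y = y and q = "mem s ''pid'' y"], goal_cases)
          case (13 t4 s4)
          show ?case
            by (rule post[OF _ x min placed_cong[OF 13(2)]])
              (use 5(1) 13(1) t12 in \<open>simp_all add: ag3 mem2 algebra_simps\<close>)
        qed (use 5 y x2 ready in \<open>simp_all add: ag3 mem2 chain_end_def\<close>)
      qed (use i2 v2 y in \<open>simp_all add: mem2 has_input_def chain_state_def\<close>)
    next
      case g: True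
      then have nb: "\<not> bval w s2 (Not (Equal (Reg ''g'') (Const 0)))" by simp
      \<comment> \<open>Complemented ends have priority. Once there is none among the hits,
        \<open>h\<close> and \<open>e\<close> account for all of them.\<close>
      have sg: "mem s ''sg'' y = 0" if "hit s1 y" for y
        using sc g that unfolding hit by simp
      show ?thesis
      proof (cases "reg s2 ''h'' = 0")
        case True
        then have b: "bval w s2 (Equal (Reg ''h'') (Const 0))" by simp
        have none: "\<not> hit s1 y" for y
        proof
          assume y: "hit s1 y"
          then have "y < k" by (simp add: hit)
          then have "mem s ''sg'' y \<noteq> 0" using sc True y by simp
          then show False using sg[OF y] by simp
        qed
        show ?thesis
          unfolding wp_If if_not_P[OF nb] if_P[OF b]
        proof (rule wp_new_chain[where x = x], goal_cases)
          case (5 t3 s3)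
          show ?case
            by (rule post[OF _ x min placed_cong[OF 5(2)]])
              (use 5(1) t12 in \<open>simp_all add: mem2 algebra_simps\<close>)
        qed (use v2 x2 ready none hit in \<open>auto simp: mem2\<close>)
      next
        case h: False
        then have nb2: "\<not> bval w s2 (Equal (Reg ''h'') (Const 0))" by simp
        define y where "y = reg s2 ''h'' - 1"
        have y: "y < k" "chain_end (mem s ''pid'') (mem s ''pos'') (mem s ''len'') y"
          "kind x y \<noteq> 0" "mem s ''sg'' y = 0" "reg s2 ''c'' = kind x y"
          using sc h unfolding hit y_def by simp_all
        have y': "aval w s2 (Minus (Reg ''h'') (Const 1)) = y"
          using w_pos by (simp add: y_def)
        show ?thesis
          unfolding wp_If if_not_P[OF nb] if_not_P[OF nb2] wp_Seq wp_Assign y'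
        proof (rule wp_bring_last, goal_cases)
          case (5 t3 s3)
          note ag3 = agree_reg[OF 5(6)] agree_mem[OF 5(6)]
          define q where "q = mem s ''pid'' y"
          have q: "reg s3 ''q'' = q" "q \<noteq> 0" "Suc (mem s3 ''pos'' y) = mem s ''len'' q"
            using 5 y by (simp_all add: q_def mem2 chain_end_def)
          have v3: "valid (mem s ''pid'') (mem s3 ''pos'') (mem s ''len'') (mem s ''sg'')"
            using 5(2) by (simp add: chain_state_def ag3 mem2)
          have ends3: "chain_end (mem s ''pid'') (mem s3 ''pos'') (mem s ''len'') z \<longleftrightarrow>
              chain_end (mem s ''pid'') (mem s ''pos'') (mem s ''len'') z" if "z < k" for z
            using 5(5) that by (simp add: mem2)
          have i3: "has_input s3" by (rule has_input_agree[OF _ 5(6)]) (use i2 in \<open>auto simp: has_input_def\<close>)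
          show ?case
          proof (cases "reg s2 ''e'' = 0")
            case True
            then have b: "bval w s3 (Equal (Reg ''e'') (Const 0))" by (simp add: ag3)
            have none: "kind x z = 0"
              if "z < k" "chain_end (mem s ''pid'') (mem s3 ''pos'') (mem s ''len'') z"
                "mem s ''pid'' z \<noteq> q" for z
            proof (rule ccontr)
              assume "kind x z \<noteq> 0"
              then have "hit s1 z" using that ends3 hit by simp
              then show False using sc True sg[of z] that(1,3) unfolding q_def y_def by simp
            qed
            show ?thesis
              unfolding if_P[OF b]
            proof (rule wp_attachment[where x = x and q = q], goal_cases)
              case (4 t4)
              show ?case
                by (rule post[OF _ x min])
                  (use 4 5(1) t12 valid_attach[OF v3 ready y(1) q_def[symmetric] q(2,3) y(4,3) none]
                    x q(2) y(5) in
                  \<open>simp_all add: placed_def chain_state_def ag3 mem2 algebra_simps\<close>)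
            qed (use x2 q chain_state_bounds(2)[OF v] in \<open>simp_all add: ag3 mem2\<close>)
          next
            case e: False
            then have nb3: "\<not> bval w s3 (Equal (Reg ''e'') (Const 0))" by (simp add: ag3)
            define z where "z = reg s2 ''e'' - 1"
            have z: "z < k" "chain_end (mem s ''pid'') (mem s ''pos'') (mem s ''len'') z"
              "kind x z \<noteq> 0" "mem s ''sg'' z = 0" "q \<noteq> mem s ''pid'' z"
              using sc e unfolding hit z_def q_def y_def by simp_all
            show ?thesis
              unfolding if_not_P[OF nb3]
            proof (rule wp_bring_first[where z = z], goal_cases)
              case (6 t4 s4)
              note ag4 = agree_reg[OF 6(7)] agree_mem[OF 6(7)]
              define r where "r = mem s ''pid'' z"
              have r: "reg s4 ''r'' = r" "r \<noteq> 0" "mem s4 ''pos'' z = 0" "q \<noteq> r"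
                using 6 z by (simp_all add: r_def ag3 mem2 chain_end_def)
              have v4: "valid (mem s ''pid'') (mem s4 ''pos'') (mem s ''len'') (mem s ''sg'')"
                using 6(2) by (simp add: chain_state_def ag4 ag3 mem2)
              have y4: "Suc (mem s4 ''pos'' y) = mem s ''len'' q"
                using 6(6) q(3) z(5) by (simp add: ag3 mem2 q_def)
              have i4: "has_input s4" by (rule has_input_agree[OF i3 6(7)]) auto
              note join = valid_join[OF v4 ready y(1) q_def[symmetric] q(2) y4 y(4,3)
                z(1) r_def[symmetric] r(2,4,3) z(4,3)]
              have len: "mem s ''len'' p \<le> k" for p by (rule chain_state_bounds(1)[OF v])
              have pos: "mem s4 ''pos'' u < mem s ''len'' (mem s ''pid'' u)"
                if "u < k" "mem s ''pid'' u \<noteq> 0" for u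
                using v4 that chainsD(2) unfolding valid_def by blast
              show ?case
              proof (rule wp_attachment[where x = x and q = q], goal_cases)
                case (4 t5)
                have xr: "x \<noteq> z" "x \<noteq> y" "mem s ''pid'' x \<noteq> r" using x r z y
                  by (auto simp: r_def chain_end_def)
                show ?case
                proof (rule wp_joining, goal_cases)
                  case 1
                  then show ?case using i4 by (simp add: has_input_def)
                next
                  case (2 u)
                  then have "u \<noteq> x" "mem s ''pid'' u = r"
                    using r by (auto simp: ag4 ag3 mem2 split: if_splits)
                  then have "mem s4 ''pos'' u < mem s ''len'' r" using pos[of u] 2(1) r by simp
                  then have "mem s4 ''pos'' u + Suc (mem s ''len'' q) < W"
                    using len[of q] len[of r] W_bounds(2) by linarith
                  then show ?case using \<open>u \<noteq> x\<close> q by (simp add: ag4 ag3 mem2)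
                next
                  case 3
                  show ?case using len[of q] len[of r] W_bounds(2) r q by (simp add: ag4 ag3 mem2)
                next
                  case (4 t6 s6)
                  note ag6 = agree_reg[OF 4(5)] agree_mem[OF 4(5)]
                  have "mem s6 ''pid'' = (\<lambda>u. if u < k \<and> ((mem s ''pid'')(x := q)) u = r then q
                      else ((mem s ''pid'')(x := q)) u)"
                    using 4(2) r q by (simp add: ag4 ag3 mem2 cong: if_cong)
                  moreover have "mem s6 ''pos'' = (\<lambda>u. if u < k \<and> ((mem s ''pid'')(x := q)) u = r
                      then ((mem s4 ''pos'')(x := mem s ''len'' q)) u + Suc (mem s ''len'' q)
                      else ((mem s4 ''pos'')(x := mem s ''len'' q)) u)"
                    using 4(3) r q by (simp add: ag4 ag3 mem2 cong: if_cong)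
                  moreover have "mem s6 ''len'' =
                      (mem s ''len'')(q := Suc (mem s ''len'' q) + mem s ''len'' r, r := 0)"
                    using 4(4) r q by (simp add: ag4 ag3 mem2 cong: if_cong)
                  moreover have "mem s6 ''sg'' = (mem s ''sg'')(x := kind x y - 1)"
                    using y(5) by (simp add: ag6 ag4 ag3 mem2)
                  ultimately have "placed x s s6"
                    using join r(2) q(2) x by (simp add: placed_def chain_state_def)
                  then show ?case
                    by (intro post[OF _ x min])
                      (use 4(1) \<open>t5 \<le> 40\<close> 6(1) 5(1) t12 in \<open>simp_all add: algebra_simps\<close>)
                qed
              qed (use x2 q chain_state_bounds(2)[OF v] in \<open>simp_all add: ag4 ag3 mem2\<close>)
            qed (use z ends3 5(2) i3 in \<open>simp_all add: z_def ag3 mem2\<close>)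
          qed
        qed (use i2 v2 y in \<open>simp_all add: mem2 has_input_def chain_state_def\<close>)
      qed
    qed
  qed
qed

end

section \<open>The complete program and its output\<close>

definition placing :: com where
  "placing = For ''i'' ''k'' placement"

definition layout :: com where
  "layout = Seq (Assign ''o'' (Const 0)) (Seq
    (For ''j'' ''k'' (Seq (Assign ''q'' (Plus (Reg ''j'') (Const 1)))
      (If (Equal (Load ''len'' (Reg ''q'')) (Const 0)) Skip
        (Seq (Store ''ofs'' (Reg ''q'') (Reg ''o''))
          (Assign ''o'' (Plus (Plus (Reg ''o'') (Load ''len'' (Reg ''q''))) (Const 1)))))))
    (Assign ''f'' (Minus (Reg ''o'') (Const 1))))"

text \<open>Only ones are written: \<open>out\<close> is initially zero, which already provides the
  separators and the zero bits.\<close>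

definition writing :: com where
  "writing = (let set_bit = Store ''out'' (Plus (Times (Reg ''v'') (Reg ''f''))
        (Plus (Load ''ofs'' (Load ''pid'' (Reg ''y''))) (Load ''pos'' (Reg ''y'')))) (Const 1)
    in For ''y'' ''k'' (If (side_bit ''y'' ''v'')
      (If (Equal (Load ''sg'' (Reg ''y'')) (Const 0)) set_bit Skip)
      (If (Equal (Load ''sg'' (Reg ''y'')) (Const 0)) Skip set_bit)))"

definition emission :: com where
  "emission = For ''v'' ''n'' writing"

definition program :: com where
  "program = Seq sizes (Seq placing (Seq layout emission))"

context ram_input
begin

lemma written_placement [simp]:
  "''n'' \<notin> written_regs placement" "''k'' \<notin> written_regs placement" "''i'' \<notin> written_regs placement"
  "''emb'' \<notin> written_arrays placement" "''sz'' \<notin> written_arrays placement"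
  "''out'' \<notin> written_arrays placement"
  by (simp_all add: placement_def bring_last_def bring_first_def new_chain_def insertion_def
      attachment_def joining_def)

text \<open>Each round places exactly one coordinate. Counting the placed ones shows that a
  candidate exists in every round and that none is left after \<open>k\<close> rounds.\<close>

lemma wp_placing:
  assumes i: "has_input s" and sz: "\<And>y. y < k \<Longrightarrow> mem s ''sz'' y = card (A y)"
    and 0: "mem s ''pid'' = (\<lambda>_. 0)" "mem s ''len'' = (\<lambda>_. 0)"
    and post: "\<And>t s'. t \<le> 6 + k * (408 + k * (300 + n * 40)) \<Longrightarrow> has_input s' \<Longrightarrow> chain_state s' \<Longrightarrow>
      (\<forall>y<k. mem s' ''pid'' y \<noteq> 0) \<Longrightarrow> mem s' ''out'' = mem s ''out'' \<Longrightarrow> Q t s'"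
  shows "wp w placing Q s"
  unfolding placing_def
proof (rule wp_For[where m = k and T = "400 + k * (300 + n * 40)" and I = "\<lambda>j s1. chain_state s1 \<and>
      card {y. y < k \<and> mem s1 ''pid'' y \<noteq> 0} = j \<and>
      (\<forall>y<k. \<forall>z<k. mem s1 ''pid'' y \<noteq> 0 \<longrightarrow> mem s1 ''pid'' z = 0 \<longrightarrow> card (A y) \<le> card (A z))"],
    goal_cases)
  case 6
  then show ?case using valid_empty by (simp add: chain_state_def 0)
next
  case (7 j s1)
  have i1: "has_input s1" by (rule has_input_agree[OF i 7(4)]) auto
  note mem1 = agree_mem[OF 7(4)]
  have ex: "\<exists>y<k. mem s1 ''pid'' y = 0"
  proof (rule ccontr)
    assume "\<not> ?thesis"
    then have "{y. y < k \<and> mem s1 ''pid'' y \<noteq> 0} = {..<k}" by auto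
    then show False using 7(1,2) by simp
  qed
  show ?case
  proof (rule wp_placement[OF i1 _ ex], goal_cases)
    case (4 t x s2)
    have pid: "mem s2 ''pid'' y \<noteq> 0 \<longleftrightarrow> y = x \<or> mem s1 ''pid'' y \<noteq> 0" if "y < k" for y
      using 4(5) that by (simp add: placed_def)
    have "{y. y < k \<and> mem s2 ''pid'' y \<noteq> 0} = insert x {y. y < k \<and> mem s1 ''pid'' y \<noteq> 0}"
      using pid 4(2) by auto
    then have "card {y. y < k \<and> mem s2 ''pid'' y \<noteq> 0} = Suc j"
      using 4(3) 7(2) by simp
    \<comment> \<open>The selected \<open>x\<close> is minimal among the unplaced coordinates, so
      placing it preserves the order by size.\<close>
    moreover have "card (A y) \<le> card (A z)"
      if "y < k" "z < k" "mem s2 ''pid'' y \<noteq> 0" "mem s2 ''pid'' z = 0" for y z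
      using that pid[of y] pid[of z] 4(4) 7(2) by auto
    ultimately show ?case using 4(1,5) by (simp add: placed_def chain_state_def)
  qed (use 7 sz mem1 in auto)
next
  case (8 t s1)
  have "{y. y < k \<and> mem s1 ''pid'' y \<noteq> 0} = {..<k}"
    by (rule card_subset_eq) (use 8(2) in auto)
  then have "\<forall>y<k. mem s1 ''pid'' y \<noteq> 0" by blast
  moreover have "has_input s1" by (rule has_input_agree[OF i 8(3)]) auto
  ultimately show ?case using 8 agree_mem[OF 8(3)] by (intro post) (auto simp: algebra_simps)
qed (use i W W_bounds in \<open>auto simp: has_input_def\<close>)

lemma chain_count_le: "chain_count len \<le> k"
proof -
  have "chain_count len \<le> card {1..k}"
    unfolding chain_count_def by (intro card_mono) auto
  then show ?thesis by simp
qed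

lemma wp_layout:
  assumes i: "has_input s" and v: "chain_state s" and all: "\<And>y. y < k \<Longrightarrow> mem s ''pid'' y \<noteq> 0"
    and post: "\<And>t s'. t \<le> 20 + k * 38 \<Longrightarrow> reg s' ''f'' = offset (mem s ''len'') (Suc k) - 1 \<Longrightarrow>
      (\<forall>y<k. mem s' ''ofs'' (mem s ''pid'' y) = offset (mem s ''len'') (mem s ''pid'' y)) \<Longrightarrow>
      agree {''o'', ''j'', ''q'', ''f''} {''ofs''} s s' \<Longrightarrow> Q t s'"
  shows "wp w layout Q s"
proof -
  have c: "chains (mem s ''pid'') (mem s ''pos'') (mem s ''len'') (mem s ''sg'')"
    using v by (simp add: chain_state_def valid_def)
  \<comment> \<open>An offset is at most \<open>k\<close> plus the number of chains, hence at most
    \<open>2 * k\<close>, and the running offset does not wrap around.\<close>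
  have bound: "offset (mem s ''len'') q < W" if "q \<le> Suc k" for q
    using offset_mono[OF that, of "mem s ''len''"] offset_total[OF c all]
      chain_count_le[of "mem s ''len''"] W_bounds(2) by linarith
  show ?thesis
    unfolding layout_def wp_Seq wp_Assign
  proof (rule wp_For[where m = k and T = 30 and I = "\<lambda>j s1.
      reg s1 ''o'' = offset (mem s ''len'') (Suc j) \<and>
      (\<forall>q. 1 \<le> q \<longrightarrow> q \<le> j \<longrightarrow> mem s ''len'' q \<noteq> 0 \<longrightarrow> mem s1 ''ofs'' q = offset (mem s ''len'') q)"],
      goal_cases)
    case (7 j s1)
    note ag = agree_reg[OF 7(4)] agree_mem[OF 7(4)]
    have "Suc j < W" using 7(1) W_bounds by simp
    moreover have off: "offset (mem s ''len'') (Suc (Suc j)) = offset (mem s ''len'') (Suc j) +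
        (if mem s ''len'' (Suc j) = 0 then 0 else Suc (mem s ''len'' (Suc j)))"
      by (rule offset_Suc) simp
    moreover have "offset (mem s ''len'') (Suc (Suc j)) < W" using bound 7(1) by simp
    ultimately show ?case using 7 w_pos W_bounds
      by (cases "mem s ''len'' (Suc j) = 0") (auto simp: wp_simps ag W le_Suc_eq)
  next
    case (8 t s1)
    have "mem s1 ''ofs'' (mem s ''pid'' y) = offset (mem s ''len'') (mem s ''pid'' y)"
      if "y < k" for y
    proof -
      have "1 \<le> mem s ''pid'' y" "mem s ''pid'' y \<le> k" "mem s ''len'' (mem s ''pid'' y) \<noteq> 0"
        using chainsD(1,2)[OF c that all[OF that]] all[OF that] by simp_all
      then show ?thesis using 8(2) by blast
    qed
    then show ?case
      using 8 w_pos W_bounds by (intro post) (simp_all add: W agree_def)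
  qed (use i W W_bounds in \<open>auto simp: has_input_def offset_def\<close>)
qed

definition out_bits :: "ram_state \<Rightarrow> nat \<Rightarrow> nat \<Rightarrow> nat \<Rightarrow> bool" where
  "out_bits s v j a \<longleftrightarrow> (\<exists>y<j. a = v * reg s ''f'' +
    place (mem s ''pid'') (mem s ''pos'') (mem s ''len'') y \<and> v \<in> signed (mem s ''sg'' y) y)"

definition located :: "ram_state \<Rightarrow> bool" where
  "located s \<longleftrightarrow> has_input s \<and> reg s ''f'' \<le> 2 * k \<and>
    (\<forall>y<k. mem s ''ofs'' (mem s ''pid'' y) = offset (mem s ''len'') (mem s ''pid'' y) \<and>
      place (mem s ''pid'') (mem s ''pos'') (mem s ''len'') y < reg s ''f'')"

lemma wp_writing:
  assumes l: "located s" and v: "reg s ''v'' < n"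
    and post: "\<And>t s'. t \<le> 6 + k * 58 \<Longrightarrow>
      mem s' ''out'' = (\<lambda>a. if out_bits s (reg s ''v'') k a then 1 else mem s ''out'' a) \<Longrightarrow>
      agree {''y''} {''out''} s s' \<Longrightarrow> Q t s'"
  shows "wp w writing Q s"
  unfolding writing_def Let_def
proof (rule wp_For[where m = k and T = 50 and I = "\<lambda>j s1.
      mem s1 ''out'' = (\<lambda>a. if out_bits s (reg s ''v'') j a then 1 else mem s ''out'' a)"], goal_cases)
  case 6
  then show ?case by (simp add: out_bits_def)
next
  case (7 j s1)
  note ag = agree_reg[OF 7(4)] agree_mem[OF 7(4)]
  have i: "has_input s" using l by (simp add: located_def)
  have "has_input s1" by (rule has_input_agree[OF i 7(4)]) auto
  then have bit: "bval w s1 (side_bit ''y'' ''v'') \<longleftrightarrow> reg s ''v'' \<in> A j"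
    using 7 v by (subst bval_side_bit) (auto simp: ag)
  let ?p = "place (mem s ''pid'') (mem s ''pos'') (mem s ''len'') j"
  have p: "mem s ''ofs'' (mem s ''pid'' j) + mem s ''pos'' j = ?p" "?p < reg s ''f''"
      "reg s ''f'' \<le> 2 * k"
    using l 7(1) by (simp_all add: located_def place_def)
  note b = address_bound[OF v p(2,3)]
  have pW: "?p < W" using b by simp
  have out: "out_bits s (reg s ''v'') (Suc j) a \<longleftrightarrow> out_bits s (reg s ''v'') j a \<or>
      a = reg s ''v'' * reg s ''f'' + ?p \<and> reg s ''v'' \<in> signed (mem s ''sg'' j) j" for a
    unfolding out_bits_def by (auto simp: less_Suc_eq)
  show ?case using 7 w_pos W_bounds v b pW
    by (auto simp: wp_simps bit bcost_side_bit ag W p(1) out fun_eq_iff signed_def)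
next
  case (8 t s1)
  then show ?case by (intro post) auto
qed (use l W W_bounds in \<open>auto simp: located_def has_input_def\<close>)

lemma written_writing [simp]: "written_regs writing = {''y''}" "written_arrays writing = {''out''}"
  by (auto simp: writing_def Let_def)

lemma located_agree:
  assumes "located s" "agree {''v'', ''y''} {''out''} s s1"
  shows "located s1" "out_bits s1 = out_bits s"
proof -
  note ag = agree_reg[OF assms(2)] agree_mem[OF assms(2)]
  show "located s1" using assms(1) by (simp add: located_def has_input_def ag)
  show "out_bits s1 = out_bits s" by (intro ext) (simp add: out_bits_def ag)
qed

lemma wp_emission:
  assumes l: "located s" and 0: "mem s ''out'' = (\<lambda>_. 0)"
    and post: "\<And>t s'. t \<le> 6 + n * (14 + k * 58) \<Longrightarrow>
      mem s' ''out'' = (\<lambda>a. of_bool (\<exists>v<n. out_bits s v k a)) \<Longrightarrow>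
      reg s' ''f'' = reg s ''f'' \<Longrightarrow> Q t s'"
  shows "wp w emission Q s"
  unfolding emission_def
proof (rule wp_For[where m = n and T = "6 + k * 58" and I = "\<lambda>j s1.
      mem s1 ''out'' = (\<lambda>a. of_bool (\<exists>v<j. out_bits s v k a))"], goal_cases)
  case (7 j s1)
  have ag: "agree {''v'', ''y''} {''out''} s s1" using 7(4) by simp
  note loc = located_agree[OF l ag]
  show ?case
  proof (rule wp_writing[OF loc(1)], goal_cases)
    case (2 t s2)
    then show ?case using 7 by (auto simp: loc(2) fun_eq_iff less_Suc_eq)
  qed (use 7 in simp)
next
  case (8 t s1)
  then show ?case using agree_reg[OF 8(3)] by (intro post) (auto simp: algebra_simps)
qed (use l 0 W W_bounds in \<open>auto simp: located_def has_input_def\<close>)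

lemma wp_program:
  assumes i: "has_input s"
    and 0: "mem s ''pid'' = (\<lambda>_. 0)" "mem s ''len'' = (\<lambda>_. 0)" "mem s ''out'' = (\<lambda>_. 0)"
    and post: "\<And>t s' pid pos len sg.
      t \<le> 38 + k * (474 + n * 86) + k * k * (300 + n * 40) + n * 14 \<Longrightarrow>
      valid pid pos len sg \<Longrightarrow> (\<And>y. y < k \<Longrightarrow> pid y \<noteq> 0) \<Longrightarrow>
      reg s' ''f'' = offset len (Suc k) - 1 \<Longrightarrow>
      mem s' ''out'' = (\<lambda>a. of_bool (\<exists>v<n. \<exists>y<k. a = v * (offset len (Suc k) - 1) +
        place pid pos len y \<and> v \<in> signed (sg y) y)) \<Longrightarrow> Q t s'"
  shows "wp w program Q s"
  unfolding program_def wp_Seq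
proof (rule wp_sizes[OF i], goal_cases)
  case (1 t1 s1)
  note ag1 = agree_mem[OF 1(3)]
  have "has_input s1" by (rule has_input_agree[OF i 1(3)]) auto
  then show ?case
  proof (rule wp_placing, goal_cases)
    case (4 t2 s2)
    have c: "chains (mem s2 ''pid'') (mem s2 ''pos'') (mem s2 ''len'') (mem s2 ''sg'')"
      using 4(3) by (simp add: chain_state_def valid_def)
    have all: "mem s2 ''pid'' y \<noteq> 0" if "y < k" for y using 4(4) that by blast
    show ?case
    proof (rule wp_layout[OF 4(2,3) all], goal_cases)
      case (2 t3 s3)
      note ag3 = agree_reg[OF 2(4)] agree_mem[OF 2(4)]
      have i3: "has_input s3" by (rule has_input_agree[OF 4(2) 2(4)]) auto
      have f: "reg s3 ''f'' \<le> 2 * k"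
        using 2(2) offset_total[OF c all] chain_count_le[of "mem s2 ''len''"] by simp
      have l: "located s3"
        using i3 f 2(2,3) place_bound[OF c all] by (simp add: located_def ag3)
      show ?case
      proof (rule wp_emission[OF l], goal_cases)
        case 1
        show ?case using 4(5) 0 by (simp add: ag3 ag1)
      next
        case (2 t4 s4)
        show ?case
        proof (rule post[of _ "mem s2 ''pid''" "mem s2 ''pos''" "mem s2 ''len''" "mem s2 ''sg''"])
          \<comment> \<open>Sizes and output contribute the multiples of \<open>k * n\<close>; only
            the placements contribute terms with \<open>k * k\<close>.\<close>
          show "t1 + (t2 + (t3 + t4)) \<le> 38 + k * (474 + n * 86) + k * k * (300 + n * 40) + n * 14"
            using 1(1) 4(1) \<open>t3 \<le> 20 + k * 38\<close> 2(1) by (simp add: algebra_simps)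
          show "valid (mem s2 ''pid'') (mem s2 ''pos'') (mem s2 ''len'') (mem s2 ''sg'')"
            using 4(3) by (simp add: chain_state_def)
        qed (use 2 all \<open>reg s3 ''f'' = _\<close> in \<open>simp_all add: out_bits_def ag3\<close>)
      qed
    qed
  qed (use 1 0 in \<open>simp_all add: ag1\<close>)
qed

end

section \<open>Arrays of tuples, word size and running time\<close>

lemma tuple_cells_eq:
  assumes "\<And>v. v < n \<Longrightarrow> length (f v) = d"
  shows "tuple_cells n f = map (\<lambda>a. of_bool (f (a div d) ! (a mod d))) [0..<n * d]"
  using assms
proof (induction n)
  case 0
  then show ?case by (simp add: tuple_cells_def)
next
  case (Suc n)
  have "map of_bool (f n) = map (\<lambda>a. of_bool (f (a div d) ! (a mod d))) [n * d..<n * d + d]"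
    by (rule nth_equalityI) (use Suc.prems in auto)
  moreover have "[0..<Suc n * d] = [0..<n * d] @ [n * d..<n * d + d]"
    using upt_add_eq_append[of 0 "n * d" d] by (simp add: add.commute)
  ultimately show ?case using Suc by (simp add: tuple_cells_def)
qed

lemma list_array_tuple_cells:
  assumes "\<And>v. v < n \<Longrightarrow> length (f v) = d" and "v < n" "y < d"
  shows "list_array (tuple_cells n f) (v * d + y) = of_bool (f v ! y)"
proof -
  have "v * d + y < Suc v * d" using assms by simp
  also have "\<dots> \<le> n * d" using assms by (intro mult_le_mono) auto
  finally show ?thesis using assms by (simp add: list_array_def tuple_cells_eq[OF assms(1)])
qed

text \<open>After inserting \<open>k \<le> n * n\<close>, the left side is a cubic polynomial with
  leading coefficient 2. The cube of \<open>n + 2\<close> would be too small for large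
  \<open>n\<close>; its fourth power dominates coefficient by coefficient.\<close>

lemma word_size:
  fixes n k W :: nat
  assumes "(n + 2) ^ 4 \<le> W" "k \<le> n * n"
  shows "n * (2 * k + 2) + 2 * k + n + 8 \<le> W"
proof -
  have "n * (2 * k + 2) + 2 * k + n + 8 \<le> n * (2 * (n * n) + 2) + 2 * (n * n) + n + 8"
    using assms(2) by (intro add_mono mult_le_mono) auto
  also have "\<dots> \<le> (n + 2) ^ 4"
    by (simp add: power4_eq_xxxx algebra_simps)
  finally show ?thesis using assms(1) by linarith
qed

text \<open>For positive \<open>k\<close> and \<open>n\<close> every nonconstant monomial is at most
  \<open>k * k * n\<close>, and the coefficients add up to less than 1000. The summand 1 absorbs the
  constant and the case \<open>k = 0\<close>, where there is at most one vertex.\<close>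

lemma time_bound:
  fixes n k t :: nat
  assumes "t \<le> 38 + k * (474 + n * 86) + k * k * (300 + n * 40) + n * 14"
    and "k \<noteq> 0 \<Longrightarrow> n \<noteq> 0" "k = 0 \<Longrightarrow> n \<le> 1"
  shows "t \<le> 1000 * (k ^ 2 * n + 1)"
proof (cases "k = 0")
  case True
  then show ?thesis using assms(1,3) by simp
next
  case False
  define N where "N = k * k * n"
  have "1 \<le> k" "1 \<le> n" using False assms(2) by auto
  then have "k * 1 * 1 \<le> N" "k * 1 * n \<le> N" "k * k * 1 \<le> N" "1 * 1 * n \<le> N"
    unfolding N_def by (intro mult_le_mono; simp)+
  moreover have "t \<le> 38 + 474 * k + 86 * (k * n) + 300 * (k * k) + 40 * N + 14 * n"
    using assms(1) by (simp add: N_def algebra_simps)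
  ultimately show ?thesis by (simp add: power2_eq_square flip: N_def)
qed

theorem theorem4p9:
  shows "\<exists>(P :: com) (c :: nat) (C :: nat).
    \<forall>(n :: nat) (k :: nat) (G :: nat pair_pre_digraph) (L :: nat list list)
      (\<phi> :: nat \<Rightarrow> bool list) (w :: nat).
      pair_graph G \<and> pverts G = {..<n} \<and> partial_cube (with_proj G) \<and>
      adjacency_lists n G L \<and>
      k = idim (with_proj G) \<and> isometric_embedding \<phi> (with_proj G) (cube k) \<and>
      (n + 2) ^ c \<le> 2 ^ w
      \<longrightarrow>
      (\<exists>(t :: nat) (s' :: ram_state) (f' :: nat) (\<psi> :: nat \<Rightarrow> bool list).
        exec w P (input_state n k L \<phi>) t s' \<and>
        t \<le> C * (k ^ 2 * n + 1) \<and>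
        output_state s' n f' \<psi> \<and>
        isometric_embedding \<psi> (with_proj G) (fib_cube f') \<and>
        real f' \<le> 3 / 2 * real (fdim (with_proj G)))"
proof (rule exI[of _ program], rule exI[of _ 4], rule exI[of _ 1000], intro allI impI, elim conjE)
  fix n k G L \<phi> w
  assume G: "pair_graph G" "pverts G = {..<n}" and k: "k = idim (with_proj G)"
    and emb: "isometric_embedding \<phi> (with_proj G) (cube k)" and w: "(n + 2) ^ 4 \<le> (2 :: nat) ^ w"
  let ?G = "with_proj G"
  have verts: "verts ?G = {..<n}" using G(2) by simp
  have len: "length (\<phi> v) = k" if "v < n" for v
    using emb that verts by (simp add: isometric_embedding_cube_iff)
  interpret pair_graph G by (rule G(1))
  have ce: "coordinate_edges ?G \<phi> k"
    using idim_coordinate_edges[OF wf_digraph_axioms k emb] .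
  have kn: "k \<le> n * n" using coordinate_edges_bound[OF emb ce] verts by simp
  let ?A = "coordinate_set n \<phi>"
  interpret A: set_family n k ?A
    by (rule set_family_coordinates[OF verts emb ce])
  have cell: "list_array (tuple_cells n \<phi>) (v * k + y) = of_bool (\<phi> v ! y)"
    if "v < n" "y < k" for v y
    by (rule list_array_tuple_cells) (use len that in auto)
  interpret R: ram_input n k ?A w "2 ^ w" "list_array (tuple_cells n \<phi>)"
  proof
    show "n * (2 * k + 2) + 2 * k + n + 8 \<le> 2 ^ w" by (rule word_size[OF w kn])
    fix v y assume "v < n" "y < k"
    moreover have "0 < n" using \<open>v < n\<close> by simp
    ultimately show "list_array (tuple_cells n \<phi>) (v * k + y) \<noteq> list_array (tuple_cells n \<phi>) y \<longleftrightarrow>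
        v \<in> ?A y"
      using cell[of v y] cell[of 0 y] by (simp add: coordinate_set_def)
  qed simp
  have n: "n \<noteq> 0" if "k \<noteq> 0" using kn that by (cases n) auto
  \<comment> \<open>For \<open>k = 0\<close> all strings are empty, so injectivity leaves room for
    one vertex only.\<close>
  have n1: "n \<le> 1" if "k = 0"
  proof (rule ccontr)
    assume "\<not> n \<le> 1"
    then have "\<phi> 0 = \<phi> 1" "0 \<in> verts ?G" "1 \<in> verts ?G" using len that verts by auto
    then show False using emb by (auto simp: isometric_embedding_def dest: inj_onD)
  qed
  have "wp w program (\<lambda>t s'. \<exists>f' \<psi>. t \<le> 1000 * (k ^ 2 * n + 1) \<and> output_state s' n f' \<psi> \<and>
      isometric_embedding \<psi> ?G (fib_cube f') \<and> real f' \<le> 3 / 2 * real (fdim ?G))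
      (input_state n k L \<phi>)"
  proof (rule R.wp_program, goal_cases)
    case (5 t s' pid pos len sg)
    let ?f = "A.offset len (Suc k) - 1"
    let ?\<psi> = "A.layout_string pid pos len sg"
    have c: "A.chains pid pos len sg" using 5(2) by (simp add: A.valid_def)
    have "mem s' ''out'' a = of_bool (?\<psi> (a div ?f) ! (a mod ?f))" if a: "a < n * ?f" for a
    proof -
      have f: "0 < ?f" using a by (cases ?f) auto
      have less: "a div ?f < n" "a mod ?f < ?f"
        using a f by (auto simp: less_mult_imp_div_less)
      \<comment> \<open>Places are below the length of a string, so quotient and remainder of the
        address recover the vertex and the place.\<close>
      have "(\<exists>v<n. \<exists>y<k. a = v * ?f + A.place pid pos len y \<and> v \<in> A.signed (sg y) y) \<longleftrightarrow>
          (\<exists>y<k. A.place pid pos len y = a mod ?f \<and> a div ?f \<in> A.signed (sg y) y)"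
      proof
        assume "\<exists>v<n. \<exists>y<k. a = v * ?f + A.place pid pos len y \<and> v \<in> A.signed (sg y) y"
        then obtain v y where vy: "y < k" "a = v * ?f + A.place pid pos len y" "v \<in> A.signed (sg y) y"
          by blast
        then have "A.place pid pos len y < ?f" using A.place_bound[OF c 5(3)] by blast
        then have "a div ?f = v" "a mod ?f = A.place pid pos len y" using vy by auto
        then show "\<exists>y<k. A.place pid pos len y = a mod ?f \<and> a div ?f \<in> A.signed (sg y) y"
          using vy by auto
      next
        assume "\<exists>y<k. A.place pid pos len y = a mod ?f \<and> a div ?f \<in> A.signed (sg y) y"
        then obtain y where y: "y < k" "A.place pid pos len y = a mod ?f" "a div ?f \<in> A.signed (sg y) y"
          by blast
        then have "a = (a div ?f) * ?f + A.place pid pos len y" by (metis div_mult_mod_eq)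
        then show "\<exists>v<n. \<exists>y<k. a = v * ?f + A.place pid pos len y \<and> v \<in> A.signed (sg y) y"
          using y less by blast
      qed
      then show ?thesis using less(2) by (simp add: 5(5) A.layout_string_def)
    qed
    then have "map (mem s' ''out'') [0..<n * ?f] = tuple_cells n ?\<psi>"
      by (subst tuple_cells_eq[where d = ?f]) (auto simp: A.length_layout_string)
    moreover have "2 * ?f \<le> 3 * fdim ?G"
      by (rule layout_near_optimal[OF verts emb ce 5(2,3)])
    then have "real ?f \<le> 3 / 2 * real (fdim ?G)" by linarith
    moreover have "isometric_embedding ?\<psi> ?G (fib_cube ?f)"
      by (rule layout_isometric_embedding[OF verts emb ce c 5(3)])
    ultimately show ?case
      using time_bound[OF 5(1) n n1] 5(4) unfolding output_state_def by blast
  qed (simp_all add: R.has_input_def input_state_def)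
  then show "\<exists>t s' f' \<psi>. exec w program (input_state n k L \<phi>) t s' \<and>
      t \<le> 1000 * (k ^ 2 * n + 1) \<and> output_state s' n f' \<psi> \<and>
      isometric_embedding \<psi> ?G (fib_cube f') \<and> real f' \<le> 3 / 2 * real (fdim ?G)"
    unfolding wp_def by blast
qed

end
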